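(* Let $f$ satisfy the adaptive harmonic model with $M\ge1$ components, let $\Phi$ be a stationary Gaussian noise that satisfies the noise conditions (i), (ii) and (iii) of the context, let $\psi$ be a regular analytic wavelet, and let $Y=f+\Phi$. For every $m\in\{1,\ldots,M\}$, $t\in\mathbb{R}$ and $B_m(t)\subset(\underline{\mathfrak i}_m(t),\overline{\mathfrak i}_m(t))$, let $$L_m=\min_{s\in B_m(t)}\left|\frac{\partial^2S_f}{\partial s^2}(t,s)\right|,$$ let $B_m^\circ(t)$ be the interior of $B_m(t)$ and $\partial B_m(t)=B_m(t)\setminus B_m^\circ(t)$ the set of its two endpoints, and put $$\triangle=|W_f(t,s_{f,m}(t))|-\max_{s\in\partial B_m(t)}|W_f(t,s)|,\qquad \mu=\mathbb{E}\left[|W_\Phi(t,s_{f,m}(t))|\right]+\mathbb{E}\Big[\max_{s\in\partial B_m(t)}|W_\Phi(t,s)|\Big],$$ $$\sigma=\sqrt{\mathbb{E}\left[|W_\Phi(t,s_{f,m}(t))|^2\right]}+\max_{s\in\partial B_m(t)}\sqrt{\mathbb{E}\left[|W_\Phi(t,s)|^2\right]}.$$ Then for any $\varepsilon>0$ with $$\min_{s\in\partial B_m(t)}|s-s_{f,m}(t)|>\varepsilon>\frac{6}{L_m}\max\left\{\mu_{1,m},\mu_{2,m},\mu_{3,m}^2,\mu_{4,m}^2\right\},$$ we have $$\mathbb{P}\left(|s_{Y,m}(t)-s_{f,m}(t)|>\varepsilon\ \middle|\ s_{Y,m}(t)\in B_m^\circ(t)\right)\le\left[1-\exp\left(-\frac{(\triangle-\mu)^2}{\sigma^2}\right)\right]^{-1}$$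 $$\times\left\{\sum_{k=1}^2\exp\left[-\frac{L_m^2}{\sigma_{k,m}^2}\left(\frac{\varepsilon}{6}-\frac{\mu_{k,m}}{L_m}\right)^2\right]+\sum_{k=3}^4\exp\left[-\frac{L_m}{\sigma_{k,m}^2}\left(\sqrt{\frac{\varepsilon}{6}}-\frac{\mu_{k,m}}{\sqrt{L_m}}\right)^2\right]\right\}.$$
   Context: **Noise conditions.** (i) $\Phi=\{\Phi(t)\}_{t\in\mathbb{R}}$ is a real-valued, mean-square continuous, stationary Gaussian process whose covariance has a spectral density $p:\mathbb{R}\to(0,\infty)$, i.e. $\mathrm{Cov}(\Phi(t),\Phi(0))=\int_{\mathbb{R}}e^{it\lambda}p(\lambda)\,d\lambda$. (ii) There are $\gamma\in(0,2)$ and $C_1>0$ with $p(\lambda)\le C_1|\lambda|^{-(1+\gamma)}$ for all $\lambda\ne0$. (iii) One of the following holds: (long-range dependence) $p(\lambda)=L(|\lambda|^{-1})|\lambda|^{H-1}$ with $H\in(0,1)$ and $L:(0,\infty)\to(0,\infty)$ locally bounded and slowly varying at infinity, i.e. $L(cr)/L(r)\to1$ as $r\to\infty$ for every $c>0$; or (short-range dependence) $p$ is bounded and continuous at the origin. **Regular analytic wavelet.** $\psi\in L^1(\mathbb{R})\cap L^2(\mathbb{R})$, with Fourier transform $\widehat\psi(\omega)=\int_{\mathbb{R}}e^{-it\omega}\psi(t)\,dt$ satisfying $\widehat\psi(\omega)=0$ for $\omega\le0$ (analyticity); $\widehat\psi$ is three times differentiable on $(0,\infty)$ with $\sup_{\lambda>0}|\lambda^{q}\widehat\psi(\lambda)|<\infty$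 for $q=1,2$; $\sup_{\lambda>0}|\lambda^{q}D\widehat\psi(\lambda)|<\infty$ for $q=0,1,2$; $\sup_{\lambda>0}|\lambda^{q}D^2\widehat\psi(\lambda)|<\infty$ for $q=2,3$; $\sup_{\lambda>0}|\lambda^{3}D^3\widehat\psi(\lambda)|<\infty$ ($D^k$ is the $k$th derivative); and $|\widehat\psi|$ is unimodal (so that it has a single maximizer). **Analytic wavelet transform (AWT) and scalogram.** $W_f(t,s)=\int_{\mathbb{R}}f(\tau)\frac1s\overline{\psi\left(\frac{\tau-t}{s}\right)}d\tau$ for $t\in\mathbb{R}$, $s>0$; $W_\Phi$ and $W_Y$ are defined by the same formula, so $W_Y=W_f+W_\Phi$. One has $W_\Phi(t,s)=\int_0^\infty e^{it\lambda}\overline{\widehat\psi(s\lambda)}\sqrt{p(\lambda)}\,Z(d\lambda)$, where $Z$ is an orthogonally scattered Gaussian random measure on $\mathbb{R}$ with $Z(\Delta)=\overline{Z(-\Delta)}$, $\mathbb{E}[Z(\Delta)]=0$, $\mathbb{E}[Z(\Delta_1)\overline{Z(\Delta_2)}]=\mathrm{Leb}(\Delta_1\cap\Delta_2)$. Scalograms: $S_f=|W_f|^2$, $S_Y=|W_Y|^2$. **Adaptive harmonic model (AHM).** $f(t)=\sum_{m=1}^M A_m(t)\cos(2\pi\phi_m(t))$, where $A_m\in C^1(\mathbb{R})$ are positive, $\phi_m\in C^2(\mathbb{R})$ are strictly increasing with $\phi_m'>0$, $|A_m'(t)|\le\epsilon_0\phi_m'(t)$ and $|\phi_m''(t)|\le\epsilon_0\phi_m'(t)$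 for a small constant $\epsilon_0\ge0$, and, if $M>1$, $\phi_1'(t)<\cdots<\phi_M'(t)$ with $\phi_{m+1}'(t)-\phi_m'(t)\ge\delta(\phi_{m+1}'(t)+\phi_m'(t))$ for some $\delta\in(0,1)$ and all $t$. **Scale bands and ridge points.** $\omega_\psi=\frac1{2\pi}\arg\max_{\omega>0}|\widehat\psi(\omega)|$. $B_m(t)=[\underline b_m(t),\overline b_m(t)]$, $1\le m\le M$, are given with $\underline b_m,\overline b_m$ continuous on $\mathbb{R}$, $\omega_\psi/\phi_m'(t)\in B_m(t)$, and $0<\underline b_M(t)<\overline b_M(t)\le\cdots\le\underline b_1(t)<\overline b_1(t)<\infty$ for all $t$. The scalogram $S_f(t,\cdot)$ is supposed to have $M$ well-separated local maxima at each time, the $m$th being $s_{f,m}(t)=\arg\max_{s\in B_m(t)}S_f(t,s)$, a ridge point of $S_f$, that is, $\partial_sS_f(t,s_{f,m}(t))=0$ and $\partial_s^2S_f(t,s_{f,m}(t))<0$. $s_{Y,m}(t)=\arg\max_{s\in B_m(t)}S_Y(t,s)$. $\underline{\mathfrak i}_m(t)<s_{f,m}(t)<\overline{\mathfrak i}_m(t)$ are the inflection points of $S_f(t,\cdot)$ closest to $s_{f,m}(t)$ on either side. **Constants** (for fixed $t$, $m$): $\mu_{1,m}=\mathbb{E}\big[\max_{s\in B_m(t)}|\frac{\partial W_f}{\partial s}(t,s)W_\Phi(t,s)|\big]$, $\ \sigma_{1,m}^2=\max_{s\in B_m(t)}|\frac{\partial W_f}{\partial s}(t,s)|^2\,\mathbb{E}[|W_\Phi(t,s)|^2]$;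 $\mu_{2,m}=\mathbb{E}\big[\max_{s\in B_m(t)}|W_f(t,s)\frac{\partial W_\Phi}{\partial s}(t,s)|\big]$, $\ \sigma_{2,m}^2=\max_{s\in B_m(t)}|W_f(t,s)|^2\,\mathbb{E}[|\frac{\partial W_\Phi}{\partial s}(t,s)|^2]$; $\mu_{3,m}=\mathbb{E}\big[\max_{s\in B_m(t)}|W_\Phi(t,s)|\big]$, $\ \sigma_{3,m}^2=\max_{s\in B_m(t)}\mathbb{E}[|W_\Phi(t,s)|^2]$; $\mu_{4,m}=\mathbb{E}\big[\max_{s\in B_m(t)}|\frac{\partial W_\Phi}{\partial s}(t,s)|\big]$, $\ \sigma_{4,m}^2=\max_{s\in B_m(t)}\mathbb{E}[|\frac{\partial W_\Phi}{\partial s}(t,s)|^2]$; where $\mathbb{E}[|W_\Phi(t,s)|^2]=\int_0^\infty|\widehat\psi(s\lambda)|^2p(\lambda)d\lambda$ and $\mathbb{E}[|\frac{\partial W_\Phi}{\partial s}(t,s)|^2]=\int_0^\infty|\lambda[D\widehat\psi](s\lambda)|^2p(\lambda)d\lambda$. *)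

theory Defs
  imports "HOL-Probability.Probability"
begin

definition fourier :: "(real \<Rightarrow> complex) \<Rightarrow> real \<Rightarrow> complex" where
  "fourier psi \<omega> = (LINT t|lborel. exp (- (\<i> * of_real (t * \<omega>))) * psi t)"

definition fourier_D :: "nat \<Rightarrow> (real \<Rightarrow> complex) \<Rightarrow> real \<Rightarrow> complex" where
  "fourier_D k psi = ((\<lambda>g x. vector_derivative g (at x)) ^^ k) (fourier psi)"

text \<open>Only weak monotonicity is required on the two sides of the peak, so that band-limited
  wavelets are included; uniqueness of the maximizer is a separate clause.\<close>

definition unimodal :: "(real \<Rightarrow> real) \<Rightarrow> bool" where
  "unimodal g \<longleftrightarrow> (\<exists>w>0. mono_on {0<..w} g \<and> antimono_on {w..} g
      \<and> (\<forall>v>0. v \<noteq> w \<longrightarrow> g v < g w))"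

definition regular_analytic_wavelet :: "(real \<Rightarrow> complex) \<Rightarrow> bool" where
  "regular_analytic_wavelet psi \<longleftrightarrow>
     integrable lborel psi \<and> integrable lborel (\<lambda>t. (norm (psi t))\<^sup>2)
   \<and> (\<forall>\<omega>\<le>0. fourier psi \<omega> = 0)
   \<and> (\<forall>k<3. \<forall>x>0. fourier_D k psi differentiable at x)
   \<and> (\<forall>(k, q) \<in> {(0, 1), (0, 2), (1, 0), (1, 1), (1, 2), (2, 2), (2, 3), (3, 3)}.
        bdd_above ((\<lambda>x. norm (of_real (x ^ q) * fourier_D k psi x)) ` {0<..}))
   \<and> unimodal (\<lambda>x. norm (fourier psi x))"

definition peak_frequency :: "(real \<Rightarrow> complex) \<Rightarrow> real" where
  "peak_frequency psi = arg_max (\<lambda>\<omega>. norm (fourier psi \<omega>)) (\<lambda>\<omega>. \<omega> > 0) / (2 * pi)"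

definition awt_integrand :: "(real \<Rightarrow> complex) \<Rightarrow> (real \<Rightarrow> real) \<Rightarrow> real \<Rightarrow> real \<Rightarrow> real \<Rightarrow> complex" where
  "awt_integrand psi x t s \<tau> = of_real (x \<tau>) * of_real (1 / s) * cnj (psi ((\<tau> - t) / s))"

definition awt :: "(real \<Rightarrow> complex) \<Rightarrow> (real \<Rightarrow> real) \<Rightarrow> real \<Rightarrow> real \<Rightarrow> complex" where
  "awt psi x t s = (LINT \<tau>|lborel. awt_integrand psi x t s \<tau>)"

definition scalogram :: "(real \<Rightarrow> complex) \<Rightarrow> (real \<Rightarrow> real) \<Rightarrow> real \<Rightarrow> real \<Rightarrow> real" where
  "scalogram psi x t s = (norm (awt psi x t s))\<^sup>2"

text \<open>The adaptive harmonic model lets amplitudes and frequencies grow exponentially, so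
  convergence of the integrals defining \<open>W\<^sub>f\<close> and the scale-regularity that gives meaning to
  \<open>\<partial>\<^sub>s W\<^sub>f\<close>, \<open>\<partial>\<^sub>s S\<^sub>f\<close>, \<open>\<partial>\<^sub>s\<^sup>2 S\<^sub>f\<close> and to their extrema over compact
  scale bands are not automatic.\<close>

definition awt_regular :: "(real \<Rightarrow> complex) \<Rightarrow> (real \<Rightarrow> real) \<Rightarrow> bool" where
  "awt_regular psi x \<longleftrightarrow> (\<forall>t.
     (\<forall>s>0. integrable lborel (awt_integrand psi x t s))
   \<and> awt psi x t C1_differentiable_on {0<..}
   \<and> deriv (scalogram psi x t) C1_differentiable_on {0<..})"

definition adaptive_harmonic_model ::
  "real \<Rightarrow> real \<Rightarrow> nat \<Rightarrow> (nat \<Rightarrow> real \<Rightarrow> real) \<Rightarrow> (nat \<Rightarrow> real \<Rightarrow> real) \<Rightarrow> (real \<Rightarrow> real) \<Rightarrow> bool" where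
  "adaptive_harmonic_model eps0 delta N A phi f \<longleftrightarrow>
     N \<ge> 1 \<and> eps0 \<ge> 0
   \<and> (\<forall>t. f t = (\<Sum>m = 1..N. A m t * cos (2 * pi * phi m t)))
   \<and> (\<forall>m\<in>{1..N}.
        A m C1_differentiable_on UNIV
      \<and> phi m C1_differentiable_on UNIV \<and> deriv (phi m) C1_differentiable_on UNIV
      \<and> strict_mono (phi m)
      \<and> (\<forall>t. A m t > 0 \<and> deriv (phi m) t > 0
           \<and> \<bar>deriv (A m) t\<bar> \<le> eps0 * deriv (phi m) t
           \<and> \<bar>deriv (deriv (phi m)) t\<bar> \<le> eps0 * deriv (phi m) t))
   \<and> (N > 1 \<longrightarrow> 0 < delta \<and> delta < 1
      \<and> (\<forall>m\<in>{1..<N}. \<forall>t. deriv (phi m) t < deriv (phi (Suc m)) t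
           \<and> deriv (phi (Suc m)) t - deriv (phi m) t
               \<ge> delta * (deriv (phi (Suc m)) t + deriv (phi m) t)))"

text \<open>Constants count as degenerate Gaussians.\<close>

definition gaussian_rv :: "'w measure \<Rightarrow> ('w \<Rightarrow> real) \<Rightarrow> bool" where
  "gaussian_rv P X \<longleftrightarrow> X \<in> borel_measurable P
     \<and> ((\<exists>a sd. sd > 0 \<and> distributed P lborel X (normal_density a sd))
        \<or> (\<exists>a. AE \<omega> in P. X \<omega> = a))"

definition gaussian_process :: "'w measure \<Rightarrow> (real \<Rightarrow> 'w \<Rightarrow> real) \<Rightarrow> bool" where
  "gaussian_process P Phi \<longleftrightarrow>
     (\<forall>J c. finite J \<longrightarrow> gaussian_rv P (\<lambda>\<omega>. \<Sum>t\<in>J. c t * Phi t \<omega>))"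

definition stationary_process :: "'w measure \<Rightarrow> (real \<Rightarrow> 'w \<Rightarrow> real) \<Rightarrow> bool" where
  "stationary_process P Phi \<longleftrightarrow> (\<forall>J h. finite J \<longrightarrow>
     distr P (Pi\<^sub>M J (\<lambda>_. borel)) (\<lambda>\<omega>. \<lambda>t\<in>J. Phi (t + h) \<omega>)
   = distr P (Pi\<^sub>M J (\<lambda>_. borel)) (\<lambda>\<omega>. \<lambda>t\<in>J. Phi t \<omega>))"

definition mean_square_continuous :: "'w measure \<Rightarrow> (real \<Rightarrow> 'w \<Rightarrow> real) \<Rightarrow> bool" where
  "mean_square_continuous P Phi \<longleftrightarrow>
     (\<forall>t. integrable P (\<lambda>\<omega>. (Phi t \<omega>)\<^sup>2))
   \<and> (\<forall>t. ((\<lambda>u. LINT \<omega>|P. (Phi u \<omega> - Phi t \<omega>)\<^sup>2) \<longlongrightarrow> 0) (at t))"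

definition covariance :: "'w measure \<Rightarrow> ('w \<Rightarrow> real) \<Rightarrow> ('w \<Rightarrow> real) \<Rightarrow> real" where
  "covariance P X Y = (LINT \<omega>|P. (X \<omega> - (LINT w|P. X w)) * (Y \<omega> - (LINT w|P. Y w)))"

definition has_spectral_density ::
  "'w measure \<Rightarrow> (real \<Rightarrow> 'w \<Rightarrow> real) \<Rightarrow> (real \<Rightarrow> real) \<Rightarrow> bool" where
  "has_spectral_density P Phi p \<longleftrightarrow> (\<forall>l. p l > 0) \<and> integrable lborel p
   \<and> (\<forall>t. complex_of_real (covariance P (Phi t) (Phi 0))
          = (LINT l|lborel. exp (\<i> * of_real (t * l)) * of_real (p l)))"

definition slowly_varying :: "(real \<Rightarrow> real) \<Rightarrow> bool" where
  "slowly_varying L \<longleftrightarrow> (\<forall>c>0. ((\<lambda>r. L (c * r) / L r) \<longlongrightarrow> 1) at_top)"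

text \<open>The singular power law is required off the origin only.\<close>

definition long_range_dependent :: "(real \<Rightarrow> real) \<Rightarrow> bool" where
  "long_range_dependent p \<longleftrightarrow> (\<exists>H L. 0 < H \<and> H < 1 \<and> (\<forall>r>0. L r > 0)
     \<and> (\<forall>K. compact K \<and> K \<subseteq> {0<..} \<longrightarrow> bounded (L ` K)) \<and> slowly_varying L
     \<and> (\<forall>l. l \<noteq> 0 \<longrightarrow> p l = L (1 / \<bar>l\<bar>) * \<bar>l\<bar> powr (H - 1)))"

definition short_range_dependent :: "(real \<Rightarrow> real) \<Rightarrow> bool" where
  "short_range_dependent p \<longleftrightarrow> bounded (range p) \<and> isCont p 0"

text \<open>Joint measurability of the noise, without which the pathwise integral defining its wavelet
  transform has no meaning, is no loss: a mean-square continuous process has a jointly measurable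
  modification.\<close>

definition noise_conditions ::
  "'w measure \<Rightarrow> (real \<Rightarrow> 'w \<Rightarrow> real) \<Rightarrow> (real \<Rightarrow> real) \<Rightarrow> bool" where
  "noise_conditions P Phi p \<longleftrightarrow>
     (\<lambda>(\<tau>, \<omega>). Phi \<tau> \<omega>) \<in> borel_measurable (lborel \<Otimes>\<^sub>M P)
   \<and> gaussian_process P Phi \<and> stationary_process P Phi \<and> mean_square_continuous P Phi
   \<and> has_spectral_density P Phi p
   \<and> (\<exists>g C. 0 < g \<and> g < 2 \<and> C > 0 \<and> (\<forall>l. l \<noteq> 0 \<longrightarrow> p l \<le> C * \<bar>l\<bar> powr (- (1 + g))))
   \<and> (long_range_dependent p \<or> short_range_dependent p)"

text \<open>The integral defining the transform of the noise converges, for each \<open>(t, s)\<close>, almost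
  surely. Suprema over the scale and the sample derivative in the scale refer, as usual, to a
  modification with smooth sample paths.\<close>

definition awt_version ::
  "'w measure \<Rightarrow> (real \<Rightarrow> complex) \<Rightarrow> (real \<Rightarrow> 'w \<Rightarrow> real) \<Rightarrow> (real \<Rightarrow> real \<Rightarrow> 'w \<Rightarrow> complex) \<Rightarrow> bool" where
  "awt_version P psi Phi W \<longleftrightarrow>
     (\<forall>t. \<forall>s>0. W t s \<in> borel_measurable P
        \<and> (AE \<omega> in P. W t s \<omega> = awt psi (\<lambda>\<tau>. Phi \<tau> \<omega>) t s))
   \<and> (\<forall>t. \<forall>\<omega>\<in>space P. (\<lambda>s. W t s \<omega>) C1_differentiable_on {0<..})"

definition scale_bands ::
  "(real \<Rightarrow> complex) \<Rightarrow> nat \<Rightarrow> (nat \<Rightarrow> real \<Rightarrow> real) \<Rightarrow> (nat \<Rightarrow> real \<Rightarrow> real) \<Rightarrow> (nat \<Rightarrow> real \<Rightarrow> real) \<Rightarrow> bool" where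
  "scale_bands psi N phi lo hi \<longleftrightarrow>
     (\<forall>m\<in>{1..N}. continuous_on UNIV (lo m) \<and> continuous_on UNIV (hi m)
        \<and> (\<forall>t. lo m t < hi m t \<and> peak_frequency psi / deriv (phi m) t \<in> {lo m t..hi m t}))
   \<and> (\<forall>t. 0 < lo N t) \<and> (\<forall>m\<in>{1..<N}. \<forall>t. hi (Suc m) t \<le> lo m t)"

definition ridge_points ::
  "(real \<Rightarrow> real \<Rightarrow> real) \<Rightarrow> nat \<Rightarrow> (nat \<Rightarrow> real \<Rightarrow> real) \<Rightarrow> (nat \<Rightarrow> real \<Rightarrow> real) \<Rightarrow> (nat \<Rightarrow> real \<Rightarrow> real) \<Rightarrow> bool" where
  "ridge_points S N lo hi r \<longleftrightarrow> (\<forall>m\<in>{1..N}. \<forall>t.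
     is_arg_max (S t) (\<lambda>s. s \<in> {lo m t..hi m t}) (r m t)
   \<and> deriv (S t) (r m t) = 0 \<and> deriv (deriv (S t)) (r m t) < 0)"

definition inflection_point :: "(real \<Rightarrow> real) \<Rightarrow> real \<Rightarrow> bool" where
  "inflection_point g x \<longleftrightarrow> (\<exists>d>0. \<forall>y\<in>{x - d<..<x}. \<forall>z\<in>{x<..<x + d}.
     deriv (deriv g) y * deriv (deriv g) z < 0)"

definition closest_inflection_points :: "(real \<Rightarrow> real) \<Rightarrow> real \<Rightarrow> real \<Rightarrow> real \<Rightarrow> bool" where
  "closest_inflection_points g x a b \<longleftrightarrow> 0 < a \<and> a < x \<and> x < b
     \<and> inflection_point g a \<and> inflection_point g b
     \<and> (\<forall>y\<in>{a<..<b}. \<not> inflection_point g y)"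

text \<open>Below, \<open>Wf\<close> and \<open>W\<close> are functions of the scale (and the sample point). Maxima over the
  compact band \<open>B\<close>, and over its two endpoints, are written as suprema of the continuous functions
  concerned.\<close>

abbreviation dscale :: "(real \<Rightarrow> complex) \<Rightarrow> real \<Rightarrow> complex" where
  "dscale g s \<equiv> vector_derivative g (at s)"

definition mu_const ::
  "'w measure \<Rightarrow> real set \<Rightarrow> (real \<Rightarrow> complex) \<Rightarrow> (real \<Rightarrow> 'w \<Rightarrow> complex) \<Rightarrow> nat \<Rightarrow> real" where
  "mu_const P B Wf W k =
    (if k = 1 then LINT \<omega>|P. (SUP s\<in>B. norm (dscale Wf s * W s \<omega>))
     else if k = 2 then LINT \<omega>|P. (SUP s\<in>B. norm (Wf s * dscale (\<lambda>s. W s \<omega>) s))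
     else if k = 3 then LINT \<omega>|P. (SUP s\<in>B. norm (W s \<omega>))
     else LINT \<omega>|P. (SUP s\<in>B. norm (dscale (\<lambda>s. W s \<omega>) s)))"

definition sigma2_const ::
  "'w measure \<Rightarrow> real set \<Rightarrow> (real \<Rightarrow> complex) \<Rightarrow> (real \<Rightarrow> 'w \<Rightarrow> complex) \<Rightarrow> nat \<Rightarrow> real" where
  "sigma2_const P B Wf W k =
    (if k = 1 then SUP s\<in>B. (norm (dscale Wf s))\<^sup>2 * (LINT \<omega>|P. (norm (W s \<omega>))\<^sup>2)
     else if k = 2 then SUP s\<in>B. (norm (Wf s))\<^sup>2 * (LINT \<omega>|P. (norm (dscale (\<lambda>s. W s \<omega>) s))\<^sup>2)
     else if k = 3 then SUP s\<in>B. (LINT \<omega>|P. (norm (W s \<omega>))\<^sup>2)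
     else SUP s\<in>B. (LINT \<omega>|P. (norm (dscale (\<lambda>s. W s \<omega>) s))\<^sup>2))"

end

theory Submission
  imports Defs
begin

text \<open>
  Write \<open>N = 2 Re (\<partial>\<^sub>s (W\<^sub>f cnj W\<^sub>\<Phi>) + \<partial>\<^sub>s W\<^sub>\<Phi> cnj W\<^sub>\<Phi>)\<close> for the derivative of \<open>S\<^sub>Y - S\<^sub>f\<close>.
  On the band \<open>S\<^sub>f\<close> is strictly concave with \<open>S\<^sub>f'' \<le> -L\<close>, so \<open>|S\<^sub>f'(s\<^sub>Y)| \<ge> L |s\<^sub>Y - s\<^sub>f|\<close>, and
  maximality of \<open>s\<^sub>Y\<close> gives \<open>|N(s\<^sub>Y)| \<ge> L |s\<^sub>Y - s\<^sub>f|\<close>, also when \<open>s\<^sub>Y\<close> is an endpoint of the band. Both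
  the event that \<open>s\<^sub>Y\<close> is interior with \<open>|s\<^sub>Y - s\<^sub>f| > \<epsilon>\<close> and the disjoint event that \<open>s\<^sub>Y\<close> is an endpoint
  therefore force one of the four suprema behind \<open>\<mu>\<^sub>1, \<dots>, \<mu>\<^sub>4\<close> above its threshold, so the sum of their probabilities is at most the sum
  \<open>S\<close> of the four exponentials. This bounds the conditional probability by \<open>S\<close> itself, and the factor
  \<open>[1 - exp(-(\<triangle> - \<mu>)\<^sup>2 / \<sigma>\<^sup>2)]\<^sup>-\<^sup>1 \<ge> 1\<close> is free.

  The tail bounds are the Borell--TIS inequality. Since the wavelet is analytic, \<open>W\<^sub>\<Phi>\<close> and
  \<open>\<partial>\<^sub>s W\<^sub>\<Phi>\<close> are circular, so \<open>|Z|\<close> is a supremum over rotations of real Gaussians of variance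
  \<open>E |Z|\<^sup>2 / 2\<close>, which yields the exponent \<open>u\<^sup>2 / \<sigma>\<^sup>2\<close> instead of \<open>u\<^sup>2 / (2 \<sigma>\<^sup>2)\<close>. Borell--TIS
  follows from \<open>E exp F(X) \<le> exp (E F(X) + v / 2)\<close> for smooth \<open>F\<close> whose gradient pairs with \<open>X\<close> to variance
  at most \<open>v\<close>; this holds up to \<open>O(t\<^sup>3\<^sup>/\<^sup>2)\<close> for \<open>sqrt t X\<close> by Taylor expansion, and is transported to
  \<open>t = 1\<close> by writing \<open>sqrt (2 t) X\<close> as a sum of two independent copies of \<open>sqrt t X\<close>.
\<close>

section \<open>Gaussian laws are determined by linear functionals\<close>

text \<open>Two obstacles shape the development. The exponential inequality is wanted for Gaussian
  vectors with arbitrary, possibly singular covariance, of which only bounds on the single variances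
  are at hand. So no passage to independent coordinates is made: gradients are measured in the l1
  norm, for which Cauchy-Schwarz with the weights \<open>\<bar>b i\<bar>\<close> bounds the second
  moment of a linear form by those of its coordinates. Independence enters only when two copies of
  one law are added, and the law of the sum is identified by its linear functionals; hence the
  Cramer-Wold theorem at the start. A log-sum-exp smoothing of the maximum fits this setting: its
  gradient is a probability vector, and its curvature, which explodes as the smoothing is removed,
  is absent from the final bound.

  Secondly, no moment of a supremum over the band is given. Integrability is extracted from
  finiteness by tightness, and the bound on the variances from characteristic functions near 0. Nor
  is joint Gaussianity of the transforms given: it comes from L1 approximation of the pathwise
  integrals by finite linear combinations of the process.\<close>

abbreviation seq_borel :: "(nat \<Rightarrow> real) measure" where
  "seq_borel \<equiv> Pi\<^sub>M UNIV (\<lambda>_. borel)"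

lemma (in finite_measure) integrable_bounded:
  fixes f :: "'a \<Rightarrow> 'b::{banach, second_countable_topology}"
    and C :: real
  assumes "f \<in> borel_measurable M" "\<And>x. x \<in> space M \<Longrightarrow> norm (f x) \<le> C"
  shows "integrable M f"
  by (rule integrable_const_bound[of _ C]) (use assms in auto)

text \<open>Levy's uniqueness theorem speaks of probability laws. Normalising a bounded weight of
  positive mass turns weighted integrals into integrals for such a law, so that the theorem
  separates weighted functionals as well.\<close>

lemma weighted_distribution:
  fixes X v :: "'a \<Rightarrow> real"
  assumes "finite_measure P" and [measurable]: "X \<in> borel_measurable P" "v \<in> borel_measurable P"
    and v: "\<And>x. 0 \<le> v x" "\<And>x. v x \<le> C" and c: "0 < integral\<^sup>L P v"
  obtains M where "real_distribution M" "\<And>u. char M u = (CLINT x|P. v x * iexp (u * X x)) / integral\<^sup>L P v"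
    "\<And>A. A \<in> sets borel \<Longrightarrow> (LINT y|M. indicator A y) = (LINT x|P. v x * indicator A (X x)) / integral\<^sup>L P v"
proof -
  interpret P: finite_measure P by fact
  let ?c = "integral\<^sup>L P v"
  let ?D = "density P (\<lambda>x. ennreal (v x / ?c))"
  have iv: "integrable P v" by (rule P.integrable_bounded[of _ C]) (use v in auto)
  have "prob_space ?D"
  proof
    have "emeasure ?D (space P) = (\<integral>\<^sup>+ x. ennreal (v x / ?c) \<partial>P)"
      by (subst emeasure_density) (auto intro!: nn_integral_cong)
    also have "\<dots> = ennreal (LINT x|P. v x / ?c)"
      by (subst nn_integral_eq_integral) (use iv v c in auto)
    also have "\<dots> = 1" using c by simp
    finally show "emeasure ?D (space ?D) = 1" by simp
  qed
  then have 1: "real_distribution (distr ?D borel X)"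
    by (rule prob_space.real_distribution_distr) simp
  have 2: "char (distr ?D borel X) u = (CLINT x|P. v x * iexp (u * X x)) / ?c" for u
  proof -
    have "char (distr ?D borel X) u = (CLINT x|P. (v x / ?c) *\<^sub>R iexp (u * X x))"
      unfolding char_def by (simp add: integral_distr, subst integral_density) (use v c in auto)
    also have "\<dots> = (CLINT x|P. v x * iexp (u * X x) / ?c)"
      by (simp add: scaleR_conv_of_real)
    finally show ?thesis by simp
  qed
  have 3: "(LINT y|distr ?D borel X. indicator A y) = (LINT x|P. v x * indicator A (X x)) / ?c"
    if [measurable]: "A \<in> sets borel" for A
  proof -
    have "(LINT y|distr ?D borel X. indicator A y) = (LINT x|P. (v x / ?c) *\<^sub>R indicator A (X x) :: real)"
      by (subst integral_distr, simp, simp, subst integral_density) (use v c in auto)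
    then show ?thesis by simp
  qed
  show ?thesis by (rule that[OF 1 2 3])
qed

lemma weighted_Levy_uniqueness:
  fixes X v :: "'a \<Rightarrow> real" and Y w :: "'b \<Rightarrow> real"
  assumes "finite_measure P" "finite_measure Q"
    and [measurable]: "X \<in> borel_measurable P" "Y \<in> borel_measurable Q"
      "v \<in> borel_measurable P" "w \<in> borel_measurable Q"
    and v: "\<And>x. 0 \<le> v x" "\<And>x. v x \<le> C" and w: "\<And>x. 0 \<le> w x" "\<And>x. w x \<le> C"
    and eq: "\<And>u. (CLINT x|P. v x * iexp (u * X x)) = (CLINT x|Q. w x * iexp (u * Y x))"
    and A[measurable]: "A \<in> sets borel"
  shows "(LINT x|P. v x * indicator A (X x)) = (LINT x|Q. w x * indicator A (Y x))"
proof -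
  interpret P: finite_measure P by fact
  interpret Q: finite_measure Q by fact
  have iv: "integrable P v" by (rule P.integrable_bounded[of _ C]) (use v in auto)
  have iw: "integrable Q w" by (rule Q.integrable_bounded[of _ C]) (use w in auto)
  \<comment> \<open>At \<open>u = 0\<close> the hypothesis compares the total masses. A common mass
    \<open>0\<close> admits no normalisation, but then both weights vanish almost
    everywhere.\<close>
  have c: "integral\<^sup>L P v = integral\<^sup>L Q w" using eq[of 0] by simp
  show ?thesis
  proof (cases "integral\<^sup>L P v = 0")
    case True
    have "AE x in P. v x = 0" using integral_nonneg_eq_0_iff_AE[OF iv] v True by simp
    then have 1: "(LINT x|P. v x * indicator A (X x)) = (LINT x|P. 0)"
      by (intro integral_cong_AE) auto
    have "AE x in Q. w x = 0" using integral_nonneg_eq_0_iff_AE[OF iw] w True c by simp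
    then have 2: "(LINT x|Q. w x * indicator A (Y x)) = (LINT x|Q. 0)"
      by (intro integral_cong_AE) auto
    show ?thesis using 1 2 by simp
  next
    case False
    moreover have "0 \<le> integral\<^sup>L P v" using v by (intro integral_nonneg_AE) auto
    ultimately have pos: "0 < integral\<^sup>L P v" by simp
    obtain M where M: "real_distribution M" "\<And>u. char M u = (CLINT x|P. v x * iexp (u * X x)) / integral\<^sup>L P v"
      "\<And>A. A \<in> sets borel \<Longrightarrow> (LINT y|M. indicator A y) = (LINT x|P. v x * indicator A (X x)) / integral\<^sup>L P v"
      using weighted_distribution[of P X v C] assms(1,3,5) v pos by blast
    obtain N where N: "real_distribution N" "\<And>u. char N u = (CLINT x|Q. w x * iexp (u * Y x)) / integral\<^sup>L Q w"
      "\<And>A. A \<in> sets borel \<Longrightarrow> (LINT y|N. indicator A y) = (LINT x|Q. w x * indicator A (Y x)) / integral\<^sup>L Q w"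
      using weighted_distribution[of Q Y w C] assms(2,4,6) w pos c by auto
    have "M = N" by (rule Levy_uniqueness[OF M(1) N(1)], rule ext, simp only: M(2) N(2) eq c)
    then show ?thesis using M(3)[OF A] N(3)[OF A] pos c by simp
  qed
qed

text \<open>The indicators are introduced one coordinate at a time; the remaining exponential is traded
  for the nonnegative weights \<open>1 + cos (\<theta> + U)\<close>, to which Levy's theorem applies.\<close>

lemma cylinder_char_eq:
  fixes \<mu> \<nu> :: "(nat \<Rightarrow> real) measure"
  assumes "prob_space \<mu>" "prob_space \<nu>"
    and s[measurable_cong]: "sets \<mu> = sets seq_borel" "sets \<nu> = sets seq_borel"
    and eq: "\<And>n c. (CLINT y|\<mu>. iexp (\<Sum>i<n. c i * y i)) = (CLINT y|\<nu>. iexp (\<Sum>i<n. c i * y i))"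
    and A[measurable]: "\<And>i. A i \<in> sets borel"
  shows "k \<le> n \<Longrightarrow>
    (CLINT y|\<mu>. (\<Prod>i<k. indicator (A i) (y i)) * iexp (\<Sum>i=k..<n. c i * y i))
    = (CLINT y|\<nu>. (\<Prod>i<k. indicator (A i) (y i)) * iexp (\<Sum>i=k..<n. c i * y i))"
proof (induction k arbitrary: c)
  case 0
  then show ?case using eq[of c n] by (simp add: lessThan_atLeast0)
next
  case (Suc k)
  interpret \<mu>: prob_space \<mu> by fact
  interpret \<nu>: prob_space \<nu> by fact
  have [measurable]: "(\<lambda>y. y i) \<in> borel_measurable \<mu>" "(\<lambda>y. y i) \<in> borel_measurable \<nu>" for i
    by (simp_all add: measurable_cong_sets[OF s(1) refl] measurable_cong_sets[OF s(2) refl])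
  define w :: "(nat \<Rightarrow> real) \<Rightarrow> real" where "w = (\<lambda>y. \<Prod>i<k. indicator (A i) (y i))"
  define U where "U = (\<lambda>y. \<Sum>i=Suc k..<n. c i * (y i::real))"
  have [measurable]: "w \<in> borel_measurable \<mu>" "w \<in> borel_measurable \<nu>"
     "U \<in> borel_measurable \<mu>" "U \<in> borel_measurable \<nu>"
    unfolding w_def U_def by measurable
  have w: "0 \<le> w y" "w y \<le> 1" for y
    unfolding w_def by (auto intro!: prod_nonneg prod_le_1 simp: indicator_def)
  \<comment> \<open>Frequency \<open>u\<close> sits on coordinate \<open>k\<close>, and
    \<open>s\<close> scales the later frequencies. Only \<open>s = 0, 1, -1\<close> are used, the
    exponentials that make up \<open>1 + cos (\<theta> + U)\<close>.\<close>
  have IH: "(CLINT y|\<mu>. w y * iexp (u * y k) * iexp (s * U y))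
          = (CLINT y|\<nu>. w y * iexp (u * y k) * iexp (s * U y))" for u s
  proof -
    have "(\<Sum>i=k..<n. (if i = k then u else s * c i) * y i) = u * y k + s * U y" for y
      using Suc.prems unfolding U_def by (simp add: sum.atLeast_Suc_lessThan sum_distrib_left mult.assoc)
    then have *: "(\<Prod>i<k. indicator (A i) (y i)) * iexp (\<Sum>i=k..<n. (if i = k then u else s * c i) * y i)
        = w y * iexp (u * y k) * iexp (s * U y)" for y
      by (simp only: w_def of_real_prod of_real_indicator of_real_add distrib_left exp_add mult.assoc)
    show ?thesis
      using Suc.IH[of "\<lambda>i. if i = k then u else s * c i"] Suc.prems unfolding * by simp
  qed
  have int: "integrable M (\<lambda>y. w y * iexp (u * y k) * iexp (s * U y))"
    if M: "M = \<mu> \<or> M = \<nu>" for M u s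
  proof -
    have "integrable M (\<lambda>y. complex_of_real (w y) * iexp (u * y k) * iexp (s * U y))"
      if "prob_space M" "w \<in> borel_measurable M" "U \<in> borel_measurable M" "(\<lambda>y. y k) \<in> borel_measurable M"
    proof -
      interpret prob_space M by fact
      note [measurable] = that(2-4)
      show ?thesis
        by (rule integrable_bounded[of _ 1]) (use w in \<open>auto simp: norm_mult\<close>)
    qed
    then show ?thesis using M by (auto simp: \<mu>.prob_space_axioms \<nu>.prob_space_axioms)
  qed
  have cosU: "complex_of_real (cos (\<theta> + x)) = (iexp \<theta> * iexp (1 * x) + iexp (- \<theta>) * iexp (-1 * x)) / 2" for x \<theta>
    by (simp add: complex_eq_iff Re_exp Im_exp cos_add)
  have W: "(CLINT y|\<mu>. w y * iexp (u * y k)) = (CLINT y|\<nu>. w y * iexp (u * y k))" for u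
    using IH[of u 0] by simp
  have W\<theta>: "(CLINT y|\<mu>. (w y * (1 + cos (\<theta> + U y))) * iexp (u * y k))
         = (CLINT y|\<nu>. (w y * (1 + cos (\<theta> + U y))) * iexp (u * y k))" for u \<theta>
  proof -
    have *: "(CLINT y|M. (w y * (1 + cos (\<theta> + U y))) * iexp (u * y k))
      = (CLINT y|M. f 0 y) + (iexp \<theta> * (CLINT y|M. f 1 y) + iexp (- \<theta>) * (CLINT y|M. f (-1) y)) / 2"
      if M: "M = \<mu> \<or> M = \<nu>" and f: "f = (\<lambda>s y. w y * iexp (u * y k) * iexp (s * U y))" for M f
    proof -
      have i: "integrable M (f s)" for s unfolding f by (rule int[OF M])
      have "(w y * (1 + cos (\<theta> + U y))) * iexp (u * y k) = f 0 y + (iexp \<theta> * f 1 y + iexp (- \<theta>) * f (-1) y) / 2" for y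
        unfolding of_real_mult of_real_add cosU f by (simp add: field_simps)
      then have "(CLINT y|M. (w y * (1 + cos (\<theta> + U y))) * iexp (u * y k))
          = (CLINT y|M. f 0 y + (iexp \<theta> * f 1 y + iexp (- \<theta>) * f (-1) y) / 2)"
        by simp
      then show ?thesis using i by simp
    qed
    show ?thesis
      by (rule trans[OF *[OF disjI1[OF refl] refl] trans[OF _ *[OF disjI2[OF refl] refl, symmetric]]])
        (simp only: IH)
  qed
  have two: "0 \<le> w y * (1 + cos z)" "w y * (1 + cos z) \<le> 2" for y z
  proof -
    have "w y * (1 + cos z) \<le> 1 * 2"
      by (intro mult_mono; use w cos_le_one[of z] cos_ge_minus_one[of z] in \<open>simp; linarith?\<close>)
    moreover have "0 \<le> 1 + cos z" using cos_ge_minus_one[of z] by linarith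
    ultimately show "0 \<le> w y * (1 + cos z)" "w y * (1 + cos z) \<le> 2" using w by auto
  qed
  have two3: "\<bar>w y * (1 + cos z)\<bar> \<le> 2" for y z using two[of y z] by auto
  note L = weighted_Levy_uniqueness[OF \<mu>.finite_measure_axioms \<nu>.finite_measure_axioms, of "\<lambda>y. y k" "\<lambda>y. y k" _ _ _ "A k"]
  have E0: "(LINT y|\<mu>. w y * indicator (A k) (y k)) = (LINT y|\<nu>. w y * indicator (A k) (y k))"
    by (rule L[of w w 1]) (use w W in auto)
  have E\<theta>: "(LINT y|\<mu>. (w y * (1 + cos (\<theta> + U y))) * indicator (A k) (y k)) = (LINT y|\<nu>. (w y * (1 + cos (\<theta> + U y))) * indicator (A k) (y k))" for \<theta>
    by (rule L[of "\<lambda>y. w y * (1 + cos (\<theta> + U y))" "\<lambda>y. w y * (1 + cos (\<theta> + U y))" 2]) (use two W\<theta> in auto)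
  \<comment> \<open>The phases \<open>0\<close> and \<open>- (pi / 2)\<close> yield
    \<open>cos U\<close> and \<open>sin U\<close>, the real and imaginary parts of the remaining
    exponential, after subtracting the integral with weight \<open>w\<close> alone.\<close>
  have sin_cos: "sin x = cos (- (pi / 2) + x)" for x :: real by (simp add: cos_diff)
  have conv: "(CLINT y|M. (\<Prod>i<Suc k. indicator (A i) (y i)) * iexp (\<Sum>i=Suc k..<n. c i * y i))
    = Complex ((LINT y|M. (w y * (1 + cos (0 + U y))) * indicator (A k) (y k)) - (LINT y|M. w y * indicator (A k) (y k)))
       ((LINT y|M. (w y * (1 + cos (- (pi / 2) + U y))) * indicator (A k) (y k)) - (LINT y|M. w y * indicator (A k) (y k)))"
    if M: "M = \<mu> \<or> M = \<nu>" for M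
  proof -
    have "prob_space M" and m: "w \<in> borel_measurable M" "U \<in> borel_measurable M" "(\<lambda>y. y k) \<in> borel_measurable M"
      using M \<mu>.prob_space_axioms \<nu>.prob_space_axioms by auto
    then interpret prob_space M by simp
    note [measurable] = m
    let ?J = "\<lambda>y. indicator (A k) (y k) :: real"
    have i: "integrable M (\<lambda>y. w y * ?J y)" "integrable M (\<lambda>y. (w y * (1 + cos (\<theta> + U y))) * ?J y)" for \<theta>
      by (rule integrable_bounded[of _ 2]; use w two3 in \<open>auto simp: indicator_def intro: order.trans[OF w(2)]\<close>)+
    have i2: "integrable M (\<lambda>y. w y * ?J y * iexp (U y))"
      by (rule integrable_bounded[of _ 1]) (use w in \<open>auto simp: norm_mult indicator_def\<close>)
    have "(CLINT y|M. (\<Prod>i<Suc k. indicator (A i) (y i)) * iexp (\<Sum>i=Suc k..<n. c i * y i))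
       = (CLINT y|M. w y * ?J y * iexp (U y))" by (simp add: w_def U_def of_real_indicator)
    also have "\<dots> = Complex (LINT y|M. w y * ?J y * cos (U y)) (LINT y|M. w y * ?J y * sin (U y))"
      using integral_Re[OF i2] integral_Im[OF i2] by (simp add: complex_eq_iff Re_exp Im_exp)
    also have "\<dots> = Complex (LINT y|M. (w y * (1 + cos (0 + U y))) * ?J y - w y * ?J y)
         (LINT y|M. (w y * (1 + cos (- (pi / 2) + U y))) * ?J y - w y * ?J y)"
      unfolding sin_cos[symmetric] by (simp add: algebra_simps)
    finally show ?thesis unfolding Bochner_Integration.integral_diff[OF i(2) i(1)] .
  qed
  show ?case using conv[OF disjI1[OF refl]] conv[OF disjI2[OF refl]] E0 E\<theta> by (simp only:)
qed

text \<open>Once all \<open>n\<close> coordinates carry indicators, nothing is left of the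
  exponential and \<open>cylinder_char_eq\<close> compares probabilities of cylinders. These
  generate the product sigma-algebra and are closed under intersection. Coordinates below
  \<open>n\<close> outside \<open>J\<close> receive the indicator of \<open>UNIV\<close>.\<close>

lemma Cramer_Wold_seq:
  fixes \<mu> \<nu> :: "(nat \<Rightarrow> real) measure"
  assumes "prob_space \<mu>" "prob_space \<nu>"
    and s[measurable_cong]: "sets \<mu> = sets seq_borel" "sets \<nu> = sets seq_borel"
    and eq: "\<And>n c. (CLINT y|\<mu>. iexp (\<Sum>i<n. c i * y i)) = (CLINT y|\<nu>. iexp (\<Sum>i<n. c i * y i))"
  shows "\<mu> = \<nu>"
proof (rule measure_eqI_PiM_infinite[OF s])
  interpret \<mu>: prob_space \<mu> by fact
  interpret \<nu>: prob_space \<nu> by fact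
  show "finite_measure \<mu>" by unfold_locales
  fix A :: "nat \<Rightarrow> real set" and J :: "nat set"
  assume J: "finite J" and "J \<subseteq> UNIV" and A: "\<And>i. i \<in> J \<Longrightarrow> A i \<in> sets borel"
  define A' where "A' i = (if i \<in> J then A i else UNIV)" for i
  have A'[measurable]: "A' i \<in> sets borel" for i unfolding A'_def using A by auto
  obtain n where n: "J \<subseteq> {..<n}" using J by (metis finite_nat_iff_bounded)
  let ?E = "prod_emb UNIV (\<lambda>_. borel) J (Pi\<^sub>E J A) :: (nat \<Rightarrow> real) set"
  have ind: "(\<Prod>i<n. indicator (A' i) (y i)) = complex_of_real (indicator ?E y)" for y
  proof -
    have "(\<Prod>i<n. indicator (A' i) (y i) :: complex) = (\<Prod>i\<in>J. indicator (A i) (y i))"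
      by (rule prod.mono_neutral_cong_right) (use n in \<open>auto simp: A'_def\<close>)
    also have "\<dots> = indicator ?E y"
      using J by (auto simp: prod_emb_def space_PiM indicator_def PiE_iff prod_zero_iff)
    finally show ?thesis by (simp add: of_real_indicator)
  qed
  have E: "?E \<in> sets seq_borel" using A J by (intro sets_PiM_I) auto
  have "complex_of_real (measure M ?E) = (CLINT y|M. (\<Prod>i<n. indicator (A' i) (y i)) * iexp (\<Sum>i=n..<n. 0 * y i))"
    if "sets M = sets seq_borel" "prob_space M" for M
  proof -
    interpret prob_space M by fact
    have "?E \<in> sets M" using E that by simp
    then show ?thesis unfolding ind by (simp add: sets.Int_space_eq2)
  qed
  from this[of \<mu>] this[of \<nu>] cylinder_char_eq[where A=A' and k=n and n=n and c="\<lambda>_. 0", OF assms(1,2) s eq A' order.refl]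
  have "complex_of_real (measure \<mu> ?E) = complex_of_real (measure \<nu> ?E)"
    using assms(1-4) by simp
  then have "measure \<mu> ?E = measure \<nu> ?E" by (simp only: of_real_eq_iff)
  then show "emeasure \<mu> ?E = emeasure \<nu> ?E"
    by (simp add: \<mu>.emeasure_eq_measure \<nu>.emeasure_eq_measure)
qed

section \<open>Centered Gaussian variables\<close>

text \<open>The characteristic function is used instead of a density: variance \<open>0\<close> is
  then included, and limits in law only require the limit of an explicit exponential.\<close>

definition cgauss :: "'a measure \<Rightarrow> ('a \<Rightarrow> real) \<Rightarrow> real \<Rightarrow> bool" where
  "cgauss P Y v \<longleftrightarrow> Y \<in> borel_measurable P \<and> 0 \<le> v
     \<and> (\<forall>u. (CLINT x|P. iexp (u * Y x)) = complex_of_real (exp (- (u\<^sup>2 * v / 2))))"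

lemma cgauss_measurable [measurable_dest]: "cgauss P Y v \<Longrightarrow> Y \<in> borel_measurable P"
  by (simp add: cgauss_def)

lemma cgauss_nonneg: "cgauss P Y v \<Longrightarrow> 0 \<le> v"
  by (simp add: cgauss_def)

lemma cgauss_char: "cgauss P Y v \<Longrightarrow> (CLINT x|P. iexp (u * Y x)) = complex_of_real (exp (- (u\<^sup>2 * v / 2)))"
  by (simp add: cgauss_def)

lemma integrable_exp_std_normal: "integrable std_normal_distribution (\<lambda>x. exp (c * x))"
proof -
  \<comment> \<open>The square is completed: the tilted density is a multiple of the normal density
    with mean \<open>c\<close>.\<close>
  have "std_normal_density x *\<^sub>R exp (c * x) = exp (c\<^sup>2 / 2) * normal_density c 1 x" for x
    by (simp add: std_normal_density_def normal_density_def exp_add[symmetric] power2_eq_square field_simps)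
  then have "integrable lborel (\<lambda>x. std_normal_density x *\<^sub>R exp (c * x))"
    by simp
  then show ?thesis
    by (subst integrable_density) auto
qed

context prob_space
begin

lemma cgauss_distr:
  assumes "cgauss M Y v"
  shows "distr M borel Y = distr std_normal_distribution borel ((*) (sqrt v))"
proof (rule Levy_uniqueness)
  interpret N: real_distribution std_normal_distribution by (rule real_dist_normal_dist)
  have [measurable]: "Y \<in> borel_measurable M" using assms by (rule cgauss_measurable)
  show "real_distribution (distr M borel Y)" by (rule real_distribution_distr) simp
  show "real_distribution (distr std_normal_distribution borel ((*) (sqrt v)))"
    by (rule N.real_distribution_distr) simp
  show "char (distr M borel Y) = char (distr std_normal_distribution borel ((*) (sqrt v)))"
  proof
    fix u
    have "char (distr std_normal_distribution borel ((*) (sqrt v))) u = char std_normal_distribution (u * sqrt v)"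
      by (simp add: char_def integral_distr mult.assoc)
    also have "\<dots> = complex_of_real (exp (- (u\<^sup>2 * v / 2)))"
      using cgauss_nonneg[OF assms] by (simp add: char_std_normal_distribution power_mult_distrib)
    also have "\<dots> = char (distr M borel Y) u"
      unfolding char_def cgauss_char[OF assms, symmetric] by (subst integral_distr) auto
    finally show "char (distr M borel Y) u = char (distr std_normal_distribution borel ((*) (sqrt v))) u" ..
  qed
qed

lemma
  fixes f :: "real \<Rightarrow> real"
  assumes g: "cgauss M Y v" and [measurable]: "f \<in> borel_measurable borel"
  shows cgauss_integrable_iff: "integrable M (\<lambda>x. f (Y x)) \<longleftrightarrow> integrable std_normal_distribution (\<lambda>x. f (sqrt v * x))"
    and cgauss_integral: "(LINT x|M. f (Y x)) = (LINT x|std_normal_distribution. f (sqrt v * x))"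
proof -
  have [measurable]: "Y \<in> borel_measurable M" using g by (rule cgauss_measurable)
  have "integrable M (\<lambda>x. f (Y x)) = integrable (distr M borel Y) f"
    by (subst integrable_distr_eq) auto
  also have "\<dots> = integrable std_normal_distribution (\<lambda>x. f (sqrt v * x))"
    unfolding cgauss_distr[OF g] by (subst integrable_distr_eq) auto
  finally show "integrable M (\<lambda>x. f (Y x)) \<longleftrightarrow> integrable std_normal_distribution (\<lambda>x. f (sqrt v * x))" .
  have "(LINT x|M. f (Y x)) = (LINT x|distr M borel Y. f x)"
    by (subst integral_distr) auto
  also have "\<dots> = (LINT x|std_normal_distribution. f (sqrt v * x))"
    unfolding cgauss_distr[OF g] by (subst integral_distr) auto
  finally show "(LINT x|M. f (Y x)) = (LINT x|std_normal_distribution. f (sqrt v * x))" .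
qed

lemma cgauss_exp_moment:
  assumes "cgauss M Y v"
  shows "integrable M (\<lambda>x. exp (c * \<bar>Y x\<bar>))"
proof -
  have [measurable]: "Y \<in> borel_measurable M" using assms by (rule cgauss_measurable)
  have *: "integrable M (\<lambda>x. exp (c * Y x))" for c
    using integrable_exp_std_normal[of "c * sqrt v"]
    by (subst cgauss_integrable_iff[OF assms, of "\<lambda>y. exp (c * y)"]) (simp_all add: mult.assoc)
  show ?thesis
  proof (rule Bochner_Integration.integrable_bound)
    show "integrable M (\<lambda>x. exp (c * Y x) + exp (-c * Y x))" using *[of c] *[of "-c"] by simp
    show "AE x in M. norm (exp (c * \<bar>Y x\<bar>)) \<le> norm (exp (c * Y x) + exp (- c * Y x))"
    proof (rule AE_I2)
      fix x
      have "exp (c * \<bar>Y x\<bar>) \<le> exp (c * Y x) + exp (- c * Y x)" by (cases "0 \<le> Y x") auto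
      then show "norm (exp (c * \<bar>Y x\<bar>)) \<le> norm (exp (c * Y x) + exp (- c * Y x))"
        unfolding real_norm_def by (metis abs_exp_cancel abs_ge_self order_trans)
    qed
  qed simp
qed

lemma
  assumes "cgauss M Y v"
  shows cgauss_integrable_square: "integrable M (\<lambda>x. (Y x)\<^sup>2)"
    and cgauss_second_moment: "(LINT x|M. (Y x)\<^sup>2) = v"
proof -
  show "integrable M (\<lambda>x. (Y x)\<^sup>2)"
    using integrable_std_normal_distribution_moment[of 2]
    by (subst cgauss_integrable_iff[OF assms, of "\<lambda>y. y\<^sup>2"]) (auto simp: power_mult_distrib)
  show "(LINT x|M. (Y x)\<^sup>2) = v"
    using std_normal_distribution_even_moments[of 1] cgauss_nonneg[OF assms]
    by (subst cgauss_integral[OF assms, of "\<lambda>y. y\<^sup>2"]) (auto simp: power_mult_distrib fact_numeral)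
qed

lemma cgauss_integrable:
  assumes "cgauss M Y v" shows "integrable M Y"
  by (rule square_integrable_imp_integrable[OF cgauss_measurable[OF assms] cgauss_integrable_square[OF assms]])

text \<open>Joint behaviour does not matter here: the sum is at most \<open>n\<close> times its
  largest summand, and the exponential of the largest summand is at most the sum of all
  exponentials.\<close>

lemma exp_sum_moment:
  assumes "\<And>i. i < (n::nat) \<Longrightarrow> \<exists>v. cgauss M (Y i) v"
  shows "integrable M (\<lambda>x. exp (c * (\<Sum>i<n. \<bar>Y i x\<bar>)))"
proof (cases "n = 0")
  case False
  have m: "Y i \<in> borel_measurable M" if "i < n" for i using assms[OF that] by (auto simp: cgauss_measurable)
  have [measurable]: "(\<lambda>x. \<Sum>i<n. \<bar>Y i x\<bar>) \<in> borel_measurable M"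
    using m by (intro borel_measurable_sum) (auto simp: borel_measurable_abs)
  let ?d = "\<bar>c\<bar> * n"
  show ?thesis
  proof (rule Bochner_Integration.integrable_bound)
    show "integrable M (\<lambda>x. \<Sum>i<n. exp (?d * \<bar>Y i x\<bar>))"
      using assms cgauss_exp_moment by (intro Bochner_Integration.integrable_sum) blast
    have "exp (c * (\<Sum>i<n. \<bar>Y i x\<bar>)) \<le> (\<Sum>i<n. exp (?d * \<bar>Y i x\<bar>))" for x
    proof -
      obtain k where k: "k < n" "\<And>i. i < n \<Longrightarrow> \<bar>Y i x\<bar> \<le> \<bar>Y k x\<bar>"
      proof -
        have "Max ((\<lambda>i. \<bar>Y i x\<bar>) ` {..<n}) \<in> (\<lambda>i. \<bar>Y i x\<bar>) ` {..<n}" using False by (intro Max_in) auto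
        then obtain k where "k < n" "\<bar>Y k x\<bar> = Max ((\<lambda>i. \<bar>Y i x\<bar>) ` {..<n})" by auto
        then show ?thesis by (intro that[of k]) auto
      qed
      have "(\<Sum>i<n. \<bar>Y i x\<bar>) \<le> (\<Sum>i<n. \<bar>Y k x\<bar>)" by (intro sum_mono k) auto
      then have "(\<Sum>i<n. \<bar>Y i x\<bar>) \<le> n * \<bar>Y k x\<bar>" by simp
      then have "\<bar>c\<bar> * (\<Sum>i<n. \<bar>Y i x\<bar>) \<le> \<bar>c\<bar> * (n * \<bar>Y k x\<bar>)" by (intro mult_left_mono) auto
      moreover have "c * (\<Sum>i<n. \<bar>Y i x\<bar>) \<le> \<bar>c\<bar> * (\<Sum>i<n. \<bar>Y i x\<bar>)" by (intro mult_right_mono) (auto intro: sum_nonneg)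
      ultimately have "exp (c * (\<Sum>i<n. \<bar>Y i x\<bar>)) \<le> exp (?d * \<bar>Y k x\<bar>)" by (simp add: mult.assoc)
      also have "\<dots> \<le> (\<Sum>i<n. exp (?d * \<bar>Y i x\<bar>))" by (rule member_le_sum) (use k in auto)
      finally show ?thesis .
    qed
    then show "AE x in M. norm (exp (c * (\<Sum>i<n. \<bar>Y i x\<bar>))) \<le> norm (\<Sum>i<n. exp (?d * \<bar>Y i x\<bar>))"
      by (auto intro!: AE_I2 order.trans[OF _ abs_ge_self])
  qed simp
qed simp

end

section \<open>The exponential inequality for smooth functions\<close>

text \<open>The gradient \<open>a\<close> is carried along explicitly, so that the class is closed under averaging over
  translates without differentiating under the integral.\<close>

definition smooth_cls ::
  "nat \<Rightarrow> real \<Rightarrow> real \<Rightarrow> ((nat \<Rightarrow> real) \<Rightarrow> real) \<Rightarrow> (nat \<Rightarrow> (nat \<Rightarrow> real) \<Rightarrow> real) \<Rightarrow> bool" where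
  "smooth_cls n B C F a \<longleftrightarrow> F \<in> borel_measurable seq_borel \<and> (\<forall>i<n. a i \<in> borel_measurable seq_borel)
     \<and> (\<forall>x. (\<Sum>i<n. \<bar>a i x\<bar>) \<le> B)
     \<and> (\<forall>x y. \<bar>F (\<lambda>i. x i + y i) - F x\<bar> \<le> B * (\<Sum>i<n. \<bar>y i\<bar>))
     \<and> (\<forall>x y. \<bar>F (\<lambda>i. x i + y i) - F x - (\<Sum>i<n. a i x * y i)\<bar> \<le> C * (\<Sum>i<n. (y i)\<^sup>2))"

lemma smooth_clsD:
  assumes "smooth_cls n B C F a"
  shows "F \<in> borel_measurable seq_borel" "\<And>i. i < n \<Longrightarrow> a i \<in> borel_measurable seq_borel"
    "\<And>x. (\<Sum>i<n. \<bar>a i x\<bar>) \<le> B" "\<And>x y. \<bar>F (\<lambda>i. x i + y i) - F x\<bar> \<le> B * (\<Sum>i<n. \<bar>y i\<bar>)"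
    "\<And>x y. \<bar>F (\<lambda>i. x i + y i) - F x - (\<Sum>i<n. a i x * y i)\<bar> \<le> C * (\<Sum>i<n. (y i)\<^sup>2)"
    "0 \<le> B"
proof -
  show "0 \<le> B" using assms unfolding smooth_cls_def
    by (meson order.trans sum_nonneg abs_ge_zero)
qed (use assms in \<open>auto simp: smooth_cls_def\<close>)

lemma measurable_seq_add:
  assumes "\<And>i. f i \<in> borel_measurable M" "\<And>i. g i \<in> borel_measurable M"
  shows "(\<lambda>x i. f i x + g i x :: real) \<in> measurable M seq_borel"
  by (rule measurable_PiM_single') (use assms in \<open>auto intro: borel_measurable_add\<close>)

lemma smooth_cls_translate:
  assumes "smooth_cls n B C F a"
  shows "smooth_cls n B C (\<lambda>y. F (\<lambda>i. x i + y i)) (\<lambda>k y. a k (\<lambda>i. x i + y i))"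
proof -
  have t: "(\<lambda>y i. x i + y i) \<in> measurable seq_borel seq_borel"
    by (intro measurable_seq_add) auto
  show ?thesis
    using smooth_clsD[OF assms] t unfolding smooth_cls_def
    by (auto simp: add.assoc[symmetric] intro: measurable_compose[OF t])
qed

definition exp_moments :: "nat \<Rightarrow> (nat \<Rightarrow> real) measure \<Rightarrow> bool" where
  "exp_moments n N \<longleftrightarrow> (\<forall>c. integrable N (\<lambda>y. exp (c * (\<Sum>i<n. \<bar>y i\<bar>))))"

lemma smooth_cls_bound:
  assumes "smooth_cls n B C F a"
  shows "\<bar>F y\<bar> \<le> \<bar>F (\<lambda>_. 0)\<bar> + B * (\<Sum>i<n. \<bar>y i\<bar>)"
  using smooth_clsD(4)[OF assms, of "\<lambda>_. 0" y] by simp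

lemma smooth_cls_integrable:
  assumes F: "smooth_cls n B C F a" and N: "prob_space N" "sets N = sets seq_borel" "exp_moments n N"
  shows "integrable N F" "integrable N (\<lambda>y. exp (F y))"
proof -
  interpret prob_space N by fact
  note [measurable_cong] = N(2)
  note [measurable] = smooth_clsD(1)[OF F]
  let ?s = "\<lambda>y. \<Sum>i<n. \<bar>y i\<bar> :: real"
  let ?c = "\<bar>F (\<lambda>_. 0)\<bar>"
  have i: "integrable N (\<lambda>y. exp ?c * exp (B * ?s y))"
    using N(3) by (simp add: exp_moments_def)
  have b: "\<bar>F y\<bar> \<le> ?c + B * ?s y" for y by (rule smooth_cls_bound[OF F])
  have e: "exp \<bar>F y\<bar> \<le> exp ?c * exp (B * ?s y)" for y
    using b[of y] by (simp add: exp_add[symmetric])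
  show "integrable N (\<lambda>y. exp (F y))"
  proof (rule Bochner_Integration.integrable_bound[OF i])
    have "exp (F y) \<le> exp ?c * exp (B * ?s y)" for y
      by (rule order.trans[OF _ e]) simp
    then show "AE x in N. norm (exp (F x)) \<le> norm (exp ?c * exp (B * ?s x))" by simp
  qed measurable
  show "integrable N F"
  proof (rule Bochner_Integration.integrable_bound[OF i])
    have "\<bar>F y\<bar> \<le> exp ?c * exp (B * ?s y)" for y
      by (rule order.trans[OF _ e]) (use exp_ge_add_one_self[of "\<bar>F y\<bar>"] in linarith)
    then show "AE x in N. norm (F x) \<le> norm (exp ?c * exp (B * ?s x))" by simp
  qed measurable
qed

text \<open>Each estimate of the class is uniform in the base point, so it survives integration over
  translates with the same \<open>B\<close> and \<open>C\<close>. The growth of \<open>F\<close> is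
  linear, which the exponential moments dominate.\<close>

lemma smooth_cls_average:
  assumes F: "smooth_cls n B C F a" and N: "prob_space N" "sets N = sets seq_borel" "exp_moments n N"
  shows "smooth_cls n B C (\<lambda>x. LINT y|N. F (\<lambda>i. x i + y i)) (\<lambda>k x. LINT y|N. a k (\<lambda>i. x i + y i))"
proof -
  interpret prob_space N by fact
  note [measurable_cong] = N(2)
  note D = smooth_clsD[OF F]
  have add: "(\<lambda>(x, y) i. x i + y i) \<in> measurable (seq_borel \<Otimes>\<^sub>M N) seq_borel"
    unfolding case_prod_beta by (intro measurable_seq_add) auto
  have add1: "(\<lambda>y i. x i + y i) \<in> measurable N seq_borel" for x
    by (intro measurable_seq_add) auto
  note FD = smooth_cls_translate[OF F]
  have Fi: "integrable N (\<lambda>y. F (\<lambda>i. x i + y i))" for x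
    by (rule smooth_cls_integrable(1)[OF FD N])
  have ab: "\<bar>a k x\<bar> \<le> B" if "k < n" for k x
    by (rule order.trans[OF member_le_sum[of k "{..<n}" "\<lambda>i. \<bar>a i x\<bar>"] D(3)]) (use that in auto)
  have ai: "integrable N (\<lambda>y. a k (\<lambda>i. x i + y i))" if k: "k < n" for k x
    by (rule integrable_bounded[of _ B]) (use measurable_compose[OF add1 D(2)[OF k]] ab[OF k] in auto)
  show ?thesis unfolding smooth_cls_def
  proof (intro conjI allI impI)
    show "(\<lambda>x. LINT y|N. F (\<lambda>i. x i + y i)) \<in> borel_measurable seq_borel"
      using measurable_compose[OF add D(1)] by (intro borel_measurable_lebesgue_integral) (simp add: case_prod_beta)
    show "(\<lambda>x. LINT y|N. a k (\<lambda>i. x i + y i)) \<in> borel_measurable seq_borel" if "k < n" for k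
      using measurable_compose[OF add D(2)[OF that]] by (intro borel_measurable_lebesgue_integral) (simp add: case_prod_beta)
    fix x :: "nat \<Rightarrow> real"
    show "(\<Sum>k<n. \<bar>LINT y|N. a k (\<lambda>i. x i + y i)\<bar>) \<le> B"
    proof -
      have "(\<Sum>k<n. \<bar>LINT y|N. a k (\<lambda>i. x i + y i)\<bar>) \<le> (\<Sum>k<n. (LINT y|N. \<bar>a k (\<lambda>i. x i + y i)\<bar>))"
        by (intro sum_mono integral_abs_bound)
      also have "\<dots> = (LINT y|N. (\<Sum>k<n. \<bar>a k (\<lambda>i. x i + y i)\<bar>))"
        using ai by (subst Bochner_Integration.integral_sum) auto
      also have "\<dots> \<le> (LINT y|N. B)"
        using ai D(3) by (intro integral_mono Bochner_Integration.integrable_sum) (auto simp: prob_space)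
      finally show ?thesis by (simp add: prob_space)
    qed
    fix z :: "nat \<Rightarrow> real"
    have sw: "(\<lambda>i. x i + z i + y i) = (\<lambda>i. (x i + y i) + z i)" for y by auto
    have Fi': "integrable N (\<lambda>y. F (\<lambda>i. x i + y i + z i))"
      using Fi[of "\<lambda>i. x i + z i"] unfolding sw .
    show "\<bar>(LINT y|N. F (\<lambda>i. x i + z i + y i)) - (LINT y|N. F (\<lambda>i. x i + y i))\<bar> \<le> B * (\<Sum>i<n. \<bar>z i\<bar>)"
    proof -
      have "(LINT y|N. F (\<lambda>i. x i + z i + y i)) - (LINT y|N. F (\<lambda>i. x i + y i))
        = (LINT y|N. F (\<lambda>i. (x i + y i) + z i) - F (\<lambda>i. x i + y i))"
        unfolding sw using Fi Fi' by simp
      also have "\<bar>\<dots>\<bar> \<le> (LINT y|N. \<bar>F (\<lambda>i. (x i + y i) + z i) - F (\<lambda>i. x i + y i)\<bar>)"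
        by (rule integral_abs_bound)
      also have "\<dots> \<le> (LINT y|N. B * (\<Sum>i<n. \<bar>z i\<bar>))"
        using Fi Fi' D(4) by (intro integral_mono) auto
      finally show ?thesis by (simp add: prob_space)
    qed
    show "\<bar>(LINT y|N. F (\<lambda>i. x i + z i + y i)) - (LINT y|N. F (\<lambda>i. x i + y i))
        - (\<Sum>k<n. (LINT y|N. a k (\<lambda>i. x i + y i)) * z k)\<bar> \<le> C * (\<Sum>i<n. (z i)\<^sup>2)"
    proof -
      let ?G = "\<lambda>y. F (\<lambda>i. (x i + y i) + z i) - F (\<lambda>i. x i + y i) - (\<Sum>k<n. a k (\<lambda>i. x i + y i) * z k)"
      have si: "integrable N (\<lambda>y. \<Sum>k<n. a k (\<lambda>i. x i + y i) * z k)"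
        using ai by (intro Bochner_Integration.integrable_sum) auto
      have "(LINT y|N. F (\<lambda>i. x i + z i + y i)) - (LINT y|N. F (\<lambda>i. x i + y i))
        - (\<Sum>k<n. (LINT y|N. a k (\<lambda>i. x i + y i)) * z k) = (LINT y|N. ?G y)"
        unfolding sw using Fi Fi' si ai by (simp add: Bochner_Integration.integral_sum)
      also have "\<bar>\<dots>\<bar> \<le> (LINT y|N. \<bar>?G y\<bar>)"
        by (rule integral_abs_bound)
      also have "\<dots> \<le> (LINT y|N. C * (\<Sum>i<n. (z i)\<^sup>2))"
        using Fi Fi' si D(5) by (intro integral_mono) auto
      finally show ?thesis by (simp add: prob_space)
    qed
  qed
qed

text \<open>The inequality is demanded for the whole class with fixed \<open>B\<close> and
  \<open>C\<close>, since a convolution step applies it to translates of \<open>F\<close> and to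
  their average, which stay in that class.\<close>

definition exp_ineq :: "nat \<Rightarrow> real \<Rightarrow> real \<Rightarrow> (nat \<Rightarrow> real) measure \<Rightarrow> real \<Rightarrow> bool" where
  "exp_ineq n B C N c \<longleftrightarrow> (\<forall>F a. smooth_cls n B C F a \<longrightarrow>
     (LINT y|N. exp (F y)) \<le> exp ((LINT y|N. F y) + c))"

text \<open>The inequality is applied twice: to \<open>F\<close> as a function of the second summand
  with the first one frozen, and then to the resulting mean \<open>u\<close>. Each application costs
  \<open>c\<close>, and Fubini turns the mean of \<open>u\<close> into the mean of \<open>F\<close>
  under the convolution.\<close>

lemma exp_ineq_convolution:
  assumes N: "prob_space N" "sets N = sets seq_borel" "exp_moments n N"
    and E: "exp_ineq n B C N c"
  shows "exp_ineq n B C (distr (N \<Otimes>\<^sub>M N) seq_borel (\<lambda>(x, y) i. x i + y i)) (2 * c)"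
  unfolding exp_ineq_def
proof (intro allI impI)
  fix F a assume F: "smooth_cls n B C F a"
  interpret prob_space N by fact
  interpret pair_prob_space N N by unfold_locales
  note [measurable_cong] = N(2)
  note D = smooth_clsD[OF F]
  have add: "(\<lambda>(x, y) i. x i + y i) \<in> measurable (N \<Otimes>\<^sub>M N) seq_borel"
    unfolding case_prod_beta by (intro measurable_seq_add) auto
  note [measurable] = D(1)
  note FD = smooth_cls_translate[OF F]
  define u where "u x = (LINT y|N. F (\<lambda>i. x i + y i))" for x
  have u: "smooth_cls n B C u (\<lambda>k x. LINT y|N. a k (\<lambda>i. x i + y i))"
    unfolding u_def by (rule smooth_cls_average[OF F N])
  have Fi: "integrable N (\<lambda>y. F (\<lambda>i. x i + y i))" "integrable N (\<lambda>y. exp (F (\<lambda>i. x i + y i)))" for x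
    by (rule smooth_cls_integrable[OF FD N])+
  let ?s = "\<lambda>y. \<Sum>i<n. \<bar>y i\<bar> :: real"
  let ?c = "\<bar>F (\<lambda>_. 0)\<bar>"
  have ei: "integrable N (\<lambda>y. exp (B * ?s y))" using N(3) by (simp add: exp_moments_def)
  have pi: "integrable (N \<Otimes>\<^sub>M N) (\<lambda>(x, y). exp ?c * exp (B * ?s x) * exp (B * ?s y))"
  proof (rule Fubini_integrable)
    show "integrable N (\<lambda>x. LINT y|N. norm (case (x, y) of (x, y) \<Rightarrow> exp ?c * exp (B * ?s x) * exp (B * ?s y)))"
      using ei by simp
    show "AE x in N. integrable N (\<lambda>y. case (x, y) of (x, y) \<Rightarrow> exp ?c * exp (B * ?s x) * exp (B * ?s y))"
      using ei by simp
  qed measurable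
  have e: "exp \<bar>F (\<lambda>i. x i + y i)\<bar> \<le> exp ?c * exp (B * ?s x) * exp (B * ?s y)" for x y
  proof -
    have "?s (\<lambda>i. x i + y i) \<le> ?s x + ?s y" by (simp add: sum.distrib[symmetric] sum_mono abs_triangle_ineq)
    then have "B * ?s (\<lambda>i. x i + y i) \<le> B * (?s x + ?s y)" using D(6) by (intro mult_left_mono)
    with smooth_cls_bound[OF F, of "\<lambda>i. x i + y i"] show ?thesis
      by (simp add: exp_add[symmetric] distrib_left)
  qed
  have Fm: "(\<lambda>(x, y). F (\<lambda>i. x i + y i)) \<in> borel_measurable (N \<Otimes>\<^sub>M N)"
    using measurable_compose[OF add D(1)] by (simp add: case_prod_beta)
  then have Fm': "(\<lambda>(x, y). exp (F (\<lambda>i. x i + y i))) \<in> borel_measurable (N \<Otimes>\<^sub>M N)"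
    unfolding case_prod_beta by measurable
  have p1: "integrable (N \<Otimes>\<^sub>M N) (\<lambda>(x, y). exp (F (\<lambda>i. x i + y i)))"
  proof (rule Bochner_Integration.integrable_bound[OF pi Fm'])
    have "exp (F (\<lambda>i. x i + y i)) \<le> exp ?c * exp (B * ?s x) * exp (B * ?s y)" for x y
      by (rule order.trans[OF _ e]) simp
    then show "AE x in N \<Otimes>\<^sub>M N. norm (case x of (x, y) \<Rightarrow> exp (F (\<lambda>i. x i + y i)))
        \<le> norm (case x of (x, y) \<Rightarrow> exp ?c * exp (B * ?s x) * exp (B * ?s y))" by (auto simp: abs_mult)
  qed
  have p2: "integrable (N \<Otimes>\<^sub>M N) (\<lambda>(x, y). F (\<lambda>i. x i + y i))"
  proof (rule Bochner_Integration.integrable_bound[OF pi Fm])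
    have "\<bar>F (\<lambda>i. x i + y i)\<bar> \<le> exp ?c * exp (B * ?s x) * exp (B * ?s y)" for x y
      by (rule order.trans[OF _ e]) (use exp_ge_add_one_self[of "\<bar>F (\<lambda>i. x i + y i)\<bar>"] in linarith)
    then show "AE x in N \<Otimes>\<^sub>M N. norm (case x of (x, y) \<Rightarrow> F (\<lambda>i. x i + y i))
        \<le> norm (case x of (x, y) \<Rightarrow> exp ?c * exp (B * ?s x) * exp (B * ?s y))" by (auto simp: abs_mult)
  qed
  let ?N2 = "distr (N \<Otimes>\<^sub>M N) seq_borel (\<lambda>(x, y) i. x i + y i)"
  have "(LINT y|?N2. exp (F y)) = (LINT z|(N \<Otimes>\<^sub>M N). (\<lambda>(x, y). exp (F (\<lambda>i. x i + y i))) z)"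
    by (subst integral_distr[OF add]) (simp_all add: split_beta')
  also have "\<dots> = (LINT x|N. LINT y|N. exp (F (\<lambda>i. x i + y i)))"
    using integral_fst'[OF p1] by simp
  also have "\<dots> \<le> (LINT x|N. exp (u x + c))"
  proof (rule integral_mono)
    show "integrable N (\<lambda>x. LINT y|N. exp (F (\<lambda>i. x i + y i)))" using integrable_fst'[OF p1] by simp
    show "integrable N (\<lambda>x. exp (u x + c))" using smooth_cls_integrable(2)[OF u N] by (simp add: exp_add)
    show "(LINT y|N. exp (F (\<lambda>i. x i + y i))) \<le> exp (u x + c)" for x
      using E FD[of x] unfolding exp_ineq_def u_def by blast
  qed
  also have "\<dots> = (LINT x|N. exp (u x)) * exp c" by (simp add: exp_add)
  also have "\<dots> \<le> exp ((LINT x|N. u x) + c) * exp c"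
    using E u unfolding exp_ineq_def by (intro mult_right_mono) auto
  also have "(LINT x|N. u x) = (LINT y|?N2. F y)"
    unfolding u_def using integral_fst'[OF p2] by (subst integral_distr[OF add]) (simp_all add: split_beta')
  finally show "(LINT y|?N2. exp (F y)) \<le> exp ((LINT y|?N2. F y) + 2 * c)"
    by (simp add: exp_add[symmetric] add.assoc)
qed

section \<open>Second-order expansion of exponential moments at small times\<close>

lemma exp_le_cubic_remainder: "exp z \<le> 1 + z + z\<^sup>2 / 2 + \<bar>z\<bar> ^ 3 * exp \<bar>z\<bar>" for z :: real
proof -
  obtain t where t: "\<bar>t\<bar> \<le> \<bar>z\<bar>" "exp z = (\<Sum>m<3. z ^ m / fact m) + exp t / fact 3 * z ^ 3"
    using Maclaurin_exp_le[of z 3] by blast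
  have "exp t / fact 3 * z ^ 3 \<le> \<bar>exp t / fact 3 * z ^ 3\<bar>" by (rule abs_ge_self)
  also have "\<dots> = exp t * \<bar>z\<bar> ^ 3 / 6" by (simp add: abs_mult power_abs fact_numeral)
  also have "\<dots> \<le> exp t * \<bar>z\<bar> ^ 3" by simp
  also have "\<dots> \<le> exp \<bar>z\<bar> * \<bar>z\<bar> ^ 3" using t(1) by (intro mult_right_mono) auto
  finally show ?thesis using t(2) by (simp add: eval_nat_numeral mult.commute)
qed

lemma power_le_fact_exp: "0 \<le> x \<Longrightarrow> x ^ k \<le> fact k * exp (x::real)"
proof -
  assume x: "0 \<le> x"
  obtain t where t: "exp x = (\<Sum>m<Suc k. x ^ m / fact m) + exp t / fact (Suc k) * x ^ Suc k"
    using Maclaurin_exp_le[of x "Suc k"] by blast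
  have "x ^ k / fact k \<le> (\<Sum>m<Suc k. x ^ m / fact m)"
    by (rule member_le_sum) (use x in auto)
  moreover have "0 \<le> exp t / fact (Suc k) * x ^ Suc k" using x by simp
  ultimately have "x ^ k / fact k \<le> exp x" using t by linarith
  then show ?thesis by (simp add: field_simps)
qed

text \<open>The first-order term \<open>Z - F0\<close> is left whole, so that its mean supplies the
  mean of \<open>F\<close> in the exponent; only the quadratic term is compared with the linear part
  of \<open>F\<close> at the origin. \<open>K\<close> is fixed before \<open>F\<close>, because
  \<open>exp_ineq\<close> asks for one constant for the whole class.\<close>

lemma exp_ineq_small_time:
  assumes N: "prob_space N" "sets N = sets seq_borel" "exp_moments n N"
    and V: "\<And>i. i < n \<Longrightarrow> integrable N (\<lambda>y. (y i)\<^sup>2)" "\<And>i. i < n \<Longrightarrow> (LINT y|N. (y i)\<^sup>2) \<le> V"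
    and pos: "0 \<le> B" "0 \<le> C" "0 \<le> V"
  obtains K where "\<And>t. 0 \<le> t \<Longrightarrow> t \<le> 1 \<Longrightarrow>
    exp_ineq n B C (distr N seq_borel (\<lambda>y i. sqrt t * y i)) (t * (B\<^sup>2 * V / 2) + t * sqrt t * K)"
proof -
  interpret prob_space N by fact
  note [measurable_cong] = N(2)
  have [measurable]: "(\<lambda>y. y i) \<in> borel_measurable N" for i
    by (simp add: measurable_cong_sets[OF N(2) refl])
  let ?s = "\<lambda>y. \<Sum>i<n. \<bar>y i\<bar> :: real"
  \<comment> \<open>With \<open>t * sqrt t\<close> factored out, the three terms bound half the
    cross term of linear part and Taylor remainder of \<open>F\<close>, half the squared remainder,
    and the cubic remainder of the exponential. For the second,
    \<open>t * t \<le> t * sqrt t\<close> on \<open>t \<le> 1\<close> is used.\<close>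
  define g where "g s = B * C * s ^ 3 + C\<^sup>2 * s ^ 4 / 2 + B ^ 3 * s ^ 3 * exp (B * s)" for s
  have gm [measurable]: "g \<in> borel_measurable borel" unfolding g_def by measurable
  have em: "integrable N (\<lambda>y. exp (c * ?s y))" for c using N(3) by (simp add: exp_moments_def)
  have g0: "0 \<le> g s" if "0 \<le> s" for s using pos that by (simp add: g_def)
  have gi: "integrable N (\<lambda>y. g (?s y))"
  proof (rule Bochner_Integration.integrable_bound)
    let ?B = "\<lambda>y. (6 * B * C + 12 * C\<^sup>2) * exp (1 * ?s y) + 6 * B ^ 3 * exp ((1 + B) * ?s y)"
    show "integrable N ?B" by (intro Bochner_Integration.integrable_add integrable_mult_right em)
    have "g s \<le> (6 * B * C + 12 * C\<^sup>2) * exp (1 * s) + 6 * B ^ 3 * exp ((1 + B) * s)" if s: "0 \<le> s" for s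
    proof -
      have s3: "s ^ 3 \<le> 6 * exp s" and s4: "s ^ 4 \<le> 24 * exp s"
        using power_le_fact_exp[OF s, of 3] power_le_fact_exp[OF s, of 4] by (simp_all add: fact_numeral)
      have f1: "B * C * s ^ 3 \<le> B * C * (6 * exp s)" using s3 pos by (intro mult_left_mono) auto
      have f2: "C\<^sup>2 * s ^ 4 / 2 \<le> C\<^sup>2 * (24 * exp s) / 2"
        using s4 by (intro divide_right_mono mult_left_mono) auto
      have f3: "B ^ 3 * s ^ 3 * exp (B * s) \<le> B ^ 3 * (6 * exp s) * exp (B * s)"
        using s3 pos by (intro mult_right_mono mult_left_mono) auto
      have "g s \<le> B * C * (6 * exp s) + C\<^sup>2 * (24 * exp s) / 2 + B ^ 3 * (6 * exp s) * exp (B * s)"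
        unfolding g_def by (intro add_mono f1 f2 f3)
      then show ?thesis by (simp add: algebra_simps exp_add)
    qed
    then have "g (?s y) \<le> ?B y" for y by (simp add: sum_nonneg)
    then show "AE y in N. norm (g (?s y)) \<le> norm (?B y)"
      using g0 by (intro AE_I2) (smt (verit) real_norm_def sum_nonneg abs_ge_zero)
  qed measurable
  define K where "K = (LINT y|N. g (?s y))"
  show ?thesis
  proof (rule that[of K])
    fix t :: real assume t: "0 \<le> t" "t \<le> 1"
    have sc: "(\<lambda>y i. sqrt t * y i) \<in> measurable N seq_borel"
      by (rule measurable_PiM_single') auto
    show "exp_ineq n B C (distr N seq_borel (\<lambda>y i. sqrt t * y i)) (t * (B\<^sup>2 * V / 2) + t * sqrt t * K)"
      unfolding exp_ineq_def
    proof (intro allI impI)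
      fix F a assume F: "smooth_cls n B C F a"
      note D = smooth_clsD[OF F]
      note [measurable] = D(1)
      define b where "b i = a i (\<lambda>_. 0)" for i
      define F0 where "F0 = F (\<lambda>_. 0)"
      define Z where "Z y = F (\<lambda>i. sqrt t * y i)" for y
      have [measurable]: "Z \<in> borel_measurable N" unfolding Z_def
        by (rule measurable_compose[OF sc D(1)])
      define l where "l y = (\<Sum>i<n. b i * y i)" for y
      have b: "(\<Sum>i<n. \<bar>b i\<bar>) \<le> B" unfolding b_def by (rule D(3))
      have lip: "\<bar>Z y - F0\<bar> \<le> B * (sqrt t * ?s y)" for y
        using D(4)[of "\<lambda>_. 0" "\<lambda>i. sqrt t * y i"] t
        by (simp add: Z_def F0_def abs_mult sum_distrib_left)
      have s2: "(\<Sum>i<n. (y i)\<^sup>2) \<le> (?s y)\<^sup>2" for y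
      proof -
        have "(\<Sum>i<n. (y i)\<^sup>2) = (\<Sum>i<n. \<bar>y i\<bar> * \<bar>y i\<bar>)" by (simp add: power2_eq_square)
        also have "\<dots> \<le> (\<Sum>i<n. \<bar>y i\<bar> * ?s y)"
          by (intro sum_mono mult_left_mono member_le_sum) auto
        finally show ?thesis by (simp add: sum_distrib_right power2_eq_square)
      qed
      have rem: "\<bar>Z y - F0 - sqrt t * l y\<bar> \<le> C * (t * (?s y)\<^sup>2)" for y
      proof -
        have "\<bar>Z y - F0 - sqrt t * l y\<bar> \<le> C * (\<Sum>i<n. (sqrt t * y i)\<^sup>2)"
          using D(5)[of "\<lambda>_. 0" "\<lambda>i. sqrt t * y i"]
          by (simp add: Z_def F0_def b_def l_def sum_distrib_left mult_ac)
        also have "(\<Sum>i<n. (sqrt t * y i)\<^sup>2) = t * (\<Sum>i<n. (y i)\<^sup>2)"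
          using t by (simp add: power_mult_distrib sum_distrib_left)
        also have "C * (t * (\<Sum>i<n. (y i)\<^sup>2)) \<le> C * (t * (?s y)\<^sup>2)"
          using s2 t pos by (intro mult_left_mono) auto
        finally show ?thesis .
      qed
      have lb: "\<bar>l y\<bar> \<le> B * ?s y" for y
      proof -
        have "\<bar>l y\<bar> \<le> (\<Sum>i<n. \<bar>b i\<bar> * \<bar>y i\<bar>)" unfolding l_def by (rule order.trans[OF sum_abs]) (simp add: abs_mult)
        also have "\<dots> \<le> (\<Sum>i<n. \<bar>b i\<bar> * ?s y)"
          by (intro sum_mono mult_left_mono member_le_sum) auto
        also have "\<dots> \<le> B * ?s y"
          unfolding sum_distrib_right[symmetric] using b by (intro mult_right_mono) (auto intro: sum_nonneg)
        finally show ?thesis .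
      qed
      \<comment> \<open>Splitting \<open>\<bar>b i\<bar>\<close> into two square roots makes
        Cauchy-Schwarz produce the l1 norm of the gradient times a weighted sum of squares. Bounds
        on the single second moments then suffice, whatever the correlations.\<close>
      have l2: "(l y)\<^sup>2 \<le> B * (\<Sum>i<n. \<bar>b i\<bar> * (y i)\<^sup>2)" for y
      proof -
        have "\<bar>l y\<bar> \<le> (\<Sum>i<n. sqrt \<bar>b i\<bar> * (sqrt \<bar>b i\<bar> * \<bar>y i\<bar>))"
          unfolding l_def by (rule order.trans[OF sum_abs]) (simp add: abs_mult mult.assoc[symmetric])
        then have "(l y)\<^sup>2 \<le> (\<Sum>i<n. sqrt \<bar>b i\<bar> * (sqrt \<bar>b i\<bar> * \<bar>y i\<bar>))\<^sup>2"
          by (metis abs_ge_zero power2_abs power_mono)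
        also have "\<dots> \<le> (\<Sum>i<n. (sqrt \<bar>b i\<bar>)\<^sup>2) * (\<Sum>i<n. (sqrt \<bar>b i\<bar> * \<bar>y i\<bar>)\<^sup>2)"
          by (rule Cauchy_Schwarz_ineq_sum)
        also have "\<dots> = (\<Sum>i<n. \<bar>b i\<bar>) * (\<Sum>i<n. \<bar>b i\<bar> * (y i)\<^sup>2)" by (simp add: power_mult_distrib)
        also have "\<dots> \<le> B * (\<Sum>i<n. \<bar>b i\<bar> * (y i)\<^sup>2)"
          using b by (intro mult_right_mono) (auto intro: sum_nonneg)
        finally show ?thesis .
      qed
      have li: "integrable N (\<lambda>y. \<Sum>i<n. \<bar>b i\<bar> * (y i)\<^sup>2)"
        using V(1) by (intro Bochner_Integration.integrable_sum integrable_mult_right) auto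
      have lE: "(LINT y|N. (\<Sum>i<n. \<bar>b i\<bar> * (y i)\<^sup>2)) \<le> B * V"
      proof -
        have "(LINT y|N. (\<Sum>i<n. \<bar>b i\<bar> * (y i)\<^sup>2)) = (\<Sum>i<n. \<bar>b i\<bar> * (LINT y|N. (y i)\<^sup>2))"
          using V(1) by (subst Bochner_Integration.integral_sum) auto
        also have "\<dots> \<le> (\<Sum>i<n. \<bar>b i\<bar> * V)" using V(2) by (intro sum_mono mult_left_mono) auto
        also have "\<dots> \<le> B * V" unfolding sum_distrib_right[symmetric] using b pos by (intro mult_right_mono) auto
        finally show ?thesis .
      qed
      have pt: "exp (Z y - F0) \<le> 1 + (Z y - F0) + t * (B * (\<Sum>i<n. \<bar>b i\<bar> * (y i)\<^sup>2)) / 2 + t * sqrt t * g (?s y)" for y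
      proof -
        define d where "d = Z y - F0"
        define r where "r = d - sqrt t * l y"
        let ?S = "?s y"
        have S: "0 \<le> ?S" by (auto intro: sum_nonneg)
        have r: "\<bar>r\<bar> \<le> C * t * ?S\<^sup>2" using rem[of y] by (simp add: r_def d_def mult.assoc)
        have st: "sqrt t \<le> 1" "0 \<le> sqrt t" "sqrt t * sqrt t = t" using t by auto
        have d1: "\<bar>d\<bar> \<le> sqrt t * (B * ?S)" using lip[of y] by (simp add: d_def mult_ac)
        also have "\<dots> \<le> 1 * (B * ?S)" using st S pos by (intro mult_right_mono) auto
        finally have d2: "\<bar>d\<bar> \<le> B * ?S" by simp
        have "\<bar>d\<bar> ^ 3 \<le> (sqrt t * (B * ?S)) ^ 3" using d1 by (intro power_mono) auto
        also have "\<dots> = t * sqrt t * (B ^ 3 * ?S ^ 3)" using st(3) by (simp add: power3_eq_cube mult_ac)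
        finally have "\<bar>d\<bar> ^ 3 * exp \<bar>d\<bar> \<le> (t * sqrt t * (B ^ 3 * ?S ^ 3)) * exp (B * ?S)"
          using d2 t pos S by (intro mult_mono) auto
        then have d3: "\<bar>d\<bar> ^ 3 * exp \<bar>d\<bar> \<le> t * sqrt t * (B ^ 3 * ?S ^ 3 * exp (B * ?S))"
          by (simp add: mult_ac)
        have "2 * (sqrt t * l y) * r \<le> 2 * (\<bar>sqrt t * l y\<bar> * \<bar>r\<bar>)"
          by (metis abs_mult abs_ge_self mult.assoc mult_left_mono zero_le_numeral)
        also have "\<bar>sqrt t * l y\<bar> * \<bar>r\<bar> \<le> (sqrt t * (B * ?S)) * (C * t * ?S\<^sup>2)"
          using lb[of y] r st S pos by (intro mult_mono) (auto simp: abs_mult intro: mult_left_mono)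
        finally have x1: "2 * (sqrt t * l y) * r \<le> t * sqrt t * (2 * (B * C * ?S ^ 3))"
          by (simp add: power2_eq_square power3_eq_cube mult_ac)
        have "r\<^sup>2 \<le> (C * t * ?S\<^sup>2)\<^sup>2" using r by (metis abs_ge_zero power2_abs power_mono)
        also have "\<dots> = t * t * (C\<^sup>2 * ?S ^ 4)" by (simp add: eval_nat_numeral mult_ac)
        also have "\<dots> \<le> t * sqrt t * (C\<^sup>2 * ?S ^ 4)"
        proof (intro mult_right_mono mult_left_mono)
          show "t \<le> sqrt t" using st mult_right_mono[of "sqrt t" 1 "sqrt t"] by simp
        qed (use t in auto)
        finally have x2: "r\<^sup>2 \<le> t * sqrt t * (C\<^sup>2 * ?S ^ 4)" .
        have "d\<^sup>2 = (sqrt t * l y + r)\<^sup>2" by (simp add: r_def)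
        also have "\<dots> = t * (l y)\<^sup>2 + 2 * (sqrt t * l y) * r + r\<^sup>2"
          using t by (simp add: power2_sum power_mult_distrib)
        also have "\<dots> \<le> t * (B * (\<Sum>i<n. \<bar>b i\<bar> * (y i)\<^sup>2)) + t * sqrt t * (2 * (B * C * ?S ^ 3)) + t * sqrt t * (C\<^sup>2 * ?S ^ 4)"
          using l2[of y] t by (intro add_mono mult_left_mono x1 x2) auto
        finally have d4: "d\<^sup>2 / 2 \<le> t * (B * (\<Sum>i<n. \<bar>b i\<bar> * (y i)\<^sup>2)) / 2 + t * sqrt t * (B * C * ?S ^ 3 + C\<^sup>2 * ?S ^ 4 / 2)"
          by (simp add: algebra_simps)
        have "t * sqrt t * g ?S = t * sqrt t * (B * C * ?S ^ 3 + C\<^sup>2 * ?S ^ 4 / 2) + t * sqrt t * (B ^ 3 * ?S ^ 3 * exp (B * ?S))"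
          by (simp add: g_def distrib_left)
        then show ?thesis using exp_le_cubic_remainder[of d] d3 d4 unfolding d_def[symmetric] by linarith
      qed
      have Zi: "integrable N Z"
      proof (rule Bochner_Integration.integrable_bound)
        show "integrable N (\<lambda>y. \<bar>F0\<bar> + exp (B * sqrt t * ?s y))" using em by simp
        have "\<bar>Z y\<bar> \<le> \<bar>F0\<bar> + exp (B * sqrt t * ?s y)" for y
          using lip[of y] exp_ge_add_one_self[of "B * sqrt t * ?s y"] unfolding mult.assoc by linarith
        then show "AE y in N. norm (Z y) \<le> norm (\<bar>F0\<bar> + exp (B * sqrt t * ?s y))"
          by (auto intro!: AE_I2 order.trans[OF _ abs_ge_self])
      qed measurable
      have eZi: "integrable N (\<lambda>y. exp (Z y))"
      proof (rule Bochner_Integration.integrable_bound)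
        show "integrable N (\<lambda>y. exp F0 * exp (B * sqrt t * ?s y))" using em by simp
        have "exp (Z y) \<le> exp F0 * exp (B * sqrt t * ?s y)" for y
          using lip[of y] by (simp add: exp_add[symmetric] mult.assoc)
        then show "AE y in N. norm (exp (Z y)) \<le> norm (exp F0 * exp (B * sqrt t * ?s y))" by auto
      qed measurable
      have eq: "exp (Z y - F0) = exp (Z y) * exp (- F0)" for y by (simp add: exp_diff exp_minus field_simps)
      have "(LINT y|N. exp (Z y)) * exp (- F0) = (LINT y|N. exp (Z y - F0))" unfolding eq by simp
      also have "\<dots> \<le> (LINT y|N. 1 + (Z y - F0) + t * (B * (\<Sum>i<n. \<bar>b i\<bar> * (y i)\<^sup>2)) / 2 + t * sqrt t * g (?s y))"
      proof (rule integral_mono)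
        show "integrable N (\<lambda>y. exp (Z y - F0))" unfolding eq using eZi by simp
        show "integrable N (\<lambda>y. 1 + (Z y - F0) + t * (B * (\<Sum>i<n. \<bar>b i\<bar> * (y i)\<^sup>2)) / 2 + t * sqrt t * g (?s y))"
          using Zi li gi by (intro Bochner_Integration.integrable_add Bochner_Integration.integrable_diff
             integrable_divide_zero integrable_mult_right integrable_const) auto
      qed (rule pt)
      also have "\<dots> = 1 + ((LINT y|N. Z y) - F0) + t * (B * (LINT y|N. (\<Sum>i<n. \<bar>b i\<bar> * (y i)\<^sup>2))) / 2 + t * sqrt t * K"
        using Zi li gi unfolding K_def by (simp add: prob_space)
      also have "\<dots> \<le> 1 + ((LINT y|N. Z y) - F0) + t * (B * (B * V)) / 2 + t * sqrt t * K"
        using lE t pos by (intro add_mono divide_right_mono mult_left_mono) auto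
      also have "\<dots> = 1 + (((LINT y|N. Z y) + (t * (B\<^sup>2 * V / 2) + t * sqrt t * K)) - F0)"
        by (simp add: power2_eq_square algebra_simps)
      also have "\<dots> \<le> exp (((LINT y|N. Z y) + (t * (B\<^sup>2 * V / 2) + t * sqrt t * K)) - F0)"
        by (rule exp_ge_add_one_self)
      finally have "(LINT y|N. exp (Z y)) * exp (- F0) * exp F0
          \<le> exp (((LINT y|N. Z y) + (t * (B\<^sup>2 * V / 2) + t * sqrt t * K)) - F0) * exp F0"
        by (intro mult_right_mono) auto
      then have "(LINT y|N. exp (Z y)) \<le> exp ((LINT y|N. Z y) + (t * (B\<^sup>2 * V / 2) + t * sqrt t * K))"
        by (simp only: mult.assoc exp_add[symmetric]) simp
      moreover have "(LINT y|distr N seq_borel (\<lambda>y i. sqrt t * y i). exp (F y)) = (LINT y|N. exp (Z y))"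
        "(LINT y|distr N seq_borel (\<lambda>y i. sqrt t * y i). F y) = (LINT y|N. Z y)"
        unfolding Z_def by (subst integral_distr[OF sc]; simp)+
      ultimately show "(LINT y|distr N seq_borel (\<lambda>y i. sqrt t * y i). exp (F y))
        \<le> exp ((LINT y|distr N seq_borel (\<lambda>y i. sqrt t * y i). F y) + (t * (B\<^sup>2 * V / 2) + t * sqrt t * K))"
        by simp
    qed
  qed
qed


section \<open>Gaussian laws on sequences and the doubling of time\<close>

definition gauss_law :: "(nat \<Rightarrow> real) measure \<Rightarrow> (nat \<Rightarrow> (nat \<Rightarrow> real) \<Rightarrow> real) \<Rightarrow> bool" where
  "gauss_law N Q \<longleftrightarrow> prob_space N \<and> sets N = sets seq_borel
     \<and> (\<forall>n c. cgauss N (\<lambda>y. \<Sum>i<n. c i * y i) (Q n c))"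

abbreviation scaled_law :: "real \<Rightarrow> (nat \<Rightarrow> real) measure \<Rightarrow> (nat \<Rightarrow> real) measure" where
  "scaled_law t N \<equiv> distr N seq_borel (\<lambda>y i. sqrt t * y i)"

lemma gauss_law_coord:
  assumes "gauss_law N Q" shows "\<exists>v. cgauss N (\<lambda>y. y i) v"
proof -
  have "cgauss N (\<lambda>y. \<Sum>j<Suc i. (if j = i then 1 else 0) * y j) (Q (Suc i) (\<lambda>j. if j = i then 1 else 0))"
    using assms by (simp add: gauss_law_def del: sum.lessThan_Suc)
  moreover have "(\<Sum>j<Suc i. (if j = i then 1 else 0) * y j) = y i" for y :: "nat \<Rightarrow> real" by simp
  ultimately show ?thesis by auto
qed

lemma gauss_law_exp_moments:
  assumes "gauss_law N Q" shows "exp_moments n N"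
proof -
  interpret prob_space N using assms by (simp add: gauss_law_def)
  show ?thesis unfolding exp_moments_def
    using exp_sum_moment[of n "\<lambda>i y. y i"] gauss_law_coord[OF assms] by blast
qed

lemma gauss_law_char:
  assumes "gauss_law N Q"
  shows "(CLINT y|N. iexp (\<Sum>i<n. c i * y i)) = complex_of_real (exp (- (Q n c / 2)))"
proof -
  have "cgauss N (\<lambda>y. \<Sum>i<n. c i * y i) (Q n c)" using assms by (simp add: gauss_law_def)
  from cgauss_char[OF this, of 1] show ?thesis by simp
qed

lemma gauss_law_scaled:
  assumes G: "gauss_law N Q" and t: "0 \<le> t"
  shows "gauss_law (scaled_law t N) (\<lambda>n c. t * Q n c)"
proof -
  interpret prob_space N using G by (simp add: gauss_law_def)
  have s[measurable_cong]: "sets N = sets seq_borel" using G by (simp add: gauss_law_def)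
  have sc[measurable]: "(\<lambda>y i. sqrt t * y i) \<in> measurable N seq_borel"
    by (rule measurable_PiM_single') auto
  have "cgauss (scaled_law t N) (\<lambda>y. \<Sum>i<n. c i * y i) (t * Q n c)" for n c
  proof -
    have g: "cgauss N (\<lambda>y. \<Sum>i<n. c i * y i) (Q n c)" using G by (simp add: gauss_law_def)
    have "(CLINT y|scaled_law t N. iexp (u * (\<Sum>i<n. c i * y i))) = complex_of_real (exp (- (u\<^sup>2 * (t * Q n c) / 2)))" for u
    proof -
      have "(CLINT y|scaled_law t N. iexp (u * (\<Sum>i<n. c i * y i)))
         = (CLINT y|N. iexp (u * (\<Sum>i<n. c i * (sqrt t * y i))))"
        by (subst integral_distr[OF sc]) auto
      also have "\<dots> = (CLINT y|N. iexp ((u * sqrt t) * (\<Sum>i<n. c i * y i)))"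
        by (simp only: sum_distrib_left mult_ac)
      also have "\<dots> = complex_of_real (exp (- ((u * sqrt t)\<^sup>2 * Q n c / 2)))" by (rule cgauss_char[OF g])
      also have "(u * sqrt t)\<^sup>2 * Q n c = u\<^sup>2 * (t * Q n c)" using t by (simp add: power_mult_distrib)
      finally show ?thesis .
    qed
    then show ?thesis using cgauss_nonneg[OF g] t unfolding cgauss_def by auto
  qed
  then show ?thesis unfolding gauss_law_def by (auto intro: prob_space_distr)
qed

text \<open>Both sides have characteristic function \<open>exp (- t * Q n c)\<close> on the
  functional with coefficients \<open>c\<close>: a product of two equal exponentials on the left,
  doubled time on the right. \<open>Cramer_Wold_seq\<close> lifts this to the laws.\<close>

lemma gauss_law_double:
  assumes G: "gauss_law N Q" and t: "0 \<le> t"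
  shows "distr (scaled_law t N \<Otimes>\<^sub>M scaled_law t N) seq_borel (\<lambda>(x, y) i. x i + y i) = scaled_law (2 * t) N"
proof (rule Cramer_Wold_seq)
  let ?\<mu> = "scaled_law t N"
  have G1: "gauss_law ?\<mu> (\<lambda>n c. t * Q n c)" by (rule gauss_law_scaled[OF G t])
  have G2: "gauss_law (scaled_law (2 * t) N) (\<lambda>n c. 2 * t * Q n c)" using gauss_law_scaled[OF G, of "2 * t"] t by simp
  interpret \<mu>: prob_space ?\<mu> using G1 by (simp add: gauss_law_def)
  interpret pair_prob_space ?\<mu> ?\<mu> by unfold_locales
  have add[measurable]: "(\<lambda>(x, y) i. x i + y i) \<in> measurable (?\<mu> \<Otimes>\<^sub>M ?\<mu>) seq_borel"
    unfolding case_prod_beta by (intro measurable_seq_add) auto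
  show "prob_space (distr (?\<mu> \<Otimes>\<^sub>M ?\<mu>) seq_borel (\<lambda>(x, y) i. x i + y i))" by (rule P.prob_space_distr[OF add])
  show "prob_space (scaled_law (2 * t) N)" using G2 by (simp add: gauss_law_def)
  fix n c
  let ?e = "\<lambda>y::nat \<Rightarrow> real. iexp (\<Sum>i<n. c i * y i)"
  have em[measurable]: "?e \<in> borel_measurable seq_borel" by measurable
  have "(CLINT y|distr (?\<mu> \<Otimes>\<^sub>M ?\<mu>) seq_borel (\<lambda>(x, y) i. x i + y i). ?e y)
     = integral\<^sup>L (?\<mu> \<Otimes>\<^sub>M ?\<mu>) (\<lambda>(x, y). ?e x * ?e y)"
    by (subst integral_distr[OF add em]) (simp add: split_beta' distrib_left sum.distrib exp_add)
  also have "\<dots> = (CLINT x|?\<mu>. CLINT y|?\<mu>. ?e x * ?e y)"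
  proof -
    have i: "integrable (?\<mu> \<Otimes>\<^sub>M ?\<mu>) (\<lambda>(x, y). ?e x * ?e y)"
      by (rule P.integrable_bounded[of _ 1]) (auto simp: norm_mult split_beta')
    show ?thesis using integral_fst'[OF i] by (simp only: split_conv)
  qed
  also have "\<dots> = (CLINT x|?\<mu>. ?e x) * (CLINT y|?\<mu>. ?e y)" by simp
  also have "\<dots> = complex_of_real (exp (- (2 * t * Q n c / 2)))"
    unfolding gauss_law_char[OF G1] by (simp flip: of_real_mult exp_add)
  also have "\<dots> = (CLINT y|scaled_law (2 * t) N. ?e y)" unfolding gauss_law_char[OF G2] ..
  finally show "(CLINT y|distr (?\<mu> \<Otimes>\<^sub>M ?\<mu>) seq_borel (\<lambda>(x, y) i. x i + y i). ?e y) = (CLINT y|scaled_law (2 * t) N. ?e y)" .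
qed auto

text \<open>Doubling the time \<open>k\<close> times from \<open>t = 1/2\<^sup>k\<close> multiplies the bound of
  \<open>exp_ineq_small_time\<close> by \<open>2\<^sup>k\<close>: the main term reaches its value at time \<open>1\<close>, and the error term
  of order \<open>t sqrt t\<close> disappears as \<open>k\<close> grows.\<close>

lemma gauss_exp_ineq:
  assumes G: "gauss_law N Q" and V: "\<And>i. i < n \<Longrightarrow> (LINT y|N. (y i)\<^sup>2) \<le> V" "0 \<le> V"
    and pos: "0 \<le> B" "0 \<le> C"
  shows "exp_ineq n B C N (B\<^sup>2 * V / 2)"
proof -
  interpret prob_space N using G by (simp add: gauss_law_def)
  have s: "sets N = sets seq_borel" using G by (simp add: gauss_law_def)
  have Vi: "integrable N (\<lambda>y. (y i)\<^sup>2)" for i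
    using gauss_law_coord[OF G, of i] cgauss_integrable_square by blast
  obtain K where K: "\<And>t. 0 \<le> t \<Longrightarrow> t \<le> 1 \<Longrightarrow>
    exp_ineq n B C (scaled_law t N) (t * (B\<^sup>2 * V / 2) + t * sqrt t * K)"
    using exp_ineq_small_time[OF prob_space_axioms s gauss_law_exp_moments[OF G] Vi V(1) pos V(2)] by blast
  have step: "exp_ineq n B C N (B\<^sup>2 * V / 2 + sqrt ((1/2) ^ k) * K)" for k
  proof -
    define t :: real where "t = (1/2) ^ k"
    have t: "0 \<le> t" "t \<le> 1" unfolding t_def by (auto intro: power_le_one)
    define c where "c = t * (B\<^sup>2 * V / 2) + t * sqrt t * K"
    have "exp_ineq n B C (scaled_law (2 ^ j * t) N) (2 ^ j * c)" for j
    proof (induction j)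
      case 0
      then show ?case using K[OF t] by (simp add: c_def)
    next
      case (Suc j)
      have p: "0 \<le> 2 ^ j * t" using t by simp
      have G1: "gauss_law (scaled_law (2 ^ j * t) N) (\<lambda>n c. (2 ^ j * t) * Q n c)" by (rule gauss_law_scaled[OF G p])
      have "exp_ineq n B C (distr (scaled_law (2 ^ j * t) N \<Otimes>\<^sub>M scaled_law (2 ^ j * t) N) seq_borel (\<lambda>(x, y) i. x i + y i)) (2 * (2 ^ j * c))"
        by (rule exp_ineq_convolution[OF _ _ _ Suc.IH]) (use G1 gauss_law_exp_moments[OF G1] in \<open>auto simp: gauss_law_def\<close>)
      then show ?case unfolding gauss_law_double[OF G p] by (simp add: mult.assoc)
    qed
    from this[of k] have "exp_ineq n B C (scaled_law (2 ^ k * t) N) (2 ^ k * c)" .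
    moreover have "2 ^ k * t = 1" by (simp add: t_def power_divide)
    moreover have "2 ^ k * c = (2 ^ k * t) * (B\<^sup>2 * V / 2) + (2 ^ k * t) * (sqrt t * K)"
      by (simp add: c_def algebra_simps)
    moreover have "scaled_law 1 N = N" using distr_id2[OF s[symmetric]] by (simp add: id_def)
    ultimately show ?thesis by (simp add: t_def)
  qed
  show ?thesis unfolding exp_ineq_def
  proof (intro allI impI)
    fix F a assume F: "smooth_cls n B C F a"
    have "(\<lambda>k. exp ((LINT y|N. F y) + (B\<^sup>2 * V / 2 + sqrt ((1/2) ^ k) * K)))
      \<longlonglongrightarrow> exp ((LINT y|N. F y) + (B\<^sup>2 * V / 2 + sqrt 0 * K))"
      by (intro tendsto_intros LIMSEQ_power_zero) auto
    then show "(LINT y|N. exp (F y)) \<le> exp ((LINT y|N. F y) + B\<^sup>2 * V / 2)"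
      using step F unfolding exp_ineq_def by (intro LIMSEQ_le_const) auto
  qed
qed

section \<open>Suprema of real Gaussian families\<close>

lemma exp_le_quadratic:
  assumes "\<bar>z::real\<bar> \<le> 1" shows "exp z \<le> 1 + z + 2 * z\<^sup>2"
proof -
  obtain t where t: "\<bar>t\<bar> \<le> \<bar>z\<bar>" "exp z = (\<Sum>m<2. z ^ m / fact m) + exp t / fact 2 * z ^ 2"
    using Maclaurin_exp_le[of z 2] by blast
  have "t \<le> 1" using t(1) assms by linarith
  then have "exp t \<le> exp 1" by simp
  then have "exp t / 2 \<le> 2" using exp_le by linarith
  then have "exp t / 2 * z\<^sup>2 \<le> 2 * z\<^sup>2" by (intro mult_right_mono) auto
  with t(2) show ?thesis by (simp add: eval_nat_numeral)
qed

text \<open>An increment of log-sum-exp is the logarithm of a mean of exponentials under Gibbs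
  weights \<open>p\<close>. The three estimates become the two sides of the second-order expansion
  and the Lipschitz bound.\<close>

lemma log_mean_exp_bounds:
  fixes p z :: "nat \<Rightarrow> real"
  assumes p: "\<And>i. i < n \<Longrightarrow> 0 \<le> p i" "(\<Sum>i<n. p i) = 1"
  defines "E \<equiv> \<Sum>i<n. p i * exp (z i)" and "m \<equiv> \<Sum>i<n. p i * z i" and "q \<equiv> \<Sum>i<n. (z i)\<^sup>2"
  shows "m \<le> ln E" "ln E \<le> m + 2 * q" "\<bar>ln E\<bar> \<le> (\<Sum>i<n. \<bar>z i\<bar>)" "0 < E"
proof -
  \<comment> \<open>Jensen's inequality, from the tangent of the exponential at the mean
    \<open>m\<close>.\<close>
  have "exp m * (\<Sum>i<n. p i * (1 + (z i - m))) \<le> exp m * (\<Sum>i<n. p i * exp (z i - m))"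
    by (intro mult_left_mono sum_mono exp_ge_add_one_self p) auto
  also have "\<dots> = E" unfolding E_def sum_distrib_left
    by (intro sum.cong refl) (simp add: exp_diff)
  also have "(\<Sum>i<n. p i * (1 + (z i - m))) = (\<Sum>i<n. p i) + (\<Sum>i<n. p i * z i) - (\<Sum>i<n. p i) * m"
    by (simp add: algebra_simps sum.distrib sum_subtractf sum_distrib_left)
  also have "\<dots> = 1" using p by (simp add: m_def)
  finally have E: "exp m \<le> E" by simp
  then show E0: "0 < E" by (meson exp_gt_zero less_le_trans)
  show mE: "m \<le> ln E" using E E0 by (simp add: ln_ge_iff)
  have avg: "(\<Sum>i<n. p i * w i) \<le> K" if "\<And>i. i < n \<Longrightarrow> w i \<le> K" for w K
  proof -
    have "(\<Sum>i<n. p i * w i) \<le> (\<Sum>i<n. p i * K)" using p that by (intro sum_mono mult_left_mono) auto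
    then show ?thesis using p by (simp flip: sum_distrib_right)
  qed
  have top: "ln E \<le> s" if "\<And>i. i < n \<Longrightarrow> z i \<le> s" for s
  proof -
    have "E \<le> exp s" unfolding E_def using that by (intro avg) auto
    then show ?thesis using E0 by (metis ln_exp ln_le_cancel_iff exp_gt_zero)
  qed
  have bot: "- s \<le> m" if "\<And>i. i < n \<Longrightarrow> - s \<le> z i" for s
    using avg[of "\<lambda>i. - z i" s] that by (fastforce simp: m_def sum_negf)
  show "ln E \<le> m + 2 * q"
  proof (cases "q \<le> 1")
    case True
    have z1: "(z i)\<^sup>2 \<le> q" if "i < n" for i unfolding q_def using that by (intro member_le_sum) auto
    have z: "\<bar>z i\<bar> \<le> 1" if "i < n" for i
      using order.trans[OF z1[OF that] True] by (simp add: abs_square_le_1)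
    have "E \<le> (\<Sum>i<n. p i * (1 + z i + 2 * (z i)\<^sup>2))" unfolding E_def
      using z p by (intro sum_mono mult_left_mono exp_le_quadratic) auto
    also have "\<dots> = 1 + m + 2 * (\<Sum>i<n. p i * (z i)\<^sup>2)" using p(2)
      by (simp add: m_def distrib_left sum.distrib sum_distrib_left mult_ac)
    also have "\<dots> \<le> 1 + (m + 2 * q)" using avg[of "\<lambda>i. (z i)\<^sup>2" q] z1 by simp
    also have "\<dots> \<le> exp (m + 2 * q)" by (rule exp_ge_add_one_self)
    finally show ?thesis using E0 by (metis ln_exp ln_le_cancel_iff exp_gt_zero)
  next
    case False
    have z1: "\<bar>z i\<bar> \<le> sqrt q" if "i < n" for i
    proof -
      have "(z i)\<^sup>2 \<le> q" unfolding q_def using that by (intro member_le_sum) auto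
      then show ?thesis by (metis real_sqrt_abs real_sqrt_le_mono)
    qed
    have z2: "z i \<le> sqrt q" "- sqrt q \<le> z i" if "i < n" for i using z1[OF that] by linarith+
    have "ln E \<le> sqrt q" by (rule top[OF z2(1)])
    moreover have "- sqrt q \<le> m" by (rule bot[OF z2(2)])
    moreover have "sqrt q \<le> q" using False by (metis linear real_sqrt_ge_1_iff real_sqrt_ge_zero mult_left_le mult.commute real_sqrt_pow2 power2_eq_square mult_le_cancel_left1 not_le dual_order.trans zero_le_one)
    ultimately show ?thesis by linarith
  qed
  have z1: "\<bar>z i\<bar> \<le> (\<Sum>i<n. \<bar>z i\<bar>)" if "i < n" for i using that by (intro member_le_sum) auto
  have z2: "z i \<le> (\<Sum>i<n. \<bar>z i\<bar>)" "- (\<Sum>i<n. \<bar>z i\<bar>) \<le> z i" if "i < n" for i using z1[OF that] by linarith+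
  have "ln E \<le> (\<Sum>i<n. \<bar>z i\<bar>)" by (rule top[OF z2(1)])
  moreover have "- (\<Sum>i<n. \<bar>z i\<bar>) \<le> m" by (rule bot[OF z2(2)])
  ultimately show "\<bar>ln E\<bar> \<le> (\<Sum>i<n. \<bar>z i\<bar>)" using mE by linarith
qed

text \<open>The log-sum-exp function at inverse temperature \<open>b\<close>; it exceeds the maximum
  of the first \<open>n\<close> coordinates by at most \<open>ln n / b\<close>.\<close>

definition softmax :: "nat \<Rightarrow> real \<Rightarrow> (nat \<Rightarrow> real) \<Rightarrow> real" where
  "softmax n b x = ln (\<Sum>i<n. exp (b * x i)) / b"

text \<open>The gradient is the vector of Gibbs weights times \<open>l\<close>, whose l1 norm is
  \<open>\<bar>l\<bar>\<close> for every \<open>b\<close> and \<open>n\<close>. Only the curvature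
  constant grows with \<open>b\<close>, and \<open>gauss_exp_ineq\<close> gives a bound free of
  it.\<close>

lemma smooth_cls_softmax:
  assumes n: "0 < n" and b: "0 < b"
  shows "smooth_cls n \<bar>l\<bar> (2 * b * \<bar>l\<bar>) (\<lambda>x. l * softmax n b x)
    (\<lambda>k x. l * (exp (b * x k) / (\<Sum>i<n. exp (b * x i))))"
  unfolding smooth_cls_def
proof (intro conjI allI impI)
  have "softmax n b = (\<lambda>x. ln (\<Sum>i<n. exp (b * x i)) / b)" by (simp add: softmax_def fun_eq_iff)
  then show "(\<lambda>x. l * softmax n b x) \<in> borel_measurable seq_borel" by simp
  show "(\<lambda>x. l * (exp (b * x k) / (\<Sum>i<n. exp (b * x i)))) \<in> borel_measurable seq_borel" for k by measurable
  fix x :: "nat \<Rightarrow> real"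
  define S where "S = (\<Sum>i<n. exp (b * x i))"
  have S: "S > 0" unfolding S_def using n by (intro sum_pos) auto
  define p where "p i = exp (b * x i) / S" for i
  have p: "0 \<le> p i" "(\<Sum>i<n. p i) = 1" for i
    using S by (auto simp: p_def S_def simp flip: sum_divide_distrib)
  have "(\<Sum>k<n. \<bar>l * p k\<bar>) = \<bar>l\<bar> * (\<Sum>k<n. p k)" using p(1) by (simp add: abs_mult sum_distrib_left)
  then show "(\<Sum>k<n. \<bar>l * (exp (b * x k) / (\<Sum>i<n. exp (b * x i)))\<bar>) \<le> \<bar>l\<bar>"
    using p(2) by (simp add: p_def S_def)
  fix y :: "nat \<Rightarrow> real"
  define E where "E = (\<Sum>i<n. p i * exp (b * y i))"
  note L = log_mean_exp_bounds[of n p "\<lambda>i. b * y i", OF p, folded E_def]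
  have eq: "softmax n b (\<lambda>i. x i + y i) - softmax n b x = ln E / b"
  proof -
    have "(\<Sum>i<n. exp (b * (x i + y i))) = S * E"
      using S by (simp add: E_def p_def sum_distrib_left distrib_left exp_add)
    then show ?thesis using S L(4) by (simp add: softmax_def S_def[symmetric] ln_mult diff_divide_distrib[symmetric])
  qed
  have s1: "(\<Sum>i<n. \<bar>b * y i\<bar>) = b * (\<Sum>i<n. \<bar>y i\<bar>)" using b by (simp add: abs_mult sum_distrib_left)
  have s2: "(\<Sum>i<n. p i * (b * y i)) = b * (\<Sum>i<n. p i * y i)" by (simp add: sum_distrib_left mult_ac)
  have s3: "(\<Sum>i<n. (b * y i)\<^sup>2) = b\<^sup>2 * (\<Sum>i<n. (y i)\<^sup>2)" by (simp add: sum_distrib_left power_mult_distrib)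
  have "\<bar>ln E / b\<bar> \<le> (\<Sum>i<n. \<bar>y i\<bar>)"
    using L(3) b unfolding s1 by (simp add: field_simps)
  then have "\<bar>l\<bar> * \<bar>ln E / b\<bar> \<le> \<bar>l\<bar> * (\<Sum>i<n. \<bar>y i\<bar>)" by (intro mult_left_mono) auto
  then show "\<bar>l * softmax n b (\<lambda>i. x i + y i) - l * softmax n b x\<bar> \<le> \<bar>l\<bar> * (\<Sum>i<n. \<bar>y i\<bar>)"
    unfolding right_diff_distrib[symmetric] eq by (simp add: abs_mult)
  have "0 \<le> ln E - b * (\<Sum>i<n. p i * y i)" "ln E - b * (\<Sum>i<n. p i * y i) \<le> b * (2 * b * (\<Sum>i<n. (y i)\<^sup>2))"
    using L(1,2) unfolding s2 s3 by (simp_all add: power2_eq_square mult_ac)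
  then have "\<bar>ln E / b - (\<Sum>i<n. p i * y i)\<bar> \<le> 2 * b * (\<Sum>i<n. (y i)\<^sup>2)"
    using b by (simp add: field_simps)
  then have "\<bar>l\<bar> * \<bar>ln E / b - (\<Sum>i<n. p i * y i)\<bar> \<le> \<bar>l\<bar> * (2 * b * (\<Sum>i<n. (y i)\<^sup>2))"
    by (intro mult_left_mono) auto
  moreover have "l * softmax n b (\<lambda>i. x i + y i) - l * softmax n b x - (\<Sum>k<n. l * p k * y k)
     = l * (ln E / b - (\<Sum>i<n. p i * y i))"
    unfolding right_diff_distrib[symmetric] eq by (simp add: sum_distrib_left right_diff_distrib mult.assoc)
  ultimately show "\<bar>l * softmax n b (\<lambda>i. x i + y i) - l * softmax n b x
      - (\<Sum>k<n. l * (exp (b * x k) / (\<Sum>i<n. exp (b * x i))) * y k)\<bar> \<le> 2 * b * \<bar>l\<bar> * (\<Sum>i<n. (y i)\<^sup>2)"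
    by (simp add: p_def S_def abs_mult mult_ac)
qed

lemma softmax_Max:
  assumes n: "0 < n" and b: "0 < b"
  shows "Max (x ` {..<n}) \<le> softmax n b x" "softmax n b x \<le> Max (x ` {..<n}) + ln n / b"
proof -
  let ?M = "Max (x ` {..<n})"
  have S: "(\<Sum>i<n. exp (b * x i)) > 0" using n by (intro sum_pos) auto
  have "?M \<in> x ` {..<n}" using n by (intro Max_in) auto
  then obtain k where k: "k < n" "x k = ?M" by auto
  have "exp (b * ?M) \<le> (\<Sum>i<n. exp (b * x i))"
    unfolding k(2)[symmetric] by (rule member_le_sum) (use k in auto)
  then have "b * ?M \<le> ln (\<Sum>i<n. exp (b * x i))" using S by (simp add: ln_ge_iff)
  then show "?M \<le> softmax n b x" using b by (simp add: softmax_def field_simps)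
  have "(\<Sum>i<n. exp (b * x i)) \<le> (\<Sum>i<n. exp (b * ?M))"
    using b by (intro sum_mono) (auto intro!: Max_ge)
  then have "ln (\<Sum>i<n. exp (b * x i)) \<le> ln (n * exp (b * ?M))" using S by (simp add: ln_le_cancel_iff n)
  also have "\<dots> = ln n + b * ?M" using n by (simp add: ln_mult)
  finally show "softmax n b x \<le> ?M + ln n / b" using b by (simp add: softmax_def field_simps)
qed

section \<open>Exponential moments and tails of Gaussian maxima and suprema\<close>

context prob_space
begin

lemma integrable_Max:
  fixes X :: "nat \<Rightarrow> 'a \<Rightarrow> real"
  assumes "0 < n" "\<And>i. i < n \<Longrightarrow> integrable M (X i)"
  shows "integrable M (\<lambda>x. Max ((\<lambda>i. X i x) ` {..<n}))"
  using assms
proof (induction n)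
  case (Suc n)
  show ?case
  proof (cases "n = 0")
    case False
    then have "Max ((\<lambda>i. X i x) ` {..<Suc n}) = max (X n x) (Max ((\<lambda>i. X i x) ` {..<n}))" for x
      unfolding lessThan_Suc image_insert by (intro Max_insert) auto
    then show ?thesis using Suc False by (simp add: integrable_max)
  qed (use Suc in \<open>simp add: lessThan_Suc\<close>)
qed simp

text \<open>Pushes the family forward to sequence space, where the exponential inequality lives; the
  variance of each linear combination is chosen as the form \<open>Q\<close>.\<close>

lemma gauss_family_law:
  fixes X :: "nat \<Rightarrow> 'a \<Rightarrow> real"
  assumes "\<And>n c. \<exists>v. cgauss M (\<lambda>x. \<Sum>i<n. c i * X i x) v"
  shows "\<exists>Q. gauss_law (distr M seq_borel (\<lambda>x i. X i x)) Q" and "\<And>i. \<exists>v. cgauss M (X i) v"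
    and "(\<lambda>x i. X i x) \<in> measurable M seq_borel"
proof -
  show c: "\<exists>v. cgauss M (X i) v" for i
  proof -
    have *: "(\<Sum>j<Suc i. (if j = i then 1 else 0) * X j x) = X i x" for x by simp
    have "\<exists>v. cgauss M (\<lambda>x. \<Sum>j<Suc i. (if j = i then 1 else 0) * X j x) v" by (rule assms)
    then show ?thesis unfolding * .
  qed
  have X: "X i \<in> borel_measurable M" for i using c[of i] by (auto intro: cgauss_measurable)
  then show m: "(\<lambda>x i. X i x) \<in> measurable M seq_borel"
    by (intro measurable_PiM_single') auto
  have transfer: "cgauss (distr M seq_borel (\<lambda>x i. X i x)) (\<lambda>y. \<Sum>i<n. c i * y i) v"
    if g: "cgauss M (\<lambda>x. \<Sum>i<n. c i * X i x) v" for n and c :: "nat \<Rightarrow> real" and v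
  proof -
    have "(CLINT y|distr M seq_borel (\<lambda>x i. X i x). iexp (u * (\<Sum>i<n. c i * y i)))
      = complex_of_real (exp (- (u\<^sup>2 * v / 2)))" for u
      unfolding cgauss_char[OF g, symmetric] by (subst integral_distr[OF m]) auto
    moreover have "(\<lambda>y. \<Sum>i<n. c i * y i) \<in> borel_measurable (distr M seq_borel (\<lambda>x i. X i x))" by simp
    ultimately show ?thesis unfolding cgauss_def using cgauss_nonneg[OF g] by blast
  qed
  have "\<forall>n. \<exists>q. \<forall>c. cgauss M (\<lambda>x. \<Sum>i<n. c i * X i x) (q c)"
    by (intro allI choice assms)
  then obtain Q where Q: "\<And>n c. cgauss M (\<lambda>x. \<Sum>i<n. c i * X i x) (Q n c)"
    by (auto dest!: choice)
  show "\<exists>Q. gauss_law (distr M seq_borel (\<lambda>x i. X i x)) Q"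
    unfolding gauss_law_def
    by (intro exI[of _ Q] conjI allI transfer Q prob_space_distr[OF m]) simp
qed

lemma gauss_Max_exp:
  fixes X :: "nat \<Rightarrow> 'a \<Rightarrow> real"
  assumes X: "\<And>n c. \<exists>v. cgauss M (\<lambda>x. \<Sum>i<n. c i * X i x) v"
    and n: "0 < n" and V: "\<And>i. (LINT x|M. (X i x)\<^sup>2) \<le> V"
  defines "Mx \<equiv> \<lambda>x. Max ((\<lambda>i. X i x) ` {..<n})"
  shows "integrable M Mx" "integrable M (\<lambda>x. exp (l * Mx x))"
    "(LINT x|M. exp (l * Mx x)) \<le> exp (l * (LINT x|M. Mx x) + l\<^sup>2 * V / 2)"
proof -
  note law = gauss_family_law[where X=X, OF X]
  obtain Q where Q: "gauss_law (distr M seq_borel (\<lambda>x i. X i x)) Q" using law(1) by blast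
  note m[measurable] = law(3)
  have Xm[measurable]: "X i \<in> borel_measurable M" for i using law(2)[of i] by (auto intro: cgauss_measurable)
  have Xi: "integrable M (X i)" for i using law(2)[of i] cgauss_integrable by blast
  have "0 \<le> (LINT x|M. (X 0 x)\<^sup>2)" by simp
  then have V0: "0 \<le> V" using V[of 0] by linarith
  show iM: "integrable M Mx" unfolding Mx_def by (rule integrable_Max) (use n Xi in auto)
  then have [measurable]: "Mx \<in> borel_measurable M" by simp
  have Mb: "\<bar>Mx x\<bar> \<le> (\<Sum>i<n. \<bar>X i x\<bar>)" for x
  proof -
    have "Mx x \<in> (\<lambda>i. X i x) ` {..<n}" unfolding Mx_def using n by (intro Max_in) auto
    then obtain k where "k < n" "Mx x = X k x" by auto
    then show ?thesis by (auto intro: member_le_sum)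
  qed
  have em: "integrable M (\<lambda>x. exp (c * (\<Sum>i<n. \<bar>X i x\<bar>)))" for c
    by (rule exp_sum_moment) (rule law(2))
  show ie: "integrable M (\<lambda>x. exp (l * Mx x))" for l
  proof (rule Bochner_Integration.integrable_bound[OF em[of "\<bar>l\<bar>"]])
    have "l * Mx x \<le> \<bar>l\<bar> * (\<Sum>i<n. \<bar>X i x\<bar>)" for x
      using mult_left_mono[OF Mb[of x], of "\<bar>l\<bar>"] abs_ge_self[of "l * Mx x"] by (simp add: abs_mult)
    then show "AE x in M. norm (exp (l * Mx x)) \<le> norm (exp (\<bar>l\<bar> * (\<Sum>i<n. \<bar>X i x\<bar>)))" by auto
  qed measurable
  let ?e = "\<lambda>b. ln (real n) / b"
  \<comment> \<open>The smoothing error \<open>ln n / b\<close> is paid twice, inside the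
    exponential and in the mean; this is the factor \<open>2\<close>. It vanishes as
    \<open>b\<close> tends to infinity.\<close>
  have main: "(LINT x|M. exp (l * Mx x)) \<le> exp (l * (LINT x|M. Mx x) + l\<^sup>2 * V / 2 + 2 * \<bar>l\<bar> * ?e b)"
    if b: "0 < b" for b
  proof -
    let ?\<nu> = "distr M seq_borel (\<lambda>x i. X i x)"
    have cls: "smooth_cls n \<bar>l\<bar> (2 * b * \<bar>l\<bar>) (\<lambda>x. l * softmax n b x)
      (\<lambda>k x. l * (exp (b * x k) / (\<Sum>i<n. exp (b * x i))))" by (rule smooth_cls_softmax[OF n b])
    define G where "G x = softmax n b (\<lambda>i. X i x)" for x
    have G: "Mx x \<le> G x" "G x \<le> Mx x + ?e b" for x
      unfolding G_def Mx_def using softmax_Max[OF n b, of "\<lambda>i. X i x"] by auto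
    have [measurable]: "softmax n b \<in> borel_measurable seq_borel"
    proof -
      have "softmax n b = (\<lambda>x. ln (\<Sum>i<n. exp (b * x i)) / b)" by (simp add: softmax_def fun_eq_iff)
      then show ?thesis by simp
    qed
    have [measurable]: "G \<in> borel_measurable M" unfolding G_def by measurable
    have e0: "0 \<le> ?e b" using n b by simp
    have lG: "\<bar>l * G x - l * Mx x\<bar> \<le> \<bar>l\<bar> * ?e b" for x
      unfolding right_diff_distrib[symmetric] abs_mult using G[of x] by (intro mult_left_mono) auto
    have Gi: "integrable M G"
    proof (rule Bochner_Integration.integrable_bound)
      show "integrable M (\<lambda>x. \<bar>Mx x\<bar> + ?e b)" using iM by simp
      have "\<bar>G x\<bar> \<le> \<bar>\<bar>Mx x\<bar> + ?e b\<bar>" for x using G[of x] e0 by linarith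
      then show "AE x in M. norm (G x) \<le> norm (\<bar>Mx x\<bar> + ?e b)" by auto
    qed measurable
    have eGi: "integrable M (\<lambda>x. exp (l * G x))"
    proof (rule Bochner_Integration.integrable_bound)
      show "integrable M (\<lambda>x. exp (\<bar>l\<bar> * ?e b) * exp (l * Mx x))" using ie by simp
      have "exp (l * G x) \<le> exp (\<bar>l\<bar> * ?e b) * exp (l * Mx x)" for x
        unfolding exp_add[symmetric] exp_le_cancel_iff using lG[of x] by linarith
      then show "AE x in M. norm (exp (l * G x)) \<le> norm (exp (\<bar>l\<bar> * ?e b) * exp (l * Mx x))" by auto
    qed measurable
    have V\<nu>: "(LINT y|?\<nu>. (y i)\<^sup>2) \<le> V" for i
      using V[of i] by (subst integral_distr[OF m]) auto
    have "exp_ineq n \<bar>l\<bar> (2 * b * \<bar>l\<bar>) ?\<nu> (\<bar>l\<bar>\<^sup>2 * V / 2)"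
      by (rule gauss_exp_ineq[OF Q]) (use V\<nu> V0 b in auto)
    from this[unfolded exp_ineq_def, rule_format, OF cls]
    have "(LINT x|M. exp (l * G x)) \<le> exp ((LINT x|M. l * G x) + \<bar>l\<bar>\<^sup>2 * V / 2)"
      unfolding G_def by (simp add: integral_distr[OF m])
    then have a: "(LINT x|M. exp (l * G x)) \<le> exp ((LINT x|M. l * G x) + l\<^sup>2 * V / 2)" by simp
    have "(LINT x|M. exp (l * Mx x)) \<le> (LINT x|M. exp (\<bar>l\<bar> * ?e b) * exp (l * G x))"
    proof (rule integral_mono[OF ie])
      show "exp (l * Mx x) \<le> exp (\<bar>l\<bar> * ?e b) * exp (l * G x)" for x
        unfolding exp_add[symmetric] exp_le_cancel_iff using lG[of x] by linarith
    qed (use eGi in simp)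
    also have "\<dots> = exp (\<bar>l\<bar> * ?e b) * (LINT x|M. exp (l * G x))" by simp
    also have "\<dots> \<le> exp (\<bar>l\<bar> * ?e b) * exp ((LINT x|M. l * G x) + l\<^sup>2 * V / 2)"
      using a by (intro mult_left_mono) auto
    also have "(LINT x|M. l * G x) \<le> (LINT x|M. l * Mx x + \<bar>l\<bar> * ?e b)"
    proof (rule integral_mono)
      show "l * G x \<le> l * Mx x + \<bar>l\<bar> * ?e b" for x using lG[of x] by linarith
    qed (use Gi iM in auto)
    also have "\<dots> = l * (LINT x|M. Mx x) + \<bar>l\<bar> * ?e b" using iM by (simp add: prob_space)
    finally show ?thesis by (simp add: exp_add[symmetric] algebra_simps)
  qed
  have lim: "(\<lambda>k. exp (l * (LINT x|M. Mx x) + l\<^sup>2 * V / 2 + 2 * \<bar>l\<bar> * (ln (real n) * inverse (real (Suc k)))))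
    \<longlonglongrightarrow> exp (l * (LINT x|M. Mx x) + l\<^sup>2 * V / 2 + 2 * \<bar>l\<bar> * (ln (real n) * 0))"
    by (intro tendsto_intros LIMSEQ_inverse_real_of_nat)
  have "(LINT x|M. exp (l * Mx x)) \<le> exp (l * (LINT x|M. Mx x) + l\<^sup>2 * V / 2 + 2 * \<bar>l\<bar> * (ln (real n) * inverse (real (Suc k))))" for k
    using main[of "real (Suc k)"] unfolding divide_inverse by simp
  then have "(LINT x|M. exp (l * Mx x)) \<le> exp (l * (LINT x|M. Mx x) + l\<^sup>2 * V / 2 + 2 * \<bar>l\<bar> * (ln (real n) * 0))"
    by (intro LIMSEQ_le_const[OF lim] exI allI impI)
  then show "(LINT x|M. exp (l * Mx x)) \<le> exp (l * (LINT x|M. Mx x) + l\<^sup>2 * V / 2)" by simp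
qed

lemma exp_tail_bound:
  assumes "integrable M (\<lambda>x. exp (f x))" and [measurable]: "f \<in> borel_measurable M"
  shows "prob {x \<in> space M. f x \<ge> a} \<le> exp (- a) * (LINT x|M. exp (f x))"
proof -
  have "prob {x \<in> space M. exp (f x) \<ge> exp a} \<le> (LINT x|M. exp (f x)) / exp a"
    by (rule integral_Markov_inequality_measure[OF assms(1), of "{}"]) auto
  then show ?thesis by (simp add: exp_minus field_simps)
qed

text \<open>Maxima of finitely many members increase to the supremum. Their bounds involve only
  \<open>V\<close> and the means, so monotone convergence carries them over once the means are known
  to be bounded.\<close>

lemma gauss_SUP:
  fixes X :: "nat \<Rightarrow> 'a \<Rightarrow> real"
  assumes X: "\<And>n c. \<exists>v. cgauss M (\<lambda>x. \<Sum>i<n. c i * X i x) v"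
    and V: "\<And>i. (LINT x|M. (X i x)\<^sup>2) \<le> V"
    and bdd: "\<And>x. x \<in> space M \<Longrightarrow> bdd_above (range (\<lambda>i. X i x))"
  defines "S \<equiv> \<lambda>x. SUP i. X i x"
  shows "integrable M S"
    "0 < V \<Longrightarrow> (LINT x|M. S x) \<le> r \<Longrightarrow>
      prob {x \<in> space M. S x > r} \<le> exp (- ((r - (LINT x|M. S x))\<^sup>2 / (2 * V)))"
proof -
  note law = gauss_family_law[where X=X, OF X]
  have Xm[measurable]: "X i \<in> borel_measurable M" for i using law(2)[of i] by (auto intro: cgauss_measurable)
  define Mx where "Mx n x = Max ((\<lambda>i. X i x) ` {..<Suc n})" for n x
  note E = gauss_Max_exp[where X=X, OF X zero_less_Suc V, folded Mx_def]
  have [measurable]: "Mx n \<in> borel_measurable M" for n using E(1) by (rule borel_measurable_integrable)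
  have Sm[measurable]: "S \<in> borel_measurable M"
    unfolding S_def by (rule borel_measurable_cSUP) (use bdd in auto)
  have XM: "X i x \<le> Mx n x" if "i \<le> n" for i n x unfolding Mx_def using that by (intro Max_ge) auto
  have Mex: "\<exists>i\<le>n. Mx n x = X i x" for n x
  proof -
    have "Mx n x \<in> (\<lambda>i. X i x) ` {..<Suc n}" unfolding Mx_def by (intro Max_in) auto
    then show ?thesis by (auto simp: less_Suc_eq_le)
  qed
  have XS: "X i x \<le> S x" if "x \<in> space M" for i x unfolding S_def by (rule cSUP_upper) (use bdd that in auto)
  have MS: "Mx n x \<le> S x" if "x \<in> space M" for n x using Mex[of n x] XS[OF that] by auto
  have mono: "Mx n x \<le> Mx k x" if "n \<le> k" for n k x
    using Mex[of n x] XM that by (metis order.trans)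
  have lim: "(\<lambda>n. Mx n x) \<longlonglongrightarrow> S x" if x: "x \<in> space M" for x
  proof (rule increasing_LIMSEQ)
    show "Mx n x \<le> Mx (Suc n) x" for n by (rule mono) simp
    show "Mx n x \<le> S x" for n by (rule MS[OF x])
    fix e :: real assume e: "0 < e"
    have "S x - e < (SUP i. X i x)" using e by (simp add: S_def)
    then have "\<exists>i. S x - e < X i x" using bdd[OF x] by (subst (asm) less_cSUP_iff) auto
    then obtain i where "S x - e < X i x" by blast
    with XM[of i i x] have "S x \<le> Mx i x + e" by simp
    then show "\<exists>n. S x \<le> Mx n x + e" by blast
  qed
  define m where "m n = (LINT x|M. Mx n x)" for n
  have inc: "incseq m" unfolding m_def incseq_def using E(1) mono by (auto intro!: integral_mono)
  \<comment> \<open>Tightness: as \<open>S\<close> is finite, it is at least some \<open>k\<close>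
    with probability below 1/2. A mean above \<open>k + V / 2 + 2\<close> would, by the exponential
    inequality with \<open>l = -1\<close>, put the maximum above \<open>k\<close> with probability
    exceeding 1/2, since \<open>exp (- 2) < 1/2\<close>.\<close>
  have mb: "\<exists>B. \<forall>n. m n \<le> B"
  proof -
    have "(\<lambda>k. prob {x \<in> space M. S x \<ge> real k}) \<longlonglongrightarrow> prob (\<Inter>k. {x \<in> space M. S x \<ge> real k})"
      by (rule finite_Lim_measure_decseq) (auto simp: decseq_def)
    also have "(\<Inter>k. {x \<in> space M. S x \<ge> real k}) = {}"
    proof (rule equals0I)
      fix x assume "x \<in> (\<Inter>k. {x \<in> space M. S x \<ge> real k})"
      then have "real k \<le> S x" for k by auto
      moreover obtain k where "S x < real k" using reals_Archimedean2 by blast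
      ultimately show False by (meson not_le)
    qed
    finally have "(\<lambda>k. prob {x \<in> space M. S x \<ge> real k}) \<longlonglongrightarrow> 0" by simp
    then have "eventually (\<lambda>k. prob {x \<in> space M. S x \<ge> real k} < 1/2) sequentially"
      by (rule order_tendstoD) simp
    then obtain k where k: "prob {x \<in> space M. S x \<ge> real k} < 1/2" by (auto simp: eventually_sequentially)
    have "m n \<le> real k + (V / 2 + 2)" for n
    proof (rule ccontr)
      assume c: "\<not> m n \<le> real k + (V / 2 + 2)"
      have "prob {x \<in> space M. - Mx n x \<ge> V / 2 + 2 - m n} \<le> exp (- (V / 2 + 2 - m n)) * (LINT x|M. exp (- Mx n x))"
        by (rule exp_tail_bound) (use E(2)[of "-1" n] in auto)
      also have "\<dots> \<le> exp (- (V / 2 + 2 - m n)) * exp (- m n + V / 2)"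
        using E(3)[of "-1" n] by (intro mult_left_mono) (auto simp: m_def)
      also have "\<dots> = exp (- 2)" by (simp add: exp_add[symmetric])
      also have "\<dots> < 1/2"
        using exp_ge_add_one_self[of 2] by (simp add: exp_minus field_simps)
      finally have "prob {x \<in> space M. - Mx n x \<ge> V / 2 + 2 - m n} < 1/2" .
      moreover have "1 \<le> prob ({x \<in> space M. - Mx n x \<ge> V / 2 + 2 - m n} \<union> {x \<in> space M. S x \<ge> real k})"
      proof -
        have "x \<in> {x \<in> space M. - Mx n x \<ge> V / 2 + 2 - m n} \<union> {x \<in> space M. S x \<ge> real k}" if "x \<in> space M" for x
          using MS[OF that, of n] c that by auto
        then have "space M \<subseteq> {x \<in> space M. - Mx n x \<ge> V / 2 + 2 - m n} \<union> {x \<in> space M. S x \<ge> real k}" by blast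
        then have "prob (space M) \<le> prob ({x \<in> space M. - Mx n x \<ge> V / 2 + 2 - m n} \<union> {x \<in> space M. S x \<ge> real k})"
          by (intro finite_measure_mono) auto
        then show ?thesis by (simp add: prob_space)
      qed
      moreover have "prob ({x \<in> space M. - Mx n x \<ge> V / 2 + 2 - m n} \<union> {x \<in> space M. S x \<ge> real k})
        \<le> prob {x \<in> space M. - Mx n x \<ge> V / 2 + 2 - m n} + prob {x \<in> space M. S x \<ge> real k}"
        by (rule measure_Un_le) auto
      ultimately show False using k by linarith
    qed
    then show ?thesis by blast
  qed
  obtain ell where ell: "m \<longlonglongrightarrow> ell" using mb incseq_convergent[OF inc] by blast
  have mc: "AE x in M. mono (\<lambda>n. Mx n x)" using mono by (auto simp: mono_def)
  have lc: "AE x in M. (\<lambda>n. Mx n x) \<longlonglongrightarrow> S x" using lim by auto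
  show iS: "integrable M S"
    by (rule integrable_monotone_convergence[OF E(1) mc lc ell[unfolded m_def] Sm])
  assume V0: "0 < V" and r: "(LINT x|M. S x) \<le> r"
  let ?ES = "LINT x|M. S x"
  \<comment> \<open>The minimiser of the Chernoff exponent
    \<open>- l * (r - ?ES) + l\<^sup>2 * V / 2\<close>. It is nonnegative, which allows replacing
    \<open>m n\<close> by the larger \<open>?ES\<close>.\<close>
  define l where "l = (r - ?ES) / V"
  have l0: "0 \<le> l" using r V0 by (simp add: l_def)
  have mS: "m n \<le> ?ES" for n unfolding m_def by (rule integral_mono[OF E(1) iS MS])
  have tail: "prob {x \<in> space M. Mx n x > r} \<le> exp (- ((r - ?ES)\<^sup>2 / (2 * V)))" for n
  proof -
    have "prob {x \<in> space M. Mx n x > r} \<le> prob {x \<in> space M. l * Mx n x \<ge> l * r}"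
      using l0 by (intro finite_measure_mono) (auto intro: mult_left_mono)
    also have "\<dots> \<le> exp (- (l * r)) * (LINT x|M. exp (l * Mx n x))"
      by (rule exp_tail_bound) (use E(2) in auto)
    also have "\<dots> \<le> exp (- (l * r)) * exp (l * m n + l\<^sup>2 * V / 2)"
      using E(3) by (intro mult_left_mono) (auto simp: m_def)
    also have "\<dots> \<le> exp (- (l * r)) * exp (l * ?ES + l\<^sup>2 * V / 2)"
      using mS[of n] l0 by (intro mult_left_mono) (auto intro: mult_left_mono)
    also have "\<dots> = exp (- (l * (r - ?ES)) + l\<^sup>2 * V / 2)" by (simp add: exp_add[symmetric] algebra_simps)
    also have "- (l * (r - ?ES)) + l\<^sup>2 * V / 2 = - ((r - ?ES)\<^sup>2 / (2 * V))"
      using V0 by (simp add: l_def power2_eq_square field_simps)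
    finally show ?thesis .
  qed
  have "(\<lambda>n. prob {x \<in> space M. Mx n x > r}) \<longlonglongrightarrow> prob (\<Union>n. {x \<in> space M. Mx n x > r})"
    by (rule finite_Lim_measure_incseq) (use mono in \<open>auto simp: incseq_def intro: less_le_trans\<close>)
  moreover have "{x \<in> space M. S x > r} \<subseteq> (\<Union>n. {x \<in> space M. Mx n x > r})"
  proof
    fix x assume x: "x \<in> {x \<in> space M. S x > r}"
    then have "eventually (\<lambda>n. Mx n x > r) sequentially" using order_tendstoD(1)[OF lim[of x]] by auto
    then show "x \<in> (\<Union>n. {x \<in> space M. Mx n x > r})" using x by (auto simp: eventually_sequentially)
  qed
  then have "prob {x \<in> space M. S x > r} \<le> prob (\<Union>n. {x \<in> space M. Mx n x > r})"
    by (intro finite_measure_mono) auto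
  ultimately show "prob {x \<in> space M. S x > r} \<le> exp (- ((r - ?ES)\<^sup>2 / (2 * V)))"
    using tail by (meson LIMSEQ_le_const2 order.trans)
qed

end

section \<open>Circular complex Gaussian families\<close>

text \<open>Circular symmetry is encoded by the real and imaginary parts having the same centered Gaussian
  law; applied to all complex linear combinations this makes a family jointly circular.\<close>

definition circ_gauss :: "'a measure \<Rightarrow> ('a \<Rightarrow> complex) \<Rightarrow> bool" where
  "circ_gauss P Z \<longleftrightarrow> (\<exists>v. cgauss P (\<lambda>x. Re (Z x)) v \<and> cgauss P (\<lambda>x. Im (Z x)) v)"

definition circ_family :: "'a measure \<Rightarrow> 'b set \<Rightarrow> ('b \<Rightarrow> 'a \<Rightarrow> complex) \<Rightarrow> bool" where
  "circ_family P S g \<longleftrightarrow> (\<forall>n s c. (\<forall>i<n::nat. s i \<in> S) \<longrightarrow> circ_gauss P (\<lambda>x. \<Sum>i<n. c i * g (s i) x))"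

lemma circ_gauss_measurable: "circ_gauss P Z \<Longrightarrow> Z \<in> borel_measurable P"
  unfolding circ_gauss_def by (subst borel_measurable_complex_iff) (auto intro: cgauss_measurable)

lemma circ_familyD:
  "circ_family P S g \<Longrightarrow> (\<And>i. i < n \<Longrightarrow> s i \<in> S) \<Longrightarrow> circ_gauss P (\<lambda>x. \<Sum>i<n::nat. c i * g (s i) x)"
  unfolding circ_family_def by simp

lemma circ_familyD1: "circ_family P S g \<Longrightarrow> s \<in> S \<Longrightarrow> circ_gauss P (\<lambda>x. w * g s x)"
  using circ_familyD[of P S g 1 "\<lambda>_. s" "\<lambda>_. w"] by simp

lemma circ_family_mult:
  assumes "circ_family P S g" shows "circ_family P S (\<lambda>s x. h s * g s x)"
  unfolding circ_family_def
proof (intro allI impI)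
  fix n :: nat and s c
  assume "\<forall>i<n. s i \<in> S"
  then show "circ_gauss P (\<lambda>x. \<Sum>i<n. c i * (h (s i) * g (s i) x))"
    using circ_familyD[OF assms, of n s "\<lambda>i. c i * h (s i)"] by (simp add: mult.assoc)
qed

context prob_space
begin

lemma circ_gauss_second_moment:
  assumes "circ_gauss M Z"
  shows "cgauss M (\<lambda>x. Re (Z x)) ((LINT x|M. (norm (Z x))\<^sup>2) / 2)"
proof -
  obtain v where v: "cgauss M (\<lambda>x. Re (Z x)) v" "cgauss M (\<lambda>x. Im (Z x)) v"
    using assms unfolding circ_gauss_def by blast
  have "(LINT x|M. (norm (Z x))\<^sup>2) = (LINT x|M. (Re (Z x))\<^sup>2 + (Im (Z x))\<^sup>2)" by (simp add: cmod_power2)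
  also have "\<dots> = 2 * v"
    using cgauss_integrable_square[OF v(1)] cgauss_integrable_square[OF v(2)] cgauss_second_moment[OF v(1)] cgauss_second_moment[OF v(2)]
    by simp
  finally show ?thesis using v(1) by simp
qed

lemma integrable_iexp_rv:
  assumes [measurable]: "Y \<in> borel_measurable M" shows "integrable M (\<lambda>x. iexp (u * Y x))"
  by (rule integrable_bounded[of _ 1]) auto

text \<open>Bounds uniformly the variances of all centered Gaussians dominated by one finite
  variable, without any moment of that variable. By dominated convergence some frequency
  \<open>u\<close> makes the mean of \<open>min 2 \<bar>u * X x\<bar>\<close> smaller than 1/2. The
  characteristic function of every dominated \<open>Y\<close> at \<open>u\<close> then exceeds
  \<open>exp (-1)\<close>.\<close>

lemma cgauss_char_small:
  assumes [measurable]: "X \<in> borel_measurable M"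
  obtains u :: real where "0 < u" "\<And>Y v x. cgauss M Y v \<Longrightarrow> (\<And>x. x \<in> space M \<Longrightarrow> \<bar>Y x\<bar> \<le> X x) \<Longrightarrow> u\<^sup>2 * v \<le> 2"
proof -
  let ?u = "\<lambda>k. inverse (real (Suc k))"
  have "(\<lambda>k. LINT x|M. min 2 \<bar>?u k * X x\<bar>) \<longlonglongrightarrow> (LINT x|M. 0)"
  proof (rule integral_dominated_convergence[where w="\<lambda>_. 2"])
    have "(\<lambda>k. min 2 \<bar>?u k * X x\<bar>) \<longlonglongrightarrow> min 2 \<bar>0 * X x\<bar>" for x
      by (intro tendsto_intros LIMSEQ_inverse_real_of_nat)
    then show "AE x in M. (\<lambda>k. min 2 \<bar>?u k * X x\<bar>) \<longlonglongrightarrow> 0" by simp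
  qed auto
  then have "eventually (\<lambda>k. (LINT x|M. min 2 \<bar>?u k * X x\<bar>) < 1/2) sequentially"
    by (intro order_tendstoD(2)[of _ 0]) auto
  then obtain k where k: "(LINT x|M. min 2 \<bar>?u k * X x\<bar>) < 1/2" by (auto simp: eventually_sequentially)
  show ?thesis
  proof (rule that[of "?u k"])
    fix Y v assume g: "cgauss M Y v" and b: "\<And>x. x \<in> space M \<Longrightarrow> \<bar>Y x\<bar> \<le> X x"
    have [measurable]: "Y \<in> borel_measurable M" by (rule cgauss_measurable[OF g])
    have Re_iexp: "Re (iexp z) = cos z" for z :: real by (simp add: Re_exp)
    have cosb: "1 - min 2 \<bar>z\<bar> \<le> cos z" for z :: real
    proof -
      have "\<bar>Re (iexp z - 1)\<bar> \<le> norm (iexp z - 1)" by (rule abs_Re_le_cmod)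
      also have "\<dots> \<le> \<bar>z\<bar>" using iexp_approx1[of z 0] by simp
      finally have "1 - \<bar>z\<bar> \<le> cos z" by (simp add: Re_exp)
      then show ?thesis using cos_ge_minus_one[of z] by linarith
    qed
    have "1/2 \<le> 1 - (LINT x|M. min 2 \<bar>?u k * X x\<bar>)" using k by linarith
    also have "\<dots> = (LINT x|M. 1 - min 2 \<bar>?u k * X x\<bar>)"
    proof -
      have "integrable M (\<lambda>x. min 2 \<bar>?u k * X x\<bar>)" by (rule integrable_bounded[of _ 2]) auto
      then show ?thesis by (simp add: prob_space)
    qed
    also have "\<dots> \<le> (LINT x|M. Re (iexp (?u k * Y x)))"
    proof (rule integral_mono)
      show "integrable M (\<lambda>x. 1 - min 2 \<bar>?u k * X x\<bar>)" by (rule integrable_bounded[of _ 2]) auto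
      show "integrable M (\<lambda>x. Re (iexp (?u k * Y x)))" by (intro integrable_Re integrable_iexp_rv) simp
      fix x assume "x \<in> space M"
      have "\<bar>?u k * Y x\<bar> \<le> \<bar>?u k * X x\<bar>" unfolding abs_mult using b[OF \<open>x \<in> space M\<close>] by (intro mult_left_mono) auto
      then have "1 - min 2 \<bar>?u k * X x\<bar> \<le> 1 - min 2 \<bar>?u k * Y x\<bar>" by linarith
      also have "\<dots> \<le> cos (?u k * Y x)" by (rule cosb)
      finally show "1 - min 2 \<bar>?u k * X x\<bar> \<le> Re (iexp (?u k * Y x))" unfolding Re_iexp .
    qed
    also have "\<dots> = Re (CLINT x|M. iexp (?u k * Y x))"
      by (rule integral_Re[OF integrable_iexp_rv]) simp
    also have "\<dots> = exp (- ((?u k)\<^sup>2 * v / 2))" unfolding cgauss_char[OF g] by simp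
    finally have "1/2 \<le> exp (- ((?u k)\<^sup>2 * v / 2))" .
    moreover have "exp (-1) < (1/2 :: real)" using exp_lower_Taylor_quadratic[of "1::real"] by (simp add: exp_minus field_simps)
    ultimately have "exp (-1) < exp (- ((?u k)\<^sup>2 * v / 2))" by linarith
    then show "(?u k)\<^sup>2 * v \<le> 2" by simp
  qed simp
qed

text \<open>Dense countable sets of scales and of rotations suffice by continuity, which reduces the
  supremum of moduli to a sequence of real Gaussians as in \<open>gauss_SUP\<close>. Measurability
  of \<open>X\<close> is a by-product of this reduction.\<close>

lemma circ_SUP:
  fixes g :: "real \<Rightarrow> 'a \<Rightarrow> complex"
  assumes ab: "a \<le> b" and circ: "circ_family M {a..b} g"
    and cont: "\<And>x. x \<in> space M \<Longrightarrow> continuous_on {a..b} (\<lambda>s. g s x)"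
  defines "X \<equiv> \<lambda>x. SUP s\<in>{a..b}. norm (g s x)" and "\<sigma>2 \<equiv> SUP s\<in>{a..b}. (LINT x|M. (norm (g s x))\<^sup>2)"
  shows "X \<in> borel_measurable M"
    and "\<And>x s. x \<in> space M \<Longrightarrow> s \<in> {a..b} \<Longrightarrow> norm (g s x) \<le> X x"
    and "\<And>r. (LINT x|M. X x) \<le> r \<Longrightarrow> prob {x \<in> space M. X x > r} \<le> exp (- ((r - (LINT x|M. X x))\<^sup>2 / \<sigma>2))"
proof -
  have bddX: "bdd_above ((\<lambda>s. norm (g s x)) ` {a..b})" if "x \<in> space M" for x
    by (intro bounded_imp_bdd_above compact_imp_bounded compact_continuous_image continuous_on_norm cont that compact_Icc)
  show gX: "norm (g s x) \<le> X x" if "x \<in> space M" "s \<in> {a..b}" for x s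
    unfolding X_def by (rule cSUP_upper[OF that(2) bddX[OF that(1)]])
  obtain D where D: "countable D" "D \<subseteq> {a..b}" "{a..b} \<subseteq> closure D" using separable by blast
  obtain U where U: "countable U" "U \<subseteq> sphere (0::complex) 1" "sphere 0 1 \<subseteq> closure U" using separable by blast
  have cD: "closure D = {a..b}" using D by (metis closed_atLeastAtMost closure_minimal subset_antisym)
  have cU: "closure U = sphere 0 1" using U by (metis closed_sphere closure_minimal subset_antisym)
  have ne: "D \<times> U \<noteq> {}"
  proof -
    have "(1::complex) \<in> closure U" "a \<in> closure D" using cU cD ab by auto
    then show ?thesis by auto
  qed
  define e where "e = from_nat_into (D \<times> U)"
  have e: "fst (e k) \<in> D" "snd (e k) \<in> U" for k
    using from_nat_into[OF ne, of k] by (auto simp: e_def mem_Times_iff)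
  have esurj: "\<exists>k. e k = (s, w)" if "s \<in> D" "w \<in> U" for s w
    unfolding e_def using from_nat_into_surj[of "D \<times> U" "(s, w)"] D U that by auto
  define Y where "Y k x = Re (snd (e k) * g (fst (e k)) x)" for k x
  have eD: "fst (e k) \<in> {a..b}" "norm (snd (e k)) = 1" for k using e[of k] D U by auto
  have YX: "Y k x \<le> X x" if "x \<in> space M" for k x
  proof -
    have "Y k x \<le> norm (snd (e k) * g (fst (e k)) x)" unfolding Y_def by (rule complex_Re_le_cmod)
    also have "\<dots> = norm (g (fst (e k)) x)" using eD by (simp add: norm_mult)
    also have "\<dots> \<le> X x" by (rule gX[OF that eD(1)])
    finally show ?thesis .
  qed
  have bddY: "bdd_above (range (\<lambda>k. Y k x))" if "x \<in> space M" for x using YX[OF that] by (auto intro!: bdd_aboveI)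
  have XY: "X x = (SUP k. Y k x)" if x: "x \<in> space M" for x
  proof (rule antisym)
    show "(SUP k. Y k x) \<le> X x" using YX[OF x] by (intro cSUP_least) auto
    have DU: "Re (w * g s x) \<le> (SUP k. Y k x)" if sw: "s \<in> D" "w \<in> U" for s w
    proof -
      obtain k where "e k = (s, w)" using esurj[OF sw] by blast
      then have "Re (w * g s x) = Y k x" by (simp add: Y_def)
      also have "\<dots> \<le> (SUP k. Y k x)" by (rule cSUP_upper) (use bddY[OF x] in auto)
      finally show ?thesis .
    qed
    have DU': "Re (w * g s x) \<le> (SUP k. Y k x)" if s: "s \<in> {a..b}" and "w \<in> U" for s w
    proof (rule continuous_le_on_closure[of D "\<lambda>s. Re (w * g s x)"])
      show "continuous_on (closure D) (\<lambda>s. Re (w * g s x))" unfolding cD by (intro continuous_intros cont x)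
    qed (use s cD DU that in auto)
    have DU'': "Re (w * g s x) \<le> (SUP k. Y k x)" if s: "s \<in> {a..b}" and w: "w \<in> sphere 0 1" for s w
    proof (rule continuous_le_on_closure[of U "\<lambda>w. Re (w * g s x)"])
      show "continuous_on (closure U) (\<lambda>w. Re (w * g s x))" by (intro continuous_intros)
    qed (use s w cU DU' in auto)
    show "X x \<le> (SUP k. Y k x)" unfolding X_def
    proof (rule cSUP_least)
      fix s assume s: "s \<in> {a..b}"
      show "norm (g s x) \<le> (SUP k. Y k x)"
      proof (cases "g s x = 0")
        case True
        then show ?thesis using DU''[OF s, of 1] by simp
      next
        case False
        let ?w = "cnj (g s x) / norm (g s x)"
        have "?w * g s x = norm (g s x)" using False
          by (simp add: complex_norm_square[symmetric] mult.commute power2_eq_square)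
        moreover have "?w \<in> sphere 0 1" using False by (simp add: norm_divide)
        ultimately show ?thesis using DU''[OF s, of ?w] by simp
      qed
    qed (use ab in auto)
  qed
  have YG: "\<exists>v. cgauss M (\<lambda>x. \<Sum>i<n. c i * Y i x) v" for n c
  proof -
    have "circ_gauss M (\<lambda>x. \<Sum>i<n. (complex_of_real (c i) * snd (e i)) * g (fst (e i)) x)"
      by (rule circ_familyD[OF circ eD(1)])
    then obtain v where "cgauss M (\<lambda>x. Re (\<Sum>i<n. (complex_of_real (c i) * snd (e i)) * g (fst (e i)) x)) v"
      unfolding circ_gauss_def by blast
    then show ?thesis by (auto simp: Y_def mult.assoc)
  qed
  have Ym: "Y k \<in> borel_measurable M" for k
    using circ_familyD1[OF circ eD(1), of "snd (e k)" k] unfolding Y_def circ_gauss_def by (auto intro: cgauss_measurable)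
  have "(\<lambda>x. SUP k. Y k x) \<in> borel_measurable M"
    by (rule borel_measurable_cSUP) (use bddY Ym in auto)
  then show Xm: "X \<in> borel_measurable M" using XY by (simp cong: measurable_cong)
  obtain u where u: "0 < u" "\<And>Y v. cgauss M Y v \<Longrightarrow> (\<And>x. x \<in> space M \<Longrightarrow> \<bar>Y x\<bar> \<le> X x) \<Longrightarrow> u\<^sup>2 * v \<le> 2"
    using cgauss_char_small[OF Xm] by metis
  \<comment> \<open>The supremum \<open>\<sigma>2\<close> dominates its members only if they are
    bounded. \<open>X\<close> dominates every \<open>\<bar>Re (g s x)\<bar>\<close>, whose variance
    is half the second moment of the modulus; hence \<open>4\<close> in place of
    \<open>2\<close>.\<close>
  have mom: "(LINT x|M. (norm (g s x))\<^sup>2) \<le> 4 / u\<^sup>2" if s: "s \<in> {a..b}" for s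
  proof -
    have c: "circ_gauss M (\<lambda>x. g s x)" using circ_familyD1[OF circ s, of 1] by simp
    have "u\<^sup>2 * ((LINT x|M. (norm (g s x))\<^sup>2) / 2) \<le> 2"
      by (rule u(2)[OF circ_gauss_second_moment[OF c]]) (use gX[OF _ s] abs_Re_le_cmod order.trans in blast)
    then show ?thesis using u(1) by (simp add: field_simps)
  qed
  have bddm: "bdd_above ((\<lambda>s. LINT x|M. (norm (g s x))\<^sup>2) ` {a..b})" using mom by (intro bdd_aboveI[of _ "4 / u\<^sup>2"]) auto
  have m\<sigma>: "(LINT x|M. (norm (g s x))\<^sup>2) \<le> \<sigma>2" if s: "s \<in> {a..b}" for s
    unfolding \<sigma>2_def by (rule cSUP_upper[OF s bddm])
  have "0 \<le> (LINT x|M. (norm (g a x))\<^sup>2)" by simp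
  also have "\<dots> \<le> \<sigma>2" using ab by (intro m\<sigma>) auto
  finally have \<sigma>0: "0 \<le> \<sigma>2" .
  have YV: "(LINT x|M. (Y k x)\<^sup>2) \<le> \<sigma>2 / 2" for k
  proof -
    have c: "circ_gauss M (\<lambda>x. snd (e k) * g (fst (e k)) x)" by (rule circ_familyD1[OF circ eD(1)])
    have "(LINT x|M. (Y k x)\<^sup>2) = (LINT x|M. (norm (snd (e k) * g (fst (e k)) x))\<^sup>2) / 2"
      unfolding Y_def by (rule cgauss_second_moment[OF circ_gauss_second_moment[OF c]])
    also have "\<dots> = (LINT x|M. (norm (g (fst (e k)) x))\<^sup>2) / 2" using eD by (simp add: norm_mult)
    also have "\<dots> \<le> \<sigma>2 / 2" using m\<sigma>[OF eD(1)] by simp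
    finally show ?thesis .
  qed
  note S = gauss_SUP[OF YG YV bddY]
  have EX: "(LINT x|M. X x) = (LINT x|M. (SUP k. Y k x))" using XY by (intro Bochner_Integration.integral_cong) auto
  fix r assume r: "(LINT x|M. X x) \<le> r"
  show "prob {x \<in> space M. X x > r} \<le> exp (- ((r - (LINT x|M. X x))\<^sup>2 / \<sigma>2))"
  \<comment> \<open>For \<open>\<sigma>2 = 0\<close> the quotient has the value \<open>0\<close>,
    and the claim reduces to a probability being at most \<open>1\<close>.\<close>
  proof (cases "\<sigma>2 = 0")
    case False
    then have pos: "0 < \<sigma>2 / 2" using \<sigma>0 by simp
    have "{x \<in> space M. X x > r} = {x \<in> space M. (SUP k. Y k x) > r}" using XY by auto
    then show ?thesis using S(2)[OF _ pos r[unfolded EX]] EX by simp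
  qed simp
qed

section \<open>Limits of Gaussian and circular Gaussian variables\<close>

lemma char_tendsto:
  assumes [measurable]: "\<And>k. Z k \<in> borel_measurable M" "Y \<in> borel_measurable M"
    and lim: "\<And>x. x \<in> space M \<Longrightarrow> (\<lambda>k. Z k x) \<longlonglongrightarrow> Y x"
  shows "(\<lambda>k. CLINT x|M. iexp (u * Z k x)) \<longlonglongrightarrow> (CLINT x|M. iexp (u * Y x))"
proof (rule integral_dominated_convergence[where w="\<lambda>_. 1"])
  show "AE x in M. (\<lambda>k. iexp (u * Z k x)) \<longlonglongrightarrow> iexp (u * Y x)"
    using lim by (auto intro!: AE_I2 tendsto_intros)
qed auto

text \<open>The characteristic function of the limit is continuous and equals \<open>1\<close> at
  the origin, so it is nonzero at some small \<open>u0\<close>. Taking logarithms there recovers the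
  variances from the exponentials.\<close>

lemma gauss_variances_converge:
  assumes v: "\<And>k. 0 \<le> v k" and [measurable]: "Y \<in> borel_measurable M"
    and L: "\<And>u. (\<lambda>k. exp (- (u\<^sup>2 * v k / 2))) \<longlonglongrightarrow> norm (CLINT x|M. iexp (u * Y x))"
  obtains w where "0 \<le> w" "v \<longlonglongrightarrow> w"
proof -
  define r where "r u = norm (CLINT x|M. iexp (u * Y x))" for u
  have *: "(\<lambda>k. inverse (real (Suc k)) * Y x) \<longlonglongrightarrow> 0 * Y x" for x
    by (intro tendsto_intros LIMSEQ_inverse_real_of_nat)
  have "(\<lambda>k. CLINT x|M. iexp (1 * (inverse (real (Suc k)) * Y x))) \<longlonglongrightarrow> (CLINT x|M. iexp (1 * (0 * Y x)))"
    by (rule char_tendsto[OF _ _ *]) auto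
  from tendsto_norm[OF this] have "(\<lambda>k. r (inverse (real (Suc k)))) \<longlonglongrightarrow> 1"
    by (simp add: r_def prob_space)
  then have "eventually (\<lambda>k. 0 < r (inverse (real (Suc k)))) sequentially"
    by (rule order_tendstoD) simp
  then obtain k0 where k0: "0 < r (inverse (real (Suc k0)))" by (auto simp: eventually_sequentially)
  define u0 where "u0 = inverse (real (Suc k0))"
  have u0: "0 < u0" "0 < r u0" using k0 by (auto simp: u0_def)
  define w where "w = - 2 * ln (r u0) / u0\<^sup>2"
  have "(\<lambda>k. - 2 * ln (exp (- (u0\<^sup>2 * v k / 2))) / u0\<^sup>2) \<longlonglongrightarrow> w"
    unfolding w_def by (intro tendsto_intros L[of u0, folded r_def]) (use u0 in auto)
  then have vw: "v \<longlonglongrightarrow> w" using u0 by simp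
  have "0 \<le> w" by (rule LIMSEQ_le_const[OF vw]) (use v in auto)
  then show ?thesis using vw by (rule that)
qed

text \<open>Real and imaginary parts share the variance \<open>v k\<close> along the sequence, so
  one limit of variances serves both. This carries circularity over to derivatives.\<close>

lemma circ_gauss_limit:
  assumes c: "\<And>k. circ_gauss M (Z k)" and lim: "\<And>x. x \<in> space M \<Longrightarrow> (\<lambda>k. Z k x) \<longlonglongrightarrow> Y x"
  shows "circ_gauss M Y"
proof -
  obtain v where v: "\<And>k. cgauss M (\<lambda>x. Re (Z k x)) (v k)" "\<And>k. cgauss M (\<lambda>x. Im (Z k x)) (v k)"
    using c unfolding circ_gauss_def by metis
  have Zm[measurable]: "Z k \<in> borel_measurable M" for k by (rule circ_gauss_measurable[OF c])
  have Ym[measurable]: "Y \<in> borel_measurable M" by (rule borel_measurable_LIMSEQ_metric[OF Zm lim])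
  have L: "(\<lambda>k. complex_of_real (exp (- (u\<^sup>2 * v k / 2)))) \<longlonglongrightarrow> (CLINT x|M. iexp (u * Re (Y x)))"
          "(\<lambda>k. complex_of_real (exp (- (u\<^sup>2 * v k / 2)))) \<longlonglongrightarrow> (CLINT x|M. iexp (u * Im (Y x)))" for u
    unfolding cgauss_char[OF v(1), symmetric]
    subgoal by (rule char_tendsto) (auto intro: tendsto_Re lim)
    subgoal unfolding cgauss_char[OF v(1)] unfolding cgauss_char[OF v(2), symmetric]
      by (rule char_tendsto) (auto intro: tendsto_Im lim)
    done
  have "(\<lambda>k. exp (- (u\<^sup>2 * v k / 2))) \<longlonglongrightarrow> norm (CLINT x|M. iexp (u * Re (Y x)))" for u
    using tendsto_norm[OF L(1)[of u]] by simp
  then obtain w where w0: "0 \<le> w" and vw: "v \<longlonglongrightarrow> w"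
    using gauss_variances_converge[of v "\<lambda>x. Re (Y x)"] cgauss_nonneg[OF v(1)] by auto
  have E: "(\<lambda>k. complex_of_real (exp (- (u\<^sup>2 * v k / 2)))) \<longlonglongrightarrow> complex_of_real (exp (- (u\<^sup>2 * w / 2)))" for u
    by (intro tendsto_intros vw) auto
  have "cgauss M (\<lambda>x. Re (Y x)) w" unfolding cgauss_def
    using w0 LIMSEQ_unique[OF L(1) E] by auto
  moreover have "cgauss M (\<lambda>x. Im (Y x)) w" unfolding cgauss_def
    using w0 LIMSEQ_unique[OF L(2) E] by auto
  ultimately show ?thesis unfolding circ_gauss_def by blast
qed

end

section \<open>Wavelet transform of the noise\<close>

lemma (in prob_space) gaussian_rv_char:
  assumes "gaussian_rv M X"
  obtains v where "integrable M X" "0 \<le> v"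
    "\<And>u. (CLINT x|M. iexp (u * X x)) = iexp (u * expectation X) * exp (- (u\<^sup>2 * v / 2))"
proof -
  have [measurable]: "X \<in> borel_measurable M" using assms by (simp add: gaussian_rv_def)
  consider (normal) a sd where "sd > 0" "distributed M lborel X (normal_density a sd)"
    | (const) a where "AE x in M. X x = a" using assms by (auto simp: gaussian_rv_def)
  then show ?thesis
  proof cases
    case normal
    define Z where "Z x = (X x - a) / sd" for x
    have Z: "distributed M lborel Z std_normal_density"
      using normal_standard_normal_convert[OF normal(1), of X a] normal(2) unfolding Z_def by simp
    have [measurable]: "Z \<in> borel_measurable M" unfolding Z_def by measurable
    have X: "X x = a + sd * Z x" for x using normal(1) by (simp add: Z_def)
    have D: "distr M borel Z = std_normal_distribution"
      using distributed_distr_eq_density[OF Z] by (simp cong: distr_cong)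
    have i: "integrable M Z"
    proof -
      have "integrable (distr M borel Z) (\<lambda>x. x ^ 1)" unfolding D by (rule integrable_std_normal_distribution_moment)
      then show ?thesis by (simp add: integrable_distr_eq)
    qed
    have EX: "expectation X = a" by (rule normal_distributed_expectation[OF normal])
    have "(CLINT x|M. iexp (u * X x)) = iexp (u * expectation X) * exp (- (u\<^sup>2 * sd\<^sup>2 / 2))" for u
    proof -
      have "(CLINT x|M. iexp (u * X x)) = (CLINT x|M. iexp (u * a) * iexp ((u * sd) * Z x))"
        unfolding X by (simp add: distrib_left exp_add mult.assoc)
      also have "\<dots> = iexp (u * a) * char (distr M borel Z) (u * sd)" by (simp add: char_def integral_distr)
      also have "\<dots> = iexp (u * expectation X) * exp (- (u\<^sup>2 * sd\<^sup>2 / 2))"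
        unfolding D EX char_std_normal_distribution by (simp add: power_mult_distrib)
      finally show ?thesis .
    qed
    moreover have "integrable M X" unfolding X using i by simp
    ultimately show ?thesis by (intro that[of "sd\<^sup>2"]) auto
  next
    case const
    have "integrable M X \<longleftrightarrow> integrable M (\<lambda>_. a)" by (rule integrable_cong_AE) (use const in auto)
    moreover have "expectation X = expectation (\<lambda>_. a)" by (rule integral_cong_AE) (use const in auto)
    moreover have "(CLINT x|M. iexp (u * X x)) = (CLINT x|M. iexp (u * a))" for u
      by (rule integral_cong_AE) (use const in auto)
    ultimately show ?thesis by (intro that[of 0]) (auto simp: prob_space)
  qed
qed

lemma (in prob_space) char_L1_bound:
  assumes [measurable]: "X \<in> borel_measurable M" "Y \<in> borel_measurable M" and i: "integrable M (\<lambda>x. \<bar>X x - Y x\<bar>)"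
  shows "norm ((CLINT x|M. iexp (u * X x)) - (CLINT x|M. iexp (u * Y x))) \<le> \<bar>u\<bar> * (LINT x|M. \<bar>X x - Y x\<bar>)"
proof -
  have b: "norm (iexp (u * X x) - iexp (u * Y x)) \<le> \<bar>u\<bar> * \<bar>X x - Y x\<bar>" for x
  proof -
    have "iexp (u * X x) - iexp (u * Y x) = iexp (u * Y x) * (iexp (u * (X x - Y x)) - 1)"
      by (simp add: right_diff_distrib exp_diff)
    then have "norm (iexp (u * X x) - iexp (u * Y x)) = norm (iexp (u * (X x - Y x)) - 1)" by (simp add: norm_mult)
    also have "\<dots> \<le> \<bar>u * (X x - Y x)\<bar>" using iexp_approx1[of "u * (X x - Y x)" 0] by simp
    finally show ?thesis by (simp add: abs_mult)
  qed
  have "(CLINT x|M. iexp (u * X x)) - (CLINT x|M. iexp (u * Y x)) = (CLINT x|M. iexp (u * X x) - iexp (u * Y x))"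
    using integrable_iexp_rv[of X u] integrable_iexp_rv[of Y u] by simp
  also have "norm \<dots> \<le> (LINT x|M. norm (iexp (u * X x) - iexp (u * Y x)))" by (rule integral_norm_bound)
  also have "\<dots> \<le> (LINT x|M. \<bar>u\<bar> * \<bar>X x - Y x\<bar>)"
    by (rule integral_mono) (use b i integrable_iexp_rv[of X u] integrable_iexp_rv[of Y u] in auto)
  finally show ?thesis by simp
qed

lemma (in prob_space) cgauss_L1_limit:
  assumes Z: "\<And>k. gaussian_rv M (Z k)" and Y: "integrable M Y" "expectation Y = 0"
    and lim: "(\<lambda>k. LINT x|M. \<bar>Z k x - Y x\<bar>) \<longlonglongrightarrow> 0"
  shows "\<exists>v. cgauss M Y v"
proof -
  have "\<exists>v. integrable M (Z k) \<and> 0 \<le> v \<and> (\<forall>u. (CLINT x|M. iexp (u * Z k x)) = iexp (u * expectation (Z k)) * exp (- (u\<^sup>2 * v / 2)))" for k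
    using gaussian_rv_char[OF Z[of k]] by metis
  then obtain v where v: "\<And>k. integrable M (Z k)" "\<And>k. 0 \<le> v k"
    "\<And>k u. (CLINT x|M. iexp (u * Z k x)) = iexp (u * expectation (Z k)) * exp (- (u\<^sup>2 * v k / 2))" by metis
  have [measurable]: "Y \<in> borel_measurable M" "Z k \<in> borel_measurable M" for k using v(1) Y by auto
  have i: "integrable M (\<lambda>x. \<bar>Z k x - Y x\<bar>)" for k using v(1) Y by auto
  have m: "(\<lambda>k. expectation (Z k)) \<longlonglongrightarrow> 0"
  proof (rule Lim_null_comparison[OF _ lim])
    have "expectation (Z k) = expectation (\<lambda>x. Z k x - Y x)" for k using v(1) Y by simp
    then show "\<forall>\<^sub>F k in sequentially. norm (expectation (Z k)) \<le> (LINT x|M. \<bar>Z k x - Y x\<bar>)"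
      by (auto intro!: eventuallyI integral_abs_bound)
  qed
  have c: "(\<lambda>k. CLINT x|M. iexp (u * Z k x)) \<longlonglongrightarrow> (CLINT x|M. iexp (u * Y x))" for u
  proof (rule LIM_zero_cancel, rule Lim_null_comparison)
    show "\<forall>\<^sub>F k in sequentially. norm ((CLINT x|M. iexp (u * Z k x)) - (CLINT x|M. iexp (u * Y x)))
       \<le> \<bar>u\<bar> * (LINT x|M. \<bar>Z k x - Y x\<bar>)" by (intro eventuallyI char_L1_bound i) auto
    show "(\<lambda>k. \<bar>u\<bar> * (LINT x|M. \<bar>Z k x - Y x\<bar>)) \<longlonglongrightarrow> 0" using tendsto_mult_right_zero[OF lim] by simp
  qed
  have "(\<lambda>k. exp (- (u\<^sup>2 * v k / 2))) \<longlonglongrightarrow> norm (CLINT x|M. iexp (u * Y x))" for u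
    using tendsto_norm[OF c[of u]] unfolding v(3) by (simp add: norm_mult)
  then obtain w where w: "0 \<le> w" "v \<longlonglongrightarrow> w"
    using gauss_variances_converge[of v Y] v(2) by auto
  have "(\<lambda>k. iexp (u * expectation (Z k)) * exp (- (u\<^sup>2 * v k / 2))) \<longlonglongrightarrow> iexp (u * 0) * exp (- (u\<^sup>2 * w / 2))" for u
    by (intro tendsto_intros m w(2)) auto
  then have "(CLINT x|M. iexp (u * Y x)) = complex_of_real (exp (- (u\<^sup>2 * w / 2)))" for u
    using LIMSEQ_unique[OF c[of u, unfolded v(3)]] by simp
  then have "cgauss M Y w" unfolding cgauss_def using w by simp
  then show ?thesis ..
qed

lemma cgauss_cong_AE:
  assumes "cgauss P X v" and [measurable]: "Y \<in> borel_measurable P" and ae: "AE x in P. X x = Y x"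
  shows "cgauss P Y v"
proof -
  have [measurable]: "X \<in> borel_measurable P" by (rule cgauss_measurable[OF assms(1)])
  have "(CLINT x|P. iexp (u * Y x)) = (CLINT x|P. iexp (u * X x))" for u
    by (rule integral_cong_AE) (use ae in auto)
  then show ?thesis using assms(1) unfolding cgauss_def by simp
qed

lemma circ_gauss_cong_AE:
  assumes "circ_gauss P X" and [measurable]: "Y \<in> borel_measurable P" and ae: "AE x in P. X x = Y x"
  shows "circ_gauss P Y"
proof -
  obtain v where v: "cgauss P (\<lambda>x. Re (X x)) v" "cgauss P (\<lambda>x. Im (X x)) v" using assms(1) by (auto simp: circ_gauss_def)
  have "cgauss P (\<lambda>x. Re (Y x)) v" by (rule cgauss_cong_AE[OF v(1)]) (use ae in auto)
  moreover have "cgauss P (\<lambda>x. Im (Y x)) v" by (rule cgauss_cong_AE[OF v(2)]) (use ae in auto)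
  ultimately show ?thesis by (auto simp: circ_gauss_def)
qed

section \<open>Second-order structure of the noise and its integrals against kernels\<close>

locale noise = prob_space P for P :: "'w measure" +
  fixes Phi :: "real \<Rightarrow> 'w \<Rightarrow> real" and p :: "real \<Rightarrow> real"
  assumes joint[measurable]: "(\<lambda>(\<tau>, x). Phi \<tau> x) \<in> borel_measurable (lborel \<Otimes>\<^sub>M P)"
    and gaussian: "gaussian_process P Phi"
    and stationary: "stationary_process P Phi"
    and ms_continuous: "mean_square_continuous P Phi"
    and spectral: "has_spectral_density P Phi p"
begin

sublocale pair_sigma_finite lborel P by unfold_locales

lemma Phi_measurable[measurable]: "Phi \<tau> \<in> borel_measurable P"
proof -
  show ?thesis
    using gaussian[unfolded gaussian_process_def, rule_format, of "{\<tau>}" "\<lambda>_. 1"] by (simp add: gaussian_rv_def)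
qed

lemma Phi_square: "integrable P (\<lambda>x. (Phi \<tau> x)\<^sup>2)"
  using ms_continuous by (simp add: mean_square_continuous_def)

lemma Phi_integrable: "integrable P (Phi \<tau>)"
  by (rule square_integrable_imp_integrable[OF Phi_measurable Phi_square])

text \<open>Means, powers, correlations and squared increments of the process are all of this form
  and differ only in \<open>f\<close>.\<close>

lemma stationary_pair:
  assumes f: "(\<lambda>(x, y). f x y) \<in> borel_measurable (borel \<Otimes>\<^sub>M borel)"
  shows "(LINT x|P. f (Phi (u + h) x) (Phi h x) :: real) = (LINT x|P. f (Phi u x) (Phi 0 x))"
proof -
  let ?J = "{u, 0::real}"
  let ?M = "Pi\<^sub>M ?J (\<lambda>_. borel) :: (real \<Rightarrow> real) measure"
  have eq: "distr P ?M (\<lambda>x. \<lambda>t\<in>?J. Phi (t + h) x) = distr P ?M (\<lambda>x. \<lambda>t\<in>?J. Phi t x)"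
    by (rule stationary[unfolded stationary_process_def, rule_format]) simp
  have m: "(\<lambda>x. \<lambda>t\<in>?J. Phi (t + h) x) \<in> measurable P ?M" for h
    by (rule measurable_restrict) simp
  have g: "(\<lambda>y. f (y u) (y 0)) \<in> borel_measurable ?M"
    using measurable_compose[OF measurable_Pair[of "\<lambda>y. y u" ?M borel "\<lambda>y. y 0" borel] f] by simp
  have "(LINT x|P. f (Phi (u + h) x) (Phi h x)) = (LINT y|distr P ?M (\<lambda>x. \<lambda>t\<in>?J. Phi (t + h) x). f (y u) (y 0))"
    by (subst integral_distr[OF m g]) simp
  also have "\<dots> = (LINT x|P. f (Phi u x) (Phi 0 x))"
    unfolding eq using m[of 0] by (subst integral_distr[OF _ g]) simp_all
  finally show ?thesis .
qed

text \<open>The process need not be centered. Its constant mean is carried along and disappears when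
  integrated against kernels of integral \<open>0\<close>.\<close>

definition "mean0 = expectation (Phi 0)"
definition "power0 = (LINT x|P. (Phi 0 x)\<^sup>2)"

lemma Phi_mean: "expectation (Phi \<tau>) = mean0"
  using stationary_pair[of "\<lambda>x y. y" 0 \<tau>] by (simp add: mean0_def)

lemma Phi_power: "(LINT x|P. (Phi \<tau> x)\<^sup>2) = power0"
  using stationary_pair[of "\<lambda>x y. y\<^sup>2" 0 \<tau>] by (simp add: power0_def)

lemma power0_nonneg: "0 \<le> power0" unfolding power0_def by simp

lemma Phi_product: "integrable P (\<lambda>x. Phi \<tau> x * Phi \<sigma> x)"
proof (rule Bochner_Integration.integrable_bound)
  show "integrable P (\<lambda>x. (Phi \<tau> x)\<^sup>2 + (Phi \<sigma> x)\<^sup>2)" using Phi_square by simp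
  have "\<bar>x * y\<bar> \<le> \<bar>x\<^sup>2 + y\<^sup>2\<bar>" for x y :: real
  proof -
    have "2 * (\<bar>x\<bar> * \<bar>y\<bar>) \<le> x\<^sup>2 + y\<^sup>2" using sum_squares_bound[of "\<bar>x\<bar>" "\<bar>y\<bar>"] by (simp add: mult.assoc)
    moreover have "0 \<le> \<bar>x\<bar> * \<bar>y\<bar>" by simp
    ultimately show ?thesis unfolding abs_mult by linarith
  qed
  then show "AE x in P. norm (Phi \<tau> x * Phi \<sigma> x) \<le> norm ((Phi \<tau> x)\<^sup>2 + (Phi \<sigma> x)\<^sup>2)" by simp
qed measurable

lemma Phi_correlation:
  "complex_of_real (LINT x|P. Phi \<tau> x * Phi \<sigma> x)
    = mean0\<^sup>2 + (CLINT l|lborel. iexp ((\<tau> - \<sigma>) * l) * p l)"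
proof -
  let ?u = "\<tau> - \<sigma>"
  have "(LINT x|P. Phi \<tau> x * Phi \<sigma> x) = (LINT x|P. Phi ?u x * Phi 0 x)"
    using stationary_pair[of "\<lambda>x y. x * y" ?u \<sigma>] by simp
  also have "\<dots> = mean0\<^sup>2 + covariance P (Phi ?u) (Phi 0)"
  proof -
    have "covariance P (Phi ?u) (Phi 0) = (LINT x|P. (Phi ?u x - mean0) * (Phi 0 x - mean0))"
      unfolding covariance_def Phi_mean ..
    also have "\<dots> = (LINT x|P. Phi ?u x * Phi 0 x - mean0 * Phi ?u x - mean0 * Phi 0 x + mean0 * mean0)"
      by (simp add: algebra_simps)
    also have "\<dots> = (LINT x|P. Phi ?u x * Phi 0 x) - mean0 * mean0 - mean0 * mean0 + mean0 * mean0"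
      using Phi_product Phi_integrable by (simp add: Phi_mean prob_space)
    finally show ?thesis by (simp add: power2_eq_square)
  qed
  also have "complex_of_real (mean0\<^sup>2 + covariance P (Phi ?u) (Phi 0)) = mean0\<^sup>2 + (CLINT l|lborel. iexp (?u * l) * p l)"
    using spectral unfolding has_spectral_density_def by simp
  finally show ?thesis by simp
qed

text \<open>Fubini, from a bound on the first moments that is uniform in time. It is stated for a
  general field \<open>G\<close> because it serves the process, its sampled versions and their
  differences, and the products by which the pseudo-variance is computed.\<close>

lemma kernel_integral:
  fixes G :: "real \<Rightarrow> 'w \<Rightarrow> 'b::{real_normed_field, banach, second_countable_topology}"
  assumes [measurable]: "(\<lambda>(\<tau>, x). G \<tau> x) \<in> borel_measurable (lborel \<Otimes>\<^sub>M P)"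
    and i: "\<And>\<tau>. integrable P (G \<tau>)" and B: "\<And>\<tau>. (LINT x|P. norm (G \<tau> x)) \<le> B"
    and K: "integrable lborel K"
  shows "AE x in P. integrable lborel (\<lambda>\<tau>. G \<tau> x * K \<tau>)"
    and "integrable P (\<lambda>x. LINT \<tau>|lborel. G \<tau> x * K \<tau>)"
    and "(LINT x|P. LINT \<tau>|lborel. G \<tau> x * K \<tau>) = (LINT \<tau>|lborel. (LINT x|P. G \<tau> x) * K \<tau>)"
    and "(LINT x|P. norm (LINT \<tau>|lborel. G \<tau> x * K \<tau>)) \<le> (LINT \<tau>|lborel. (LINT x|P. norm (G \<tau> x)) * norm (K \<tau>))"
proof -
  have [measurable]: "K \<in> borel_measurable borel" using K borel_measurable_integrable by force
  have I: "integrable (lborel \<Otimes>\<^sub>M P) (\<lambda>(\<tau>, x). G \<tau> x * K \<tau>)"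
  proof (rule Fubini_integrable)
    show "integrable lborel (\<lambda>\<tau>. LINT x|P. norm (case (\<tau>, x) of (\<tau>, x) \<Rightarrow> G \<tau> x * K \<tau>))"
    proof (rule Bochner_Integration.integrable_bound)
      show "integrable lborel (\<lambda>\<tau>. B * norm (K \<tau>))" using K by simp
      have m: "(\<lambda>\<tau>. LINT x|P. norm (G \<tau> x * K \<tau>)) \<in> borel_measurable lborel" by measurable
      then show "(\<lambda>\<tau>. LINT x|P. norm (case (\<tau>, x) of (\<tau>, x) \<Rightarrow> G \<tau> x * K \<tau>)) \<in> borel_measurable lborel" by simp
      have "(LINT x|P. norm (G \<tau> x * K \<tau>)) \<le> B * norm (K \<tau>)" for \<tau>
        using mult_right_mono[OF B[of \<tau>], of "norm (K \<tau>)"] by (simp add: norm_mult)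
      then have "\<bar>LINT x|P. norm (G \<tau> x * K \<tau>)\<bar> \<le> \<bar>B * norm (K \<tau>)\<bar>" for \<tau>
        by (subst abs_of_nonneg) (auto intro: order.trans[OF _ abs_ge_self])
      then show "AE \<tau> in lborel. norm (LINT x|P. norm (case (\<tau>, x) of (\<tau>, x) \<Rightarrow> G \<tau> x * K \<tau>)) \<le> norm (B * norm (K \<tau>))"
        by simp
    qed
    show "AE \<tau> in lborel. integrable P (\<lambda>x. case (\<tau>, x) of (\<tau>, x) \<Rightarrow> G \<tau> x * K \<tau>)" using i by simp
  qed measurable
  show "AE x in P. integrable lborel (\<lambda>\<tau>. G \<tau> x * K \<tau>)" by (rule AE_integrable_snd[OF I])
  show iP: "integrable P (\<lambda>x. LINT \<tau>|lborel. G \<tau> x * K \<tau>)" by (rule integrable_snd[OF I])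
  show "(LINT x|P. LINT \<tau>|lborel. G \<tau> x * K \<tau>) = (LINT \<tau>|lborel. (LINT x|P. G \<tau> x) * K \<tau>)"
    using Fubini_integral[OF I] by simp
  have J: "integrable (lborel \<Otimes>\<^sub>M P) (\<lambda>(\<tau>, x). norm (G \<tau> x * K \<tau>))"
    using integrable_norm[OF I] by (simp add: split_beta')
  have "(LINT x|P. norm (LINT \<tau>|lborel. G \<tau> x * K \<tau>)) \<le> (LINT x|P. LINT \<tau>|lborel. norm (G \<tau> x * K \<tau>))"
    by (rule integral_mono[OF integrable_norm[OF iP] integrable_snd[OF J] integral_norm_bound])
  also have "\<dots> = (LINT \<tau>|lborel. (LINT x|P. norm (G \<tau> x)) * norm (K \<tau>))"
    using Fubini_integral[OF J] by (simp add: norm_mult)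
  finally show "(LINT x|P. norm (LINT \<tau>|lborel. G \<tau> x * K \<tau>)) \<le> (LINT \<tau>|lborel. (LINT x|P. norm (G \<tau> x)) * norm (K \<tau>))" .
qed

lemma L1_le_sqrt_power:
  assumes "X \<in> borel_measurable P" "integrable P (\<lambda>x. (X x)\<^sup>2)"
  shows "(LINT x|P. \<bar>X x\<bar>) \<le> sqrt (LINT x|P. (X x)\<^sup>2)"
proof (rule real_le_rsqrt)
  have i: "integrable P (\<lambda>x. \<bar>X x\<bar>)"
    by (rule integrable_abs[OF square_integrable_imp_integrable[OF assms]])
  have "0 \<le> variance (\<lambda>x. \<bar>X x\<bar>)" by (rule variance_positive)
  also have "\<dots> = (LINT x|P. (X x)\<^sup>2) - (LINT x|P. \<bar>X x\<bar>)\<^sup>2"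
    using variance_eq[OF i] assms(2) by simp
  finally show "(LINT x|P. \<bar>X x\<bar>)\<^sup>2 \<le> (LINT x|P. (X x)\<^sup>2)" by simp
qed

lemma Phi_L1: "(LINT x|P. \<bar>Phi \<tau> x\<bar>) \<le> sqrt power0"
  using L1_le_sqrt_power[OF Phi_measurable Phi_square] unfolding Phi_power .

text \<open>By stationarity the second moment of an increment depends on the lag alone, so
  mean-square continuity at \<open>0\<close> controls all increments; the first moment follows from
  the second.\<close>

lemma Phi_increment:
  assumes "(\<lambda>k. r k) \<longlonglongrightarrow> \<tau>"
  shows "(\<lambda>k. LINT x|P. \<bar>Phi \<tau> x - Phi (r k) x\<bar>) \<longlonglongrightarrow> 0"
proof (rule Lim_null_comparison)
  define d where "d u = (LINT x|P. (Phi u x - Phi 0 x)\<^sup>2)" for u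
  have "(d \<longlongrightarrow> 0) (at 0)" using spec[OF conjunct2[OF ms_continuous[unfolded mean_square_continuous_def]], of 0]
    unfolding d_def .
  moreover have "d 0 = 0" by (simp add: d_def)
  ultimately have "isCont d 0" by (simp add: isCont_def)
  moreover have "(\<lambda>k. \<tau> - r k) \<longlonglongrightarrow> 0" using tendsto_diff[OF tendsto_const assms, of \<tau>] by simp
  ultimately have "(\<lambda>k. d (\<tau> - r k)) \<longlonglongrightarrow> d 0" by (rule isCont_tendsto_compose)
  then show "(\<lambda>k. sqrt (d (\<tau> - r k))) \<longlonglongrightarrow> 0" using \<open>d 0 = 0\<close> tendsto_real_sqrt by fastforce
  have "(LINT x|P. \<bar>Phi \<tau> x - Phi \<sigma> x\<bar>) \<le> sqrt (d (\<tau> - \<sigma>))" for \<sigma>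
  proof -
    have "(LINT x|P. (Phi \<tau> x - Phi \<sigma> x)\<^sup>2) = d (\<tau> - \<sigma>)"
      using stationary_pair[of "\<lambda>x y. (x - y)\<^sup>2" "\<tau> - \<sigma>" \<sigma>] by (simp add: d_def)
    moreover have "integrable P (\<lambda>x. (Phi \<tau> x - Phi \<sigma> x)\<^sup>2)"
      using Phi_square Phi_product by (simp add: power2_diff mult.assoc)
    ultimately show ?thesis using L1_le_sqrt_power[of "\<lambda>x. Phi \<tau> x - Phi \<sigma> x"] by simp
  qed
  then show "\<forall>\<^sub>F k in sequentially. norm (LINT x|P. \<bar>Phi \<tau> x - Phi (r k) x\<bar>) \<le> sqrt (d (\<tau> - r k))"
    by (auto intro!: eventuallyI)
qed

text \<open>A process sampled at finitely many times integrates to a finite linear combination of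
  its values, which is Gaussian by the definition of the process.\<close>

lemma step_kernel_integral:
  fixes k :: "real \<Rightarrow> real"
  assumes k: "integrable lborel k" and q[measurable]: "q \<in> borel_measurable borel" and J: "finite J"
  shows "(LINT \<tau>|lborel. (if q \<tau> \<in> J then Phi (q \<tau>) x else 0) * k \<tau>)
    = (\<Sum>t\<in>J. (LINT \<tau>|lborel. k \<tau> * indicator {\<tau>. q \<tau> = t} \<tau>) * Phi t x)"
proof -
  have i: "integrable lborel (\<lambda>\<tau>. k \<tau> * indicator {\<tau>. q \<tau> = t} \<tau>)" for t
    by (rule integrable_real_mult_indicator[OF _ k]) simp
  have "(if q \<tau> \<in> J then Phi (q \<tau>) x else 0) * k \<tau> = (\<Sum>t\<in>J. (k \<tau> * indicator {\<tau>. q \<tau> = t} \<tau>) * Phi t x)" for \<tau>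
  proof -
    have "(\<Sum>t\<in>J. (k \<tau> * indicator {\<tau>. q \<tau> = t} \<tau>) * Phi t x) = (\<Sum>t\<in>J. if q \<tau> = t then k \<tau> * Phi t x else 0)"
      by (intro sum.cong) auto
    also have "\<dots> = (if q \<tau> \<in> J then k \<tau> * Phi (q \<tau>) x else 0)" using J by (rule sum.delta')
    finally show ?thesis by (simp add: mult.commute)
  qed
  then show ?thesis using i by (simp add: Bochner_Integration.integral_sum)
qed

text \<open>Sampling the process on a grid that becomes fine and wide approximates the integral in mean.\<close>

lemma kernel_integral_gaussian:
  fixes k :: "real \<Rightarrow> real"
  assumes k: "integrable lborel k" and mean: "mean0 * (LINT \<tau>|lborel. k \<tau>) = 0"
  shows "\<exists>v. cgauss P (\<lambda>x. LINT \<tau>|lborel. Phi \<tau> x * k \<tau>) v"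
proof -
  have [measurable]: "k \<in> borel_measurable borel" using k borel_measurable_integrable by force
  \<comment> \<open>The grid has mesh \<open>1 / Suc n\<close>. Indices up to
    \<open>(Suc n)\<^sup>2\<close> in modulus cover the window of radius \<open>Suc n\<close>, so
    the mesh shrinks and the window grows while \<open>J n\<close> stays finite.\<close>
  define q where "q n \<tau> = real_of_int \<lfloor>\<tau> * real (Suc n)\<rfloor> / real (Suc n)" for n \<tau>
  define J where "J n = (\<lambda>i::int. real_of_int i / real (Suc n)) ` {- (int (Suc n))\<^sup>2..(int (Suc n))\<^sup>2}" for n
  have qm[measurable]: "q n \<in> borel_measurable borel" for n unfolding q_def by measurable
  have Jf: "finite (J n)" for n by (simp add: J_def)
  have qJ: "eventually (\<lambda>n. q n \<tau> \<in> J n) sequentially" for \<tau>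
  proof -
    obtain N where N: "\<bar>\<tau>\<bar> + 1 < real N" using reals_Archimedean2 by blast
    have "q n \<tau> \<in> J n" if "N \<le> n" for n
    proof -
      let ?m = "real (Suc n)"
      have m: "\<bar>\<tau>\<bar> + 1 \<le> ?m" using N that by linarith
      have "\<bar>\<tau> * ?m\<bar> + 1 \<le> (\<bar>\<tau>\<bar> + 1) * ?m" by (simp add: abs_mult distrib_right)
      also have "\<dots> \<le> ?m * ?m" using m by (intro mult_right_mono) auto
      finally have "\<bar>real_of_int \<lfloor>\<tau> * ?m\<rfloor>\<bar> \<le> real_of_int ((int (Suc n))\<^sup>2)"
        by (simp add: power2_eq_square) linarith
      then have "\<lfloor>\<tau> * ?m\<rfloor> \<in> {- (int (Suc n))\<^sup>2..(int (Suc n))\<^sup>2}"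
        unfolding of_int_abs[symmetric] of_int_le_iff by (auto simp: abs_le_iff)
      then show ?thesis unfolding q_def J_def by blast
    qed
    then show ?thesis by (auto simp: eventually_sequentially)
  qed
  have qlim: "(\<lambda>n. q n \<tau>) \<longlonglongrightarrow> \<tau>" for \<tau>
  proof (rule LIM_zero_cancel, rule Lim_null_comparison[OF _ LIMSEQ_inverse_real_of_nat])
    have "\<bar>q n \<tau> - \<tau>\<bar> \<le> inverse (real (Suc n))" for n
    proof -
      let ?m = "real (Suc n)"
      have "q n \<tau> - \<tau> = (real_of_int \<lfloor>\<tau> * ?m\<rfloor> - \<tau> * ?m) / ?m" unfolding q_def by (simp add: field_simps)
      then have "\<bar>q n \<tau> - \<tau>\<bar> = \<bar>real_of_int \<lfloor>\<tau> * ?m\<rfloor> - \<tau> * ?m\<bar> / ?m" by simp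
      also have "\<dots> \<le> 1 / ?m" by (intro divide_right_mono) (linarith | simp)+
      finally show ?thesis by (simp add: inverse_eq_divide)
    qed
    then show "\<forall>\<^sub>F n in sequentially. norm (q n \<tau> - \<tau>) \<le> inverse (real (Suc n))" by simp
  qed
  define S where "S n \<tau> x = (if q n \<tau> \<in> J n then Phi (q n \<tau>) x else 0)" for n \<tau> x
  have Sm[measurable]: "(\<lambda>(\<tau>, x). S n \<tau> x) \<in> borel_measurable (lborel \<Otimes>\<^sub>M P)" for n
  proof -
    have [measurable]: "J n \<in> sets borel" using Jf by (simp add: finite_imp_closed)
    have "(\<lambda>x. Phi (q n (fst x)) (snd x)) \<in> borel_measurable (lborel \<Otimes>\<^sub>M P)"
      using measurable_compose[OF _ joint, of "\<lambda>x. (q n (fst x), snd x)" "lborel \<Otimes>\<^sub>M P"] by simp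
    then show ?thesis unfolding S_def split_beta' by measurable
  qed
  have Si: "integrable P (S n \<tau>)" for n \<tau>
    unfolding S_def using Phi_integrable[of "q n \<tau>"] by (cases "q n \<tau> \<in> J n") auto
  have SL: "(LINT x|P. \<bar>S n \<tau> x\<bar>) \<le> sqrt power0" for n \<tau>
    unfolding S_def using Phi_L1[of "q n \<tau>"] power0_nonneg by (cases "q n \<tau> \<in> J n") auto
  have dm[measurable]: "(\<lambda>(\<tau>, x). S n \<tau> x - Phi \<tau> x) \<in> borel_measurable (lborel \<Otimes>\<^sub>M P)" for n
    using borel_measurable_diff[OF Sm[of n] joint] by (simp add: split_beta')
  have di: "integrable P (\<lambda>x. S n \<tau> x - Phi \<tau> x)" for n \<tau> using Si Phi_integrable by simp
  have dL: "(LINT x|P. \<bar>S n \<tau> x - Phi \<tau> x\<bar>) \<le> 2 * sqrt power0" for n \<tau>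
  proof -
    have "(LINT x|P. \<bar>S n \<tau> x - Phi \<tau> x\<bar>) \<le> (LINT x|P. \<bar>S n \<tau> x\<bar> + \<bar>Phi \<tau> x\<bar>)"
      using Si Phi_integrable by (intro integral_mono) auto
    also have "\<dots> = (LINT x|P. \<bar>S n \<tau> x\<bar>) + (LINT x|P. \<bar>Phi \<tau> x\<bar>)" using Si Phi_integrable by simp
    finally show ?thesis using SL[of n \<tau>] Phi_L1[of \<tau>] by linarith
  qed
  define Y where "Y x = (LINT \<tau>|lborel. Phi \<tau> x * k \<tau>)" for x
  define Z where "Z n x = (LINT \<tau>|lborel. S n \<tau> x * k \<tau>)" for n x
  have L: "(LINT x|P. norm (Phi \<tau> x)) \<le> sqrt power0" "(LINT x|P. norm (S n \<tau> x)) \<le> sqrt power0"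
    "(LINT x|P. norm (S n \<tau> x - Phi \<tau> x)) \<le> 2 * sqrt power0" for n \<tau>
    using Phi_L1 SL dL by auto
  note KY = kernel_integral[OF joint Phi_integrable L(1) k, folded Y_def]
  note KZ = kernel_integral[OF Sm Si L(2) k, folded Z_def]
  note KD = kernel_integral[OF dm di L(3) k]
  have EY: "expectation Y = 0" using KY(3) mean by (simp add: Phi_mean)
  have dlim: "(\<lambda>n. LINT x|P. \<bar>S n \<tau> x - Phi \<tau> x\<bar>) \<longlonglongrightarrow> 0" for \<tau>
  proof -
    have "eventually (\<lambda>n. (LINT x|P. \<bar>Phi \<tau> x - Phi (q n \<tau>) x\<bar>) = (LINT x|P. \<bar>S n \<tau> x - Phi \<tau> x\<bar>)) sequentially"
      using qJ[of \<tau>] by eventually_elim (simp add: S_def abs_minus_commute)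
    then show ?thesis using Phi_increment[OF qlim, of \<tau>] by (rule Lim_transform_eventually[rotated])
  qed
  have mm: "(\<lambda>\<tau>. LINT x|P. norm (S n \<tau> x - Phi \<tau> x)) \<in> borel_measurable lborel" for n
    using dm[of n] by measurable
  define w where "w \<tau> = 2 * sqrt power0 * norm (k \<tau>)" for \<tau>
  define s where "s n \<tau> = (LINT x|P. norm (S n \<tau> x - Phi \<tau> x)) * norm (k \<tau>)" for n \<tau>
  have sb: "norm (s n \<tau>) \<le> w \<tau>" for n \<tau>
  proof -
    have "norm (s n \<tau>) = s n \<tau>" by (simp add: s_def abs_mult)
    also have "\<dots> \<le> w \<tau>" unfolding s_def w_def by (rule mult_right_mono[OF L(3)]) simp
    finally show ?thesis .
  qed
  have sm: "s n \<in> borel_measurable lborel" for n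
    unfolding s_def using mm[of n] by measurable
  have sl: "(\<lambda>n. s n \<tau>) \<longlonglongrightarrow> 0" for \<tau>
    unfolding s_def using dlim[of \<tau>] by (intro tendsto_mult_left_zero) simp
  have wi: "integrable lborel w" unfolding w_def using k by simp
  have "(\<lambda>n. integral\<^sup>L lborel (s n)) \<longlonglongrightarrow> integral\<^sup>L lborel (\<lambda>_::real. 0)"
    by (rule integral_dominated_convergence[OF _ sm wi]) (use sl sb in auto)
  then have D0: "(\<lambda>n. LINT \<tau>|lborel. (LINT x|P. norm (S n \<tau> x - Phi \<tau> x)) * norm (k \<tau>)) \<longlonglongrightarrow> 0"
    unfolding s_def by simp
  have "(\<lambda>n. LINT x|P. \<bar>Z n x - Y x\<bar>) \<longlonglongrightarrow> 0"
  proof (rule Lim_null_comparison[OF _ D0])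
    have "(LINT x|P. \<bar>Z n x - Y x\<bar>) \<le> (LINT \<tau>|lborel. (LINT x|P. norm (S n \<tau> x - Phi \<tau> x)) * norm (k \<tau>))" for n
    proof -
      have "AE x in P. Z n x - Y x = (LINT \<tau>|lborel. (S n \<tau> x - Phi \<tau> x) * k \<tau>)"
        using KY(1) KZ(1)[of n] by eventually_elim (simp add: Y_def Z_def left_diff_distrib)
      then have "(LINT x|P. \<bar>Z n x - Y x\<bar>) = (LINT x|P. norm (LINT \<tau>|lborel. (S n \<tau> x - Phi \<tau> x) * k \<tau>))"
        using KY(2) KZ(2)[of n] KD(2)[of n] by (intro integral_cong_AE) auto
      then show ?thesis using KD(4)[of n] by simp
    qed
    then show "\<forall>\<^sub>F n in sequentially. norm (LINT x|P. \<bar>Z n x - Y x\<bar>)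
       \<le> (LINT \<tau>|lborel. (LINT x|P. norm (S n \<tau> x - Phi \<tau> x)) * norm (k \<tau>))"
      by (intro eventuallyI) simp
  qed
  moreover have "gaussian_rv P (Z n)" for n
  proof -
    have "Z n = (\<lambda>x. \<Sum>t\<in>J n. (LINT \<tau>|lborel. k \<tau> * indicator {\<tau>. q n \<tau> = t} \<tau>) * Phi t x)"
      unfolding Z_def S_def using step_kernel_integral[OF k qm Jf] by simp
    then show ?thesis using gaussian[unfolded gaussian_process_def, rule_format, OF Jf] by simp
  qed
  ultimately have "\<exists>v. cgauss P Y v" by (intro cgauss_L1_limit[OF _ KY(2) EY]) auto
  then show ?thesis unfolding Y_def .
qed

text \<open>In terms of the conjugated wavelet the Fourier sign is positive. The frequency
  \<open>l = 0\<close> is included, so such a kernel has integral \<open>0\<close> and annihilates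
  the constant mean.\<close>

definition analytic_kernel :: "(real \<Rightarrow> complex) \<Rightarrow> bool" where
  "analytic_kernel K \<longleftrightarrow> integrable lborel K \<and> (\<forall>l\<le>0. (CLINT \<tau>|lborel. iexp (\<tau> * l) * K \<tau>) = 0)"

lemma analytic_kernel_scale: "analytic_kernel K \<Longrightarrow> analytic_kernel (\<lambda>\<tau>. c * K \<tau>)"
  unfolding analytic_kernel_def by (auto simp: mult.left_commute[of _ c])

lemma integrable_iexp_kernel:
  assumes K: "integrable lborel K" shows "integrable lborel (\<lambda>\<tau>. iexp (\<tau> * l) * K \<tau>)"
proof (rule Bochner_Integration.integrable_bound[OF K])
  have "K \<in> borel_measurable borel" using K borel_measurable_integrable by force
  then show "(\<lambda>\<tau>. iexp (\<tau> * l) * K \<tau>) \<in> borel_measurable lborel" by simp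
qed (simp add: norm_mult)

lemma analytic_kernel_sum:
  assumes "\<And>i. i < (n::nat) \<Longrightarrow> analytic_kernel (K i)"
  shows "analytic_kernel (\<lambda>\<tau>. \<Sum>i<n. K i \<tau>)"
  unfolding analytic_kernel_def
proof (intro conjI allI impI)
  have i: "integrable lborel (K j)" if "j < n" for j using assms[OF that] by (simp add: analytic_kernel_def)
  show "integrable lborel (\<lambda>\<tau>. \<Sum>i<n. K i \<tau>)" using i by (intro Bochner_Integration.integrable_sum) auto
  fix l :: real assume l: "l \<le> 0"
  have "(CLINT \<tau>|lborel. iexp (\<tau> * l) * (\<Sum>i<n. K i \<tau>)) = (\<Sum>i<n. (CLINT \<tau>|lborel. iexp (\<tau> * l) * K i \<tau>))"
    unfolding sum_distrib_left using i by (intro Bochner_Integration.integral_sum integrable_iexp_kernel) auto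
  also have "\<dots> = 0" using assms l by (intro sum.neutral) (auto simp: analytic_kernel_def)
  finally show "(CLINT \<tau>|lborel. iexp (\<tau> * l) * (\<Sum>i<n. K i \<tau>)) = 0" .
qed

lemma Fubini_bounded_lborel:
  fixes K G :: "real \<Rightarrow> complex"
  assumes K: "integrable lborel K" and G: "integrable lborel G"
    and [measurable]: "(\<lambda>(x, y). b x y) \<in> borel_measurable (borel \<Otimes>\<^sub>M borel)" and b: "\<And>x y. norm (b x y) \<le> 1"
  shows "(CLINT x|lborel. (CLINT y|lborel. b x y * G y) * K x) = (CLINT y|lborel. (CLINT x|lborel. b x y * K x) * G y)"
proof -
  have [measurable]: "K \<in> borel_measurable borel" "G \<in> borel_measurable borel"
    using K G borel_measurable_integrable by force+
  have I: "integrable (lborel \<Otimes>\<^sub>M lborel) (\<lambda>(x, y). b x y * G y * K x)"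
  proof (rule Bochner_Integration.integrable_bound)
    show "integrable (lborel \<Otimes>\<^sub>M lborel) (\<lambda>(x, y). norm (K x) * norm (G y))"
    proof (rule lborel_pair.Fubini_integrable)
      show "integrable lborel (\<lambda>x. LINT y|lborel. norm (case (x, y) of (x, y) \<Rightarrow> norm (K x) * norm (G y)))"
        using K by (simp add: abs_mult)
      show "AE x in lborel. integrable lborel (\<lambda>y. case (x, y) of (x, y) \<Rightarrow> norm (K x) * norm (G y))"
        using G by simp
    qed measurable
    have "norm (b x y * G y * K x) \<le> norm (K x) * norm (G y)" for x y
      using mult_right_mono[OF b[of x y], of "norm (G y) * norm (K x)"] by (simp add: norm_mult mult_ac)
    then show "AE z in lborel \<Otimes>\<^sub>M lborel. norm (case z of (x, y) \<Rightarrow> b x y * G y * K x) \<le> norm (case z of (x, y) \<Rightarrow> norm (K x) * norm (G y))"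
      by (auto simp: split_beta')
  qed measurable
  have "(CLINT x|lborel. (CLINT y|lborel. b x y * G y) * K x) = (CLINT x|lborel. CLINT y|lborel. b x y * G y * K x)"
    by simp
  also have "\<dots> = (CLINT y|lborel. CLINT x|lborel. b x y * G y * K x)"
    by (rule lborel_pair.Fubini_integral[OF I, symmetric])
  also have "\<dots> = (CLINT y|lborel. (CLINT x|lborel. b x y * K x) * G y)"
    by (simp add: mult.assoc mult.commute[of "G _"]) (simp add: mult.assoc[symmetric])
  finally show ?thesis .
qed

text \<open>The pseudo-variance \<open>E (V\<^sup>2)\<close> equals \<open>\<integral> p(l) F(l) F(-l) dl\<close> with \<open>F\<close> the Fourier transform of the kernel;
  analyticity makes one of the factors \<open>F(l)\<close>, \<open>F(-l)\<close> vanish.\<close>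

lemma analytic_transform_circ:
  assumes K: "analytic_kernel K"
  shows "circ_gauss P (\<lambda>x. CLINT \<tau>|lborel. complex_of_real (Phi \<tau> x) * K \<tau>)"
proof -
  define V where "V x = (CLINT \<tau>|lborel. complex_of_real (Phi \<tau> x) * K \<tau>)" for x
  have Ki: "integrable lborel K" and K0: "\<And>l. l \<le> 0 \<Longrightarrow> (CLINT \<tau>|lborel. iexp (\<tau> * l) * K \<tau>) = 0"
    using K by (auto simp: analytic_kernel_def)
  have [measurable]: "K \<in> borel_measurable borel" using Ki borel_measurable_integrable by force
  have KK: "(CLINT \<tau>|lborel. K \<tau>) = 0" using K0[of 0] by simp
  have cm: "(\<lambda>(\<tau>, x). complex_of_real (Phi \<tau> x)) \<in> borel_measurable (lborel \<Otimes>\<^sub>M P)"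
    using measurable_compose[OF joint borel_measurable_of_real] by (simp add: split_beta')
  have ci: "integrable P (\<lambda>x. complex_of_real (Phi \<tau> x))" for \<tau>
    using integrable_of_real[OF Phi_integrable] .
  have cL: "(LINT x|P. norm (complex_of_real (Phi \<tau> x))) \<le> sqrt power0" for \<tau> using Phi_L1 by simp
  note KI = kernel_integral[OF cm ci cL Ki, folded V_def]
  have [measurable]: "V \<in> borel_measurable P" using KI(2) by (rule borel_measurable_integrable)
  have reKI: "mean0 * (LINT \<tau>|lborel. Re (K \<tau>)) = 0" "mean0 * (LINT \<tau>|lborel. Im (K \<tau>)) = 0"
    using integral_Re[OF Ki] integral_Im[OF Ki] KK by simp_all
  obtain v1 where v1: "cgauss P (\<lambda>x. LINT \<tau>|lborel. Phi \<tau> x * Re (K \<tau>)) v1"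
    using kernel_integral_gaussian[OF integrable_Re[OF Ki] reKI(1)] by blast
  obtain v2 where v2: "cgauss P (\<lambda>x. LINT \<tau>|lborel. Phi \<tau> x * Im (K \<tau>)) v2"
    using kernel_integral_gaussian[OF integrable_Im[OF Ki] reKI(2)] by blast
  have g1: "cgauss P (\<lambda>x. Re (V x)) v1"
  proof (rule cgauss_cong_AE[OF v1])
    show "AE x in P. (LINT \<tau>|lborel. Phi \<tau> x * Re (K \<tau>)) = Re (V x)"
      using KI(1) by eventually_elim (simp add: V_def flip: integral_Re)
  qed simp
  have g2: "cgauss P (\<lambda>x. Im (V x)) v2"
  proof (rule cgauss_cong_AE[OF v2])
    show "AE x in P. (LINT \<tau>|lborel. Phi \<tau> x * Im (K \<tau>)) = Im (V x)"
      using KI(1) by eventually_elim (simp add: V_def flip: integral_Im)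
  qed simp
  have V2: "integrable P (\<lambda>x. (norm (V x))\<^sup>2)"
    using cgauss_integrable_square[OF g1] cgauss_integrable_square[OF g2] by (simp add: cmod_power2)
  define F where "F l = (CLINT \<tau>|lborel. iexp (\<tau> * l) * K \<tau>)" for l
  have F0: "F l = 0" if "l \<le> 0" for l using K0[OF that] by (simp add: F_def)
  have Fm[measurable]: "F \<in> borel_measurable borel" unfolding F_def by measurable
  have Fb: "norm (F l) \<le> (LINT \<tau>|lborel. norm (K \<tau>))" for l
  proof -
    have "norm (F l) \<le> (LINT \<tau>|lborel. norm (iexp (\<tau> * l) * K \<tau>))" unfolding F_def by (rule integral_norm_bound)
    then show ?thesis by (simp add: norm_mult)
  qed
  have pi: "integrable lborel p" using spectral by (simp add: has_spectral_density_def)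
  then have pc: "integrable lborel (\<lambda>l. complex_of_real (p l))" by (rule integrable_of_real)
  have [measurable]: "p \<in> borel_measurable borel" using pi borel_measurable_integrable by force
  have pF: "integrable lborel (\<lambda>l. F l * complex_of_real (p l))"
  proof (rule Bochner_Integration.integrable_bound)
    show "integrable lborel (\<lambda>l. (LINT \<tau>|lborel. norm (K \<tau>)) * norm (complex_of_real (p l)))" using integrable_norm[OF pc] by (rule integrable_mult_right)
    show "AE l in lborel. norm (F l * complex_of_real (p l)) \<le> norm ((LINT \<tau>|lborel. norm (K \<tau>)) * norm (complex_of_real (p l)))"
    proof (rule AE_I2)
      fix l
      have "norm (F l * complex_of_real (p l)) \<le> (LINT \<tau>|lborel. norm (K \<tau>)) * norm (complex_of_real (p l))"
        unfolding norm_mult by (rule mult_right_mono[OF Fb]) simp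
      also have "\<dots> \<le> norm \<dots>" by simp
      finally show "norm (F l * complex_of_real (p l)) \<le> norm ((LINT \<tau>|lborel. norm (K \<tau>)) * norm (complex_of_real (p l)))" .
    qed
  qed measurable
  \<comment> \<open>The pseudo-variance is computed in two stages. Correlating \<open>V\<close> with
    a single value of the process expresses one kernel by its transform \<open>F l\<close>;
    integrating the result against \<open>K \<sigma>\<close> produces the other factor
    \<open>F (- l)\<close>.\<close>
  have c: "(CLINT x|P. V x * complex_of_real (Phi \<sigma> x)) = (CLINT l|lborel. iexp (\<sigma> * (- l)) * (F l * complex_of_real (p l)))" for \<sigma>
  proof -
    have m: "(\<lambda>(\<tau>, x). complex_of_real (Phi \<tau> x * Phi \<sigma> x)) \<in> borel_measurable (lborel \<Otimes>\<^sub>M P)"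
    proof -
      have "(\<lambda>x. complex_of_real (Phi (fst x) (snd x) * Phi \<sigma> (snd x))) \<in> borel_measurable (lborel \<Otimes>\<^sub>M P)"
        using joint by (intro measurable_compose[OF _ borel_measurable_of_real] borel_measurable_times) (simp_all add: split_beta')
      then show ?thesis by (simp add: split_beta')
    qed
    have i: "integrable P (\<lambda>x. complex_of_real (Phi \<tau> x * Phi \<sigma> x))" for \<tau> by (rule integrable_of_real[OF Phi_product])
    have B: "(LINT x|P. norm (complex_of_real (Phi \<tau> x * Phi \<sigma> x))) \<le> 2 * power0" for \<tau>
    proof -
      have "(LINT x|P. norm (complex_of_real (Phi \<tau> x * Phi \<sigma> x))) \<le> (LINT x|P. (Phi \<tau> x)\<^sup>2 + (Phi \<sigma> x)\<^sup>2)"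
      proof (rule integral_mono[OF integrable_norm[OF i]])
        fix x
        have "2 * (\<bar>Phi \<tau> x\<bar> * \<bar>Phi \<sigma> x\<bar>) \<le> (Phi \<tau> x)\<^sup>2 + (Phi \<sigma> x)\<^sup>2"
          using sum_squares_bound[of "\<bar>Phi \<tau> x\<bar>" "\<bar>Phi \<sigma> x\<bar>"] by (simp add: mult.assoc)
        moreover have "0 \<le> \<bar>Phi \<tau> x\<bar> * \<bar>Phi \<sigma> x\<bar>" by simp
        ultimately show "norm (complex_of_real (Phi \<tau> x * Phi \<sigma> x)) \<le> (Phi \<tau> x)\<^sup>2 + (Phi \<sigma> x)\<^sup>2"
          unfolding norm_of_real abs_mult by linarith
      qed (use Phi_square in simp)
      then show ?thesis using Phi_square by (simp add: Phi_power)
    qed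
    have "(CLINT x|P. V x * complex_of_real (Phi \<sigma> x))
        = (CLINT x|P. CLINT \<tau>|lborel. complex_of_real (Phi \<tau> x * Phi \<sigma> x) * K \<tau>)"
      unfolding V_def by (simp add: mult.commute[of _ "complex_of_real (Phi \<sigma> _)"] mult.assoc)
    also have "\<dots> = (CLINT \<tau>|lborel. complex_of_real (LINT x|P. Phi \<tau> x * Phi \<sigma> x) * K \<tau>)"
      by (simp only: kernel_integral(3)[OF m i B Ki] integral_complex_of_real)
    also have "\<dots> = (CLINT \<tau>|lborel. mean0\<^sup>2 * K \<tau> + (CLINT l|lborel. iexp ((\<tau> - \<sigma>) * l) * complex_of_real (p l)) * K \<tau>)"
      unfolding Phi_correlation by (simp add: distrib_right)
    also have "\<dots> = (CLINT \<tau>|lborel. mean0\<^sup>2 * K \<tau>) + (CLINT \<tau>|lborel. (CLINT l|lborel. iexp ((\<tau> - \<sigma>) * l) * complex_of_real (p l)) * K \<tau>)"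
    proof (rule Bochner_Integration.integral_add)
      show "integrable lborel (\<lambda>\<tau>. (CLINT l|lborel. iexp ((\<tau> - \<sigma>) * l) * complex_of_real (p l)) * K \<tau>)"
      proof (rule Bochner_Integration.integrable_bound)
        show "integrable lborel (\<lambda>\<tau>. (LINT l|lborel. norm (complex_of_real (p l))) * norm (K \<tau>))"
          using integrable_norm[OF Ki] by (rule integrable_mult_right)
        have "norm (CLINT l|lborel. iexp ((\<tau> - \<sigma>) * l) * complex_of_real (p l)) \<le> (LINT l|lborel. norm (complex_of_real (p l)))" for \<tau>
        proof -
          have "norm (CLINT l|lborel. iexp ((\<tau> - \<sigma>) * l) * complex_of_real (p l))
             \<le> (LINT l|lborel. norm (iexp ((\<tau> - \<sigma>) * l) * complex_of_real (p l)))" by (rule integral_norm_bound)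
          then show ?thesis by (simp add: norm_mult)
        qed
        then have "norm ((CLINT l|lborel. iexp ((\<tau> - \<sigma>) * l) * complex_of_real (p l)) * K \<tau>)
            \<le> (LINT l|lborel. norm (complex_of_real (p l))) * norm (K \<tau>)" for \<tau>
          unfolding norm_mult by (rule mult_right_mono) simp
        then show "AE \<tau> in lborel. norm ((CLINT l|lborel. iexp ((\<tau> - \<sigma>) * l) * complex_of_real (p l)) * K \<tau>)
            \<le> norm ((LINT l|lborel. norm (complex_of_real (p l))) * norm (K \<tau>))"
          unfolding real_norm_def by (intro AE_I2 order.trans[OF _ abs_ge_self])
      qed measurable
    qed (use Ki in simp)
    also have "(CLINT \<tau>|lborel. mean0\<^sup>2 * K \<tau>) = 0" using KK by simp
    also have "(CLINT \<tau>|lborel. (CLINT l|lborel. iexp ((\<tau> - \<sigma>) * l) * complex_of_real (p l)) * K \<tau>)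
       = (CLINT l|lborel. (CLINT \<tau>|lborel. iexp ((\<tau> - \<sigma>) * l) * K \<tau>) * complex_of_real (p l))"
      by (rule Fubini_bounded_lborel[OF Ki pc]) auto
    also have "\<dots> = (CLINT l|lborel. iexp (\<sigma> * (- l)) * (F l * complex_of_real (p l)))"
    proof -
      have e: "iexp ((\<tau> - \<sigma>) * l) = iexp (\<sigma> * (- l)) * iexp (\<tau> * l)" for \<tau> l
        unfolding exp_add[symmetric] by (simp add: algebra_simps)
      show ?thesis unfolding e F_def by (simp add: mult.assoc)
    qed
    finally show ?thesis by simp
  qed
  have VPi: "integrable P (\<lambda>x. V x * complex_of_real (Phi \<sigma> x))"
    and VPL: "(LINT x|P. norm (V x * complex_of_real (Phi \<sigma> x))) \<le> (LINT x|P. (norm (V x))\<^sup>2) + power0" for \<sigma>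
  proof -
    have b: "norm (V x * complex_of_real (Phi \<sigma> x)) \<le> (norm (V x))\<^sup>2 + (Phi \<sigma> x)\<^sup>2" for x
    proof -
      have "2 * (norm (V x) * \<bar>Phi \<sigma> x\<bar>) \<le> (norm (V x))\<^sup>2 + (Phi \<sigma> x)\<^sup>2"
        using sum_squares_bound[of "norm (V x)" "\<bar>Phi \<sigma> x\<bar>"] by (simp add: mult.assoc)
      moreover have "0 \<le> norm (V x) * \<bar>Phi \<sigma> x\<bar>" by simp
      ultimately show ?thesis unfolding norm_mult norm_of_real by linarith
    qed
    show i: "integrable P (\<lambda>x. V x * complex_of_real (Phi \<sigma> x))"
    proof (rule Bochner_Integration.integrable_bound)
      show "integrable P (\<lambda>x. (norm (V x))\<^sup>2 + (Phi \<sigma> x)\<^sup>2)" using V2 Phi_square by simp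
    qed (use b in \<open>auto intro!: AE_I2 order.trans[OF _ abs_ge_self]\<close>)
    have "(LINT x|P. norm (V x * complex_of_real (Phi \<sigma> x))) \<le> (LINT x|P. (norm (V x))\<^sup>2 + (Phi \<sigma> x)\<^sup>2)"
      by (rule integral_mono[OF integrable_norm[OF i] _ b]) (use V2 Phi_square in simp)
    then show "(LINT x|P. norm (V x * complex_of_real (Phi \<sigma> x))) \<le> (LINT x|P. (norm (V x))\<^sup>2) + power0"
      using V2 Phi_square by (simp add: Phi_power)
  qed
  have Vm: "(\<lambda>(\<sigma>, x). V x * complex_of_real (Phi \<sigma> x)) \<in> borel_measurable (lborel \<Otimes>\<^sub>M P)"
    using cm unfolding split_beta' by (intro borel_measurable_times) auto
  have "(CLINT x|P. V x * V x) = (CLINT x|P. CLINT \<sigma>|lborel. (V x * complex_of_real (Phi \<sigma> x)) * K \<sigma>)"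
    unfolding V_def by (simp add: mult.assoc)
  also have "\<dots> = (CLINT \<sigma>|lborel. (CLINT x|P. V x * complex_of_real (Phi \<sigma> x)) * K \<sigma>)"
    by (rule kernel_integral(3)[OF Vm VPi VPL Ki])
  also have "\<dots> = (CLINT \<sigma>|lborel. (CLINT l|lborel. iexp (\<sigma> * (- l)) * (F l * complex_of_real (p l))) * K \<sigma>)"
    unfolding c ..
  also have "\<dots> = (CLINT l|lborel. (CLINT \<sigma>|lborel. iexp (\<sigma> * (- l)) * K \<sigma>) * (F l * complex_of_real (p l)))"
    by (rule Fubini_bounded_lborel[OF Ki pF]) auto
  also have "\<dots> = (CLINT l|lborel. F (- l) * (F l * complex_of_real (p l)))" unfolding F_def ..
  also have "\<dots> = (CLINT l::real|lborel. 0)"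
  proof (rule Bochner_Integration.integral_cong[OF refl])
    show "F (- l) * (F l * complex_of_real (p l)) = 0" for l
      by (cases "l \<le> 0") (auto simp: F0)
  qed
  finally have VV: "(CLINT x|P. V x * V x) = 0" by simp
  have VVi: "integrable P (\<lambda>x. V x * V x)"
    by (rule Bochner_Integration.integrable_bound[OF V2]) (auto simp: norm_mult power2_eq_square)
  \<comment> \<open>The real part of the pseudo-variance is the difference of the variances of the
    real and imaginary parts.\<close>
  have "0 = Re (CLINT x|P. V x * V x)" unfolding VV by simp
  also have "\<dots> = (LINT x|P. (Re (V x))\<^sup>2 - (Im (V x))\<^sup>2)"
    unfolding integral_Re[OF VVi, symmetric] by (simp add: power2_eq_square)
  also have "\<dots> = v1 - v2"
    using cgauss_integrable_square[OF g1] cgauss_integrable_square[OF g2] cgauss_second_moment[OF g1] cgauss_second_moment[OF g2]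
    by simp
  finally have "v1 = v2" by simp
  then show ?thesis using g1 g2 unfolding circ_gauss_def V_def by blast
qed

text \<open>Substituting \<open>t + s * x\<close> for the time turns the transform of the kernel at
  \<open>l\<close> into a multiple of the conjugate of \<open>fourier psi (s * l)\<close>, and
  \<open>s * l \<le> 0\<close> whenever \<open>l \<le> 0\<close>.\<close>

lemma wavelet_kernel_analytic:
  assumes psi: "integrable lborel psi" and an: "\<And>l. l \<le> 0 \<Longrightarrow> fourier psi l = 0" and s: "0 < s"
  shows "analytic_kernel (\<lambda>\<tau>. of_real (1 / s) * cnj (psi ((\<tau> - t) / s)))"
  unfolding analytic_kernel_def
proof (intro conjI allI impI)
  have "integrable lborel (\<lambda>\<tau>. psi (- t / s + (1 / s) * \<tau>))"
    by (rule lborel_integrable_real_affine[OF psi]) (use s in simp)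
  moreover have "- t / s + (1 / s) * \<tau> = (\<tau> - t) / s" for \<tau> by (simp add: diff_divide_distrib)
  ultimately show "integrable lborel (\<lambda>\<tau>. of_real (1 / s) * cnj (psi ((\<tau> - t) / s)))"
    by (intro integrable_mult_right integrable_cnj) simp
  fix l :: real assume l: "l \<le> 0"
  have e: "iexp ((t + s * x) * l) * (of_real (1 / s) * cnj (psi ((t + s * x - t) / s)))
      = (iexp (t * l) * of_real (1 / s)) * cnj (exp (- (\<i> * of_real (x * (s * l)))) * psi x)" for x
  proof -
    have "iexp ((t + s * x) * l) = iexp (t * l) * cnj (exp (- (\<i> * of_real (x * (s * l)))))"
      unfolding exp_cnj exp_add[symmetric] by (simp add: algebra_simps)
    then show ?thesis using s by simp
  qed
  have "(CLINT \<tau>|lborel. iexp (\<tau> * l) * (of_real (1 / s) * cnj (psi ((\<tau> - t) / s))))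
     = \<bar>s\<bar> *\<^sub>R (CLINT x|lborel. iexp ((t + s * x) * l) * (of_real (1 / s) * cnj (psi ((t + s * x - t) / s))))"
    by (rule lborel_integral_real_affine) (use s in simp)
  also have "\<dots> = \<bar>s\<bar> *\<^sub>R ((iexp (t * l) * of_real (1 / s)) * cnj (fourier psi (s * l)))"
    unfolding e fourier_def integral_mult_right_zero Bochner_Integration.integral_cnj ..
  also have "fourier psi (s * l) = 0" using s l by (intro an) (simp add: mult_nonneg_nonpos)
  finally show "(CLINT \<tau>|lborel. iexp (\<tau> * l) * (of_real (1 / s) * cnj (psi ((\<tau> - t) / s)))) = 0" by simp
qed

text \<open>A linear combination of transforms at different scales is almost surely the transform by
  one combined kernel, again analytic. \<open>W\<close> agrees with the pathwise integrals outside a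
  null set for each scale; finitely many scales allow a common one.\<close>

lemma awt_circ_family:
  assumes psi: "integrable lborel psi" and an: "\<And>l. l \<le> 0 \<Longrightarrow> fourier psi l = 0" and W: "awt_version P psi Phi W"
  shows "circ_family P {0<..} (W t)"
  unfolding circ_family_def
proof (intro allI impI)
  fix n :: nat and s :: "nat \<Rightarrow> real" and c :: "nat \<Rightarrow> complex"
  assume s: "\<forall>i<n. s i \<in> {0<..}"
  define K where "K i \<tau> = of_real (1 / s i) * cnj (psi ((\<tau> - t) / s i))" for i \<tau>
  have K: "analytic_kernel (K i)" if "i < n" for i
    using wavelet_kernel_analytic[OF psi an, of "s i" t] s that by (simp add: K_def[abs_def])
  have cK: "analytic_kernel (\<lambda>\<tau>. \<Sum>i<n. c i * K i \<tau>)"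
    by (intro analytic_kernel_sum analytic_kernel_scale K)
  have cm: "(\<lambda>(\<tau>, x). complex_of_real (Phi \<tau> x)) \<in> borel_measurable (lborel \<Otimes>\<^sub>M P)"
    using measurable_compose[OF joint borel_measurable_of_real] by (simp add: split_beta')
  have cL: "(LINT x|P. norm (complex_of_real (Phi \<tau> x))) \<le> sqrt power0" for \<tau> using Phi_L1 by simp
  have i: "AE x in P. integrable lborel (\<lambda>\<tau>. complex_of_real (Phi \<tau> x) * K i \<tau>)" if "i < n" for i
    by (rule kernel_integral(1)[OF cm integrable_of_real[OF Phi_integrable] cL]) (use K[OF that] in \<open>simp add: analytic_kernel_def\<close>)
  have W1: "W t (s i) \<in> borel_measurable P" "AE x in P. W t (s i) x = (CLINT \<tau>|lborel. complex_of_real (Phi \<tau> x) * K i \<tau>)" if "i < n" for i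
    using W s that unfolding awt_version_def awt_def awt_integrand_def K_def by (auto simp: mult.assoc)
  have ae: "AE x in P. \<forall>i\<in>{..<n}. integrable lborel (\<lambda>\<tau>. complex_of_real (Phi \<tau> x) * K i \<tau>)
      \<and> W t (s i) x = (CLINT \<tau>|lborel. complex_of_real (Phi \<tau> x) * K i \<tau>)"
    by (rule AE_finite_allI) (use i W1(2) in auto)
  show "circ_gauss P (\<lambda>x. \<Sum>i<n. c i * W t (s i) x)"
  proof (rule circ_gauss_cong_AE[OF analytic_transform_circ[OF cK]])
    show "(\<lambda>x. \<Sum>i<n. c i * W t (s i) x) \<in> borel_measurable P"
      using W1(1) by (intro borel_measurable_sum borel_measurable_times) auto
    show "AE x in P. (CLINT \<tau>|lborel. complex_of_real (Phi \<tau> x) * (\<Sum>i<n. c i * K i \<tau>)) = (\<Sum>i<n. c i * W t (s i) x)"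
      using ae
    proof eventually_elim
      case (elim x)
      have "(CLINT \<tau>|lborel. complex_of_real (Phi \<tau> x) * (\<Sum>i<n. c i * K i \<tau>))
        = (CLINT \<tau>|lborel. (\<Sum>i<n. c i * (complex_of_real (Phi \<tau> x) * K i \<tau>)))"
        by (simp add: sum_distrib_left mult.left_commute)
      also have "\<dots> = (\<Sum>i<n. (CLINT \<tau>|lborel. c i * (complex_of_real (Phi \<tau> x) * K i \<tau>)))"
        by (rule Bochner_Integration.integral_sum) (use elim in auto)
      also have "\<dots> = (\<Sum>i<n. c i * W t (s i) x)" using elim by (intro sum.cong) auto
      finally show ?case .
    qed
  qed
qed

end

section \<open>Circularity of the scale derivative\<close>

lemma sum_lessThan_double: "(\<Sum>i<n + n. f i) = (\<Sum>i<n. f i) + (\<Sum>i<n. f (n + i))" for n :: nat and f :: "nat \<Rightarrow> complex"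
proof -
  have "(\<Sum>i<k + n. f i) = (\<Sum>i<k. f i) + (\<Sum>i<n. f (k + i))" for k
    by (induction n) (simp_all add: add.assoc)
  then show ?thesis by blast
qed

text \<open>A combination of \<open>n\<close> derivatives is a pointwise limit of combinations of
  \<open>2 * n\<close> members of the family, by difference quotients.\<close>

lemma (in prob_space) circ_family_derivative:
  fixes g :: "real \<Rightarrow> 'a \<Rightarrow> complex"
  assumes g: "circ_family M {0<..} g"
    and d: "\<And>x s. x \<in> space M \<Longrightarrow> 0 < s \<Longrightarrow> ((\<lambda>s. g s x) has_vector_derivative g' s x) (at s)"
  shows "circ_family M {0<..} g'"
  unfolding circ_family_def
proof (intro allI impI)
  fix n :: nat and s :: "nat \<Rightarrow> real" and c :: "nat \<Rightarrow> complex"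
  assume s: "\<forall>i<n. s i \<in> {0<..}"
  define h where "h k = inverse (real (Suc k))" for k
  have h: "0 < h k" for k by (simp add: h_def)
  show "circ_gauss M (\<lambda>x. \<Sum>i<n. c i * g' (s i) x)"
  proof (rule circ_gauss_limit)
    fix k
    \<comment> \<open>Indices below \<open>n\<close> carry the shifted scales, the next
      \<open>n\<close> the original scales with the opposite coefficients.\<close>
    let ?s = "\<lambda>i. if i < n then s i + h k else s (i - n)"
    let ?c = "\<lambda>i. if i < n then c i / h k else - (c (i - n) / h k)"
    have "circ_gauss M (\<lambda>x. \<Sum>i<n + n. ?c i * g (?s i) x)"
      by (rule circ_familyD[OF g]) (use s h in \<open>auto simp: add_pos_pos\<close>)
    moreover have "(\<Sum>i<n + n. ?c i * g (?s i) x) = (\<Sum>i<n. c i * ((g (s i + h k) x - g (s i) x) / h k))" for x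
      unfolding sum_lessThan_double sum.distrib[symmetric]
      by (intro sum.cong) (auto simp: diff_divide_distrib right_diff_distrib)
    ultimately show "circ_gauss M (\<lambda>x. \<Sum>i<n. c i * ((g (s i + h k) x - g (s i) x) / h k))" by simp
  next
    fix x assume x: "x \<in> space M"
    have "(\<lambda>k. (g (s i + h k) x - g (s i) x) / h k) \<longlonglongrightarrow> g' (s i) x" if "i < n" for i
    proof -
      have "((\<lambda>y. norm (g (s i + y) x - g (s i) x - y *\<^sub>R g' (s i) x) / norm y) \<longlongrightarrow> 0) (at 0)"
        using d[OF x, of "s i"] s that by (simp add: has_vector_derivative_def has_derivative_at)
      moreover have "filterlim h (at 0) sequentially"
        unfolding filterlim_at using LIMSEQ_inverse_real_of_nat by (auto simp: h_def[abs_def])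
      ultimately have l: "(\<lambda>k. norm (g (s i + h k) x - g (s i) x - h k *\<^sub>R g' (s i) x) / norm (h k)) \<longlonglongrightarrow> 0"
        by (rule filterlim_compose)
      have e: "norm (g (s i + h k) x - g (s i) x - h k *\<^sub>R g' (s i) x) / norm (h k)
          = norm ((g (s i + h k) x - g (s i) x) / h k - g' (s i) x)" for k
      proof -
        have "(g (s i + h k) x - g (s i) x) / h k - g' (s i) x = (g (s i + h k) x - g (s i) x - h k *\<^sub>R g' (s i) x) / complex_of_real (h k)"
          using h[of k] unfolding scaleR_conv_of_real diff_divide_distrib by simp
        then show ?thesis by (simp add: norm_divide)
      qed
      show ?thesis using l unfolding e by (rule LIM_zero_cancel[OF tendsto_norm_zero_cancel])
    qed
    then show "(\<lambda>k. \<Sum>i<n. c i * ((g (s i + h k) x - g (s i) x) / h k)) \<longlonglongrightarrow> (\<Sum>i<n. c i * g' (s i) x)"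
      by (intro tendsto_sum tendsto_mult tendsto_const) auto
  qed
qed

section \<open>Ridge points under perturbation\<close>

lemma circ_family_mono: "circ_family P S g \<Longrightarrow> T \<subseteq> S \<Longrightarrow> circ_family P T g"
  unfolding circ_family_def by blast

lemma norm_power2_has_derivative:
  fixes u :: "real \<Rightarrow> complex"
  assumes "(u has_vector_derivative u') (at s)"
  shows "((\<lambda>s. (norm (u s))\<^sup>2) has_real_derivative 2 * (u s \<bullet> u')) (at s)"
proof -
  have "((\<lambda>s. u s \<bullet> u s) has_vector_derivative (u s \<bullet> u' + u' \<bullet> u s)) (at s)"
    by (rule bounded_bilinear.has_vector_derivative[OF bounded_bilinear_inner assms assms])
  then show ?thesis
    by (simp add: has_real_derivative_iff_has_vector_derivative power2_norm_eq_inner inner_commute)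
qed

text \<open>A maximum at an endpoint of the band still determines the sign of the derivative there, and it is
  the sign opposite to that of \<open>F' y\<close>. Hence the noise terms have to be large whether \<open>y\<close> is an
  interior maximum or an endpoint.\<close>

lemma perturbed_ridge:
  fixes u w :: "real \<Rightarrow> complex" and F' F'' :: "real \<Rightarrow> real"
  assumes u: "\<And>s. s \<in> {a..b} \<Longrightarrow> (u has_vector_derivative u' s) (at s)"
    and w: "\<And>s. s \<in> {a..b} \<Longrightarrow> (w has_vector_derivative w' s) (at s)"
    and F': "\<And>s. s \<in> {a..b} \<Longrightarrow> ((\<lambda>s. (norm (u s))\<^sup>2) has_real_derivative F' s) (at s)"
    and F'': "\<And>s. s \<in> {a..b} \<Longrightarrow> (F' has_real_derivative F'' s) (at s)" and cF: "continuous_on {a..b} F''"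
    and L: "0 < L" "\<And>s. s \<in> {a..b} \<Longrightarrow> L \<le> \<bar>F'' s\<bar>"
    and r: "r \<in> {a..b}" "F' r = 0" "F'' r < 0"
    and y: "y \<in> {a..b}" "\<And>s. s \<in> {a..b} \<Longrightarrow> (norm (u s + w s))\<^sup>2 \<le> (norm (u y + w y))\<^sup>2"
  shows "L * \<bar>y - r\<bar> \<le> 2 * (norm (u' y * w y) + norm (u y * w' y) + norm (w y) * norm (w' y))"
proof -
  \<comment> \<open>\<open>F''\<close> is continuous and bounded away from \<open>0\<close> in
    modulus, so it keeps on the whole band the sign that it has at the ridge point.\<close>
  have neg: "F'' s \<le> - L" if s: "s \<in> {a..b}" for s
  proof (rule ccontr)
    assume c: "\<not> F'' s \<le> - L"
    then have "0 < F'' s" using L(2)[OF s] L(1) by linarith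
    have "connected (F'' ` {a..b})" using cF by (intro connected_continuous_image) auto
    then have "0 \<in> F'' ` {a..b}"
      using connected_contains_Icc[of "F'' ` {a..b}" "F'' r" "F'' s"] r s \<open>0 < F'' s\<close> by force
    then show False using L by force
  qed
  have mvt: "\<exists>z\<in>{a..b}. F' q - F' p = (q - p) * F'' z" if "p < q" "p \<in> {a..b}" "q \<in> {a..b}" for p q
  proof -
    have "\<exists>z. p < z \<and> z < q \<and> F' q - F' p = (q - p) * F'' z"
      by (rule MVT2[OF that(1)]) (use that F'' in auto)
    then show ?thesis using that by force
  qed
  define N where "N = 2 * (u y \<bullet> w' y + w y \<bullet> u' y + w y \<bullet> w' y)"
  have Fy: "F' y = 2 * (u y \<bullet> u' y)"
    by (rule DERIV_unique[OF F'[OF y(1)] norm_power2_has_derivative[OF u[OF y(1)]]])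
  have G: "((\<lambda>s. (norm (u s + w s))\<^sup>2) has_real_derivative F' y + N) (at y)"
  proof -
    have "((\<lambda>s. u s + w s) has_vector_derivative (u' y + w' y)) (at y)"
      by (intro has_vector_derivative_add u w y)
    from norm_power2_has_derivative[OF this] show ?thesis
      by (simp add: Fy N_def inner_add_left inner_add_right algebra_simps)
  qed
  have left: "0 \<le> F' y + N" if "a < y"
  proof (rule ccontr)
    assume "\<not> 0 \<le> F' y + N"
    then obtain d where d: "0 < d" "\<And>h. 0 < h \<Longrightarrow> h < d \<Longrightarrow> (norm (u y + w y))\<^sup>2 < (norm (u (y - h) + w (y - h)))\<^sup>2"
      using DERIV_neg_dec_left[OF G] by auto
    define h where "h = min (d / 2) (y - a)"
    have "0 < h" "h < d" "y - h \<in> {a..b}" using d(1) that y(1) by (auto simp: h_def min_def)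
    then show False using d(2)[of h] y(2)[of "y - h"] by linarith
  qed
  have right: "F' y + N \<le> 0" if "y < b"
  proof (rule ccontr)
    assume "\<not> F' y + N \<le> 0"
    then obtain d where d: "0 < d" "\<And>h. 0 < h \<Longrightarrow> h < d \<Longrightarrow> (norm (u y + w y))\<^sup>2 < (norm (u (y + h) + w (y + h)))\<^sup>2"
      using DERIV_pos_inc_right[OF G] by auto
    define h where "h = min (d / 2) (b - y)"
    have "0 < h" "h < d" "y + h \<in> {a..b}" using d(1) that y(1) by (auto simp: h_def min_def)
    then show False using d(2)[of h] y(2)[of "y + h"] by linarith
  qed
  have "L * \<bar>y - r\<bar> \<le> \<bar>N\<bar>"
  proof (cases y r rule: linorder_cases)
    case less
    obtain z where z: "z \<in> {a..b}" "F' r - F' y = (r - y) * F'' z" using mvt[OF less y(1) r(1)] by blast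
    have "(r - y) * F'' z \<le> (r - y) * (- L)" using less neg[OF z(1)] by (intro mult_left_mono) auto
    then have "L * (r - y) \<le> F' y" using z(2) r(2) by (simp add: mult.commute)
    moreover have "F' y + N \<le> 0" using less r(1) by (intro right) auto
    ultimately show ?thesis using less by (simp add: abs_if)
  next
    case equal
    then show ?thesis by simp
  next
    case greater
    obtain z where z: "z \<in> {a..b}" "F' y - F' r = (y - r) * F'' z" using mvt[OF greater r(1) y(1)] by blast
    have "(y - r) * F'' z \<le> (y - r) * (- L)" using greater neg[OF z(1)] by (intro mult_left_mono) auto
    then have "L * (y - r) \<le> - F' y" using z(2) r(2) by (simp add: mult.commute)
    moreover have "0 \<le> F' y + N" using greater r(1) by (intro left) auto
    ultimately show ?thesis using greater by (simp add: abs_if)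
  qed
  also have "\<bar>N\<bar> \<le> 2 * (\<bar>u y \<bullet> w' y\<bar> + \<bar>w y \<bullet> u' y\<bar> + \<bar>w y \<bullet> w' y\<bar>)"
    unfolding N_def abs_mult using abs_triangle_ineq[of "u y \<bullet> w' y + w y \<bullet> u' y" "w y \<bullet> w' y"]
      abs_triangle_ineq[of "u y \<bullet> w' y" "w y \<bullet> u' y"] by simp
  also have "\<dots> \<le> 2 * (norm (u y) * norm (w' y) + norm (w y) * norm (u' y) + norm (w y) * norm (w' y))"
    by (intro mult_left_mono add_mono Cauchy_Schwarz_ineq2) auto
  finally show ?thesis by (simp add: norm_mult mult.commute add.commute)
qed

text \<open>Since \<open>(S - q) / (1 - q) \<le> S\<close> for \<open>S \<le> 1\<close>, conditioning costs nothing when \<open>S\<close> also pays for the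
  complement of the conditioning event.\<close>

lemma conditional_le:
  fixes x y S :: real
  assumes "0 \<le> x" "x \<le> y" "y \<le> 1" "x + (1 - y) \<le> S"
  shows "x / y \<le> S"
\<comment> \<open>For \<open>y = 0\<close> the quotient has the value \<open>0\<close>, and a bound
  of at least \<open>1\<close> is trivial. Otherwise \<open>x \<le> S - 1 + y\<close>, and this is
  at most \<open>S * y\<close> since both \<open>1 - S\<close> and \<open>1 - y\<close> are
  nonnegative.\<close>
proof (cases "y = 0 \<or> 1 \<le> S")
  case True
  then show ?thesis
  proof
    assume "1 \<le> S"
    have "x / y \<le> 1" using assms by (cases "y = 0") (auto simp: field_simps)
    then show ?thesis using \<open>1 \<le> S\<close> by linarith
  qed (use assms in auto)
next
  case False
  have "0 \<le> (1 - S) * (1 - y)" using False assms by (intro mult_nonneg_nonneg) auto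
  then have "x \<le> S * y" using assms by (simp add: algebra_simps)
  then show ?thesis using False assms by (simp add: field_simps)
qed

lemma C1_differentiable_onD:
  fixes g :: "real \<Rightarrow> 'a::euclidean_space"
  assumes "g C1_differentiable_on S"
  shows "\<And>s. s \<in> S \<Longrightarrow> (g has_vector_derivative vector_derivative g (at s)) (at s)"
    and "continuous_on S (\<lambda>s. vector_derivative g (at s))" and "continuous_on S g"
  using assms
  by (auto simp: C1_differentiable_on_eq vector_derivative_works C1_differentiable_imp_continuous_on)

section \<open>Deviation of the noisy ridge point inside its band\<close>

theorem theorem4:
  fixes P :: "'w measure"
    and Phi :: "real \<Rightarrow> 'w \<Rightarrow> real" and p :: "real \<Rightarrow> real"
    and psi :: "real \<Rightarrow> complex" and W :: "real \<Rightarrow> real \<Rightarrow> 'w \<Rightarrow> complex"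
    and eps0 delta :: real and N :: nat and A phi :: "nat \<Rightarrow> real \<Rightarrow> real" and f :: "real \<Rightarrow> real"
    and lo hi sf :: "nat \<Rightarrow> real \<Rightarrow> real" and sY :: "'w \<Rightarrow> real"
    and m :: nat and t ilo ihi eps L Delta mu sigma :: real
    and B dB :: "real set" and mu_m sigma2_m :: "nat \<Rightarrow> real"
  assumes "prob_space P"
    and "adaptive_harmonic_model eps0 delta N A phi f"
    and "noise_conditions P Phi p"
    and "regular_analytic_wavelet psi"
    and "awt_regular psi f"
    and "awt_version P psi Phi W"
    and "scale_bands psi N phi lo hi"
    and "ridge_points (scalogram psi f) N lo hi sf"
    and "m \<in> {1..N}"
    and B: "B = {lo m t..hi m t}"
    and dB: "dB = B - interior B"
    and sY: "sY \<in> borel_measurable P"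
        "\<And>\<omega>. \<omega> \<in> space P \<Longrightarrow>
          is_arg_max (\<lambda>s. (norm (awt psi f t s + W t s \<omega>))\<^sup>2) (\<lambda>s. s \<in> B) (sY \<omega>)"
    and "closest_inflection_points (scalogram psi f t) (sf m t) ilo ihi"
    and "B \<subseteq> {ilo<..<ihi}"
    and L: "L = (INF s\<in>B. \<bar>deriv (deriv (scalogram psi f t)) s\<bar>)"
    and mu_m: "mu_m = mu_const P B (awt psi f t) (W t)"
    and sigma2_m: "sigma2_m = sigma2_const P B (awt psi f t) (W t)"
    and Delta: "Delta = norm (awt psi f t (sf m t)) - (SUP s\<in>dB. norm (awt psi f t s))"
    and mu: "mu = (LINT \<omega>|P. norm (W t (sf m t) \<omega>)) + (LINT \<omega>|P. (SUP s\<in>dB. norm (W t s \<omega>)))"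
    and sigma: "sigma = sqrt (LINT \<omega>|P. (norm (W t (sf m t) \<omega>))\<^sup>2)
                  + (SUP s\<in>dB. sqrt (LINT \<omega>|P. (norm (W t s \<omega>))\<^sup>2))"
    and "eps > 0"
    and "(INF s\<in>dB. \<bar>s - sf m t\<bar>) > eps"
    and "ereal eps > 6 / ereal L * ereal (Max {mu_m 1, mu_m 2, (mu_m 3)\<^sup>2, (mu_m 4)\<^sup>2})"
  shows "ereal (\<P>(\<omega> in P. \<bar>sY \<omega> - sf m t\<bar> > eps \<bar> sY \<omega> \<in> interior B))
    \<le> inverse (ereal (1 - exp (- ((Delta - mu)\<^sup>2 / sigma\<^sup>2))))
      * ereal ((\<Sum>k = 1..2. exp (- (L\<^sup>2 / sigma2_m k * (eps / 6 - mu_m k / L)\<^sup>2)))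
             + (\<Sum>k = 3..4. exp (- (L / sigma2_m k * (sqrt (eps / 6) - mu_m k / sqrt L)\<^sup>2))))"
proof -
  interpret noise P Phi p
    using assms(1,3) by (simp add: noise_def noise_axioms_def noise_conditions_def)
  define a where "a = lo m t"
  define b where "b = hi m t"
  define r where "r = sf m t"
  define u where "u = awt psi f t"
  define F where "F = scalogram psi f t"
  have bands: "lo k t < hi k t" if "k \<in> {1..N}" for k
    using assms(7) that by (auto simp: scale_bands_def)
  have ab: "a < b" using bands[OF assms(9)] by (simp add: a_def b_def)
  \<comment> \<open>Positivity is given for the lowest band only; it climbs from band
    \<open>N\<close> to band \<open>m\<close> because the bands are ordered.\<close>
  have "0 < lo m t"
  proof (rule inc_induct[of m N "\<lambda>k. 0 < lo k t"])
    show "m \<le> N" using assms(9) by simp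
    show "0 < lo N t" using assms(7) by (simp add: scale_bands_def)
    fix k assume k: "m \<le> k" "k < N" "0 < lo (Suc k) t"
    then have "hi (Suc k) t \<le> lo k t" "lo (Suc k) t < hi (Suc k) t"
      using assms(7,9) bands[of "Suc k"] by (auto simp: scale_bands_def)
    then show "0 < lo k t" using k by linarith
  qed
  then have a0: "0 < a" by (simp add: a_def)
  have Bab: "B = {a..b}" unfolding B a_def b_def ..
  have pos: "{a..b} \<subseteq> {0<..}" using a0 by auto
  have iB: "interior B = {a<..<b}" unfolding Bab by simp
  have dBab: "dB = {a, b}" using ab unfolding dB iB unfolding Bab by auto
  have ridge: "r \<in> {a..b}" "deriv F r = 0" "deriv (deriv F) r < 0"
    using assms(8,9) unfolding ridge_points_def is_arg_max_def F_def r_def a_def b_def by auto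
  have reg: "u C1_differentiable_on {0<..}" "deriv F C1_differentiable_on {0<..}"
    using assms(5) by (auto simp: awt_regular_def u_def F_def)
  note uC = C1_differentiable_onD[OF reg(1)] and FC = C1_differentiable_onD[OF reg(2)]
  have F_eq: "F = (\<lambda>s. (norm (u s))\<^sup>2)" by (simp add: F_def u_def scalogram_def fun_eq_iff)
  have F1: "(F has_real_derivative deriv F s) (at s)" if "0 < s" for s
    using norm_power2_has_derivative[OF uC(1)[of s]] that DERIV_imp_deriv unfolding F_eq by fastforce
  have F2: "(deriv F has_real_derivative deriv (deriv F) s) (at s)"
    and F2v: "vector_derivative (deriv F) (at s) = deriv (deriv F) s" if "0 < s" for s
  proof -
    have D: "(deriv F has_real_derivative vector_derivative (deriv F) (at s)) (at s)"
      using FC(1)[of s] that by (simp add: has_real_derivative_iff_has_vector_derivative)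
    then show "(deriv F has_real_derivative deriv (deriv F) s) (at s)"
      and "vector_derivative (deriv F) (at s) = deriv (deriv F) s" using DERIV_imp_deriv[OF D] by auto
  qed
  have cF2: "continuous_on {a..b} (deriv (deriv F))"
    using continuous_on_subset[OF FC(2) pos] a0 by (subst (asm) continuous_on_cong[OF refl F2v]) auto
  have Lle: "L \<le> \<bar>deriv (deriv F) s\<bar>" if "s \<in> {a..b}" for s
    unfolding L F_def[symmetric] Bab by (rule cINF_lower) (use that in \<open>auto intro: bdd_belowI[of _ 0]\<close>)
  have L0: "0 \<le> L" unfolding L Bab using ab by (intro cINF_greatest) auto
  have WC: "(\<lambda>s. W t s x) C1_differentiable_on {0<..}" if "x \<in> space P" for x
    using assms(6) that by (simp add: awt_version_def)
  note WD = C1_differentiable_onD[OF WC]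
  have fW: "circ_family P {0<..} (W t)"
    using assms(4,6) by (intro awt_circ_family[of psi]) (auto simp: regular_analytic_wavelet_def)
  have fW': "circ_family P {0<..} (\<lambda>s x. dscale (\<lambda>s. W t s x) s)"
    by (rule circ_family_derivative[OF fW]) (use WD(1) in auto)
  note f3 = circ_family_mono[OF fW pos] and f4 = circ_family_mono[OF fW' pos]
  note f1 = circ_family_mult[OF f3, of "dscale u"] and f2 = circ_family_mult[OF f4, of u]
  have c3: "continuous_on {a..b} (\<lambda>s. W t s x)" if "x \<in> space P" for x
    by (rule continuous_on_subset[OF WD(3)[OF that] pos])
  have c4: "continuous_on {a..b} (\<lambda>s. dscale (\<lambda>s. W t s x) s)" if "x \<in> space P" for x
    by (rule continuous_on_subset[OF WD(2)[OF that] pos])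
  have c1: "continuous_on {a..b} (\<lambda>s. dscale u s * W t s x)" if "x \<in> space P" for x
    by (intro continuous_on_mult c3 that continuous_on_subset[OF uC(2) pos])
  have c2: "continuous_on {a..b} (\<lambda>s. u s * dscale (\<lambda>s. W t s x) s)" if "x \<in> space P" for x
    by (intro continuous_on_mult c4 that continuous_on_subset[OF uC(3) pos])
  define X1 where "X1 x = (SUP s\<in>{a..b}. norm (dscale u s * W t s x))" for x
  define X2 where "X2 x = (SUP s\<in>{a..b}. norm (u s * dscale (\<lambda>s. W t s x) s))" for x
  define X3 where "X3 x = (SUP s\<in>{a..b}. norm (W t s x))" for x
  define X4 where "X4 x = (SUP s\<in>{a..b}. norm (dscale (\<lambda>s. W t s x) s))" for x
  have m: "mu_m 1 = expectation X1" "mu_m 2 = expectation X2" "mu_m 3 = expectation X3" "mu_m 4 = expectation X4"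
    unfolding mu_m mu_const_def Bab u_def[symmetric] X1_def X2_def X3_def X4_def by simp_all
  have sg: "sigma2_m 1 = (SUP s\<in>{a..b}. (LINT x|P. (norm (dscale u s * W t s x))\<^sup>2))"
    "sigma2_m 2 = (SUP s\<in>{a..b}. (LINT x|P. (norm (u s * dscale (\<lambda>s. W t s x) s))\<^sup>2))"
    "sigma2_m 3 = (SUP s\<in>{a..b}. (LINT x|P. (norm (W t s x))\<^sup>2))"
    "sigma2_m 4 = (SUP s\<in>{a..b}. (LINT x|P. (norm (dscale (\<lambda>s. W t s x) s))\<^sup>2))"
    unfolding sigma2_m sigma2_const_def Bab u_def[symmetric] by (simp_all add: norm_mult power_mult_distrib)
  note S1 = circ_SUP[OF less_imp_le[OF ab] f1 c1, folded X1_def sg(1) m(1), folded X1_def[abs_def]]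
  note S2 = circ_SUP[OF less_imp_le[OF ab] f2 c2, folded X2_def sg(2) m(2), folded X2_def[abs_def]]
  note S3 = circ_SUP[OF less_imp_le[OF ab] f3 c3, folded X3_def sg(3) m(3), folded X3_def[abs_def]]
  note S4 = circ_SUP[OF less_imp_le[OF ab] f4 c4, folded X4_def sg(4) m(4), folded X4_def[abs_def]]
  note [measurable] = S1(1) S2(1) S3(1) S4(1) sY(1)
  define R where "R = (\<Sum>k = 1..2. exp (- (L\<^sup>2 / sigma2_m k * (eps / 6 - mu_m k / L)\<^sup>2)))
             + (\<Sum>k = 3..4. exp (- (L / sigma2_m k * (sqrt (eps / 6) - mu_m k / sqrt L)\<^sup>2)))"
  have R_eq: "R = exp (- (L\<^sup>2 / sigma2_m 1 * (eps / 6 - mu_m 1 / L)\<^sup>2)) + exp (- (L\<^sup>2 / sigma2_m 2 * (eps / 6 - mu_m 2 / L)\<^sup>2))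
     + (exp (- (L / sigma2_m 3 * (sqrt (eps / 6) - mu_m 3 / sqrt L)\<^sup>2)) + exp (- (L / sigma2_m 4 * (sqrt (eps / 6) - mu_m 4 / sqrt L)\<^sup>2)))"
    by (simp add: R_def eval_nat_numeral sum.atLeast_Suc_atMost)
  have R0: "0 < R" unfolding R_eq by (intro add_pos_pos exp_gt_zero)
  let ?I = "{x \<in> space P. sY x \<in> interior B}"
  let ?A = "{x \<in> space P. \<bar>sY x - sf m t\<bar> > eps \<and> sY x \<in> interior B}"
  have [measurable]: "?I \<in> events" "?A \<in> events" unfolding iB by measurable
  have cp: "\<P>(x in P. \<bar>sY x - sf m t\<bar> > eps \<bar> sY x \<in> interior B) = prob ?A / prob ?I"
    by (simp add: cond_prob_def)
  have AI: "prob ?A \<le> prob ?I" by (rule finite_measure_mono) auto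
  have "prob ?A / prob ?I \<le> R"
  \<comment> \<open>Without curvature the prefactors \<open>L\<^sup>2\<close> and \<open>L\<close>
    annihilate all four exponents. Then \<open>R = 4\<close>, more than any probability.\<close>
  proof (cases "L = 0")
    case True
    then have "R = 4" unfolding R_eq by simp
    moreover have "prob ?A / prob ?I \<le> 1" using AI by (cases "prob ?I = 0") (auto simp: field_simps zero_less_measure_iff)
    ultimately show ?thesis by linarith
  next
    case False
    then have L: "0 < L" using L0 by simp
    have eps: "0 < eps" by (rule assms(22))
    \<comment> \<open>A deviation beyond \<open>eps\<close> forces
      \<open>6 * T < 2 * (X1 x + X2 x + X3 x * X4 x)\<close>. One of the three summands therefore
      exceeds \<open>T\<close>, and in the case of the product one factor exceeds
      \<open>sqrt T\<close>; this is the origin of the constant 6.\<close>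
    define T where "T = L * eps / 6"
    have T: "0 < T" using L eps by (simp add: T_def)
    let ?M = "Max {mu_m 1, mu_m 2, (mu_m 3)\<^sup>2, (mu_m 4)\<^sup>2}"
    have "6 / ereal L * ereal x = ereal (6 / L * x)" for x
      using L by (simp add: numeral_eq_ereal)
    then have "6 / L * ?M < eps" using assms(24) by (simp only: less_ereal.simps)
    then have M: "?M < T" using L by (simp add: T_def field_simps)
    have mT: "mu_m 1 \<le> T" "mu_m 2 \<le> T" "(mu_m 3)\<^sup>2 \<le> T" "(mu_m 4)\<^sup>2 \<le> T"
      using M by (simp_all del: One_nat_def)
    have mS: "mu_m 3 \<le> sqrt T" "mu_m 4 \<le> sqrt T" using mT by (auto intro: real_le_rsqrt)
    \<comment> \<open>Rescaling by \<open>L\<close>, or by \<open>sqrt L\<close>, turns the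
      exponents of the statement into those of \<open>circ_SUP\<close> at the thresholds
      \<open>T\<close> and \<open>sqrt T\<close>.\<close>
    have x1: "L\<^sup>2 / v * (eps / 6 - q / L)\<^sup>2 = (T - q)\<^sup>2 / v" for v q
    proof -
      have "L\<^sup>2 * (eps / 6 - q / L)\<^sup>2 = (L * (eps / 6 - q / L))\<^sup>2" by (simp add: power_mult_distrib)
      also have "L * (eps / 6 - q / L) = T - q" using L by (simp add: T_def right_diff_distrib)
      finally show ?thesis by simp
    qed
    have x2: "L / v * (sqrt (eps / 6) - q / sqrt L)\<^sup>2 = (sqrt T - q)\<^sup>2 / v" for v q
    proof -
      have "L * (sqrt (eps / 6) - q / sqrt L)\<^sup>2 = (sqrt L * (sqrt (eps / 6) - q / sqrt L))\<^sup>2"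
        using L by (simp add: power_mult_distrib)
      also have "sqrt L * (sqrt (eps / 6) - q / sqrt L) = sqrt T - q"
        using L by (simp add: T_def right_diff_distrib real_sqrt_mult real_sqrt_divide)
      finally show ?thesis by simp
    qed
    let ?E1 = "{x \<in> space P. X1 x > T}" and ?E2 = "{x \<in> space P. X2 x > T}"
    let ?E3 = "{x \<in> space P. X3 x > sqrt T}" and ?E4 = "{x \<in> space P. X4 x > sqrt T}"
    have "prob ((?E1 \<union> ?E2) \<union> (?E3 \<union> ?E4)) \<le> (prob ?E1 + prob ?E2) + (prob ?E3 + prob ?E4)"
      by (intro order.trans[OF measure_Un_le] add_mono measure_Un_le) auto
    also have "\<dots> \<le> R" unfolding R_eq x1 x2
      by (intro add_mono S1(3) S2(3) S3(3) S4(3) mT mS)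
    finally have ER: "prob ((?E1 \<union> ?E2) \<union> (?E3 \<union> ?E4)) \<le> R" .
    \<comment> \<open>Both endpoints are farther than \<open>eps\<close> from the ridge point, so a
      maximiser at an endpoint counts as a large deviation too.\<close>
    have near: "\<bar>a - r\<bar> > eps" "\<bar>b - r\<bar> > eps"
    proof -
      have "(INF s\<in>dB. \<bar>s - sf m t\<bar>) \<le> \<bar>a - r\<bar>" "(INF s\<in>dB. \<bar>s - sf m t\<bar>) \<le> \<bar>b - r\<bar>"
        unfolding r_def by (rule cINF_lower; use dBab in simp)+
      then show "\<bar>a - r\<bar> > eps" "\<bar>b - r\<bar> > eps" using assms(23) by linarith+
    qed
    have sub: "?A \<union> (space P - ?I) \<subseteq> (?E1 \<union> ?E2) \<union> (?E3 \<union> ?E4)"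
    proof
      fix x assume x: "x \<in> ?A \<union> (space P - ?I)"
      then have s: "x \<in> space P" by auto
      have y: "sY x \<in> {a..b}" and ymax: "\<And>s. s \<in> {a..b} \<Longrightarrow> (norm (u s + W t s x))\<^sup>2 \<le> (norm (u (sY x) + W t (sY x) x))\<^sup>2"
        using sY(2)[OF s] unfolding is_arg_max_def Bab u_def by (auto simp: not_less)
      have far: "eps < \<bar>sY x - r\<bar>"
      proof (cases "sY x \<in> interior B")
        case True
        then show ?thesis using x by (auto simp: r_def)
      next
        case False
        then have "sY x = a \<or> sY x = b" using y unfolding iB by auto
        then show ?thesis using near by auto
      qed
      let ?y = "sY x"
      have "L * \<bar>?y - r\<bar> \<le> 2 * (norm (dscale u ?y * W t ?y x) + norm (u ?y * dscale (\<lambda>s. W t s x) ?y)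
          + norm (W t ?y x) * norm (dscale (\<lambda>s. W t s x) ?y))"
        by (rule perturbed_ridge[where a=a and b=b and F'="deriv F" and F''="deriv (deriv F)"])
          (use uC(1) WD(1)[OF s] F1 F2 cF2 L Lle ridge y ymax pos F_eq in auto)
      also have "\<dots> \<le> 2 * (X1 x + X2 x + X3 x * X4 x)"
        using S1(2)[OF _ s y] S2(2)[OF _ s y] S3(2)[OF _ s y] S4(2)[OF _ s y]
        by (intro mult_left_mono add_mono mult_mono) (auto intro: order.trans[OF norm_ge_zero])
      finally have q: "L * \<bar>?y - r\<bar> \<le> 2 * (X1 x + X2 x + X3 x * X4 x)" .
      have "6 * T < L * \<bar>?y - r\<bar>" using far L by (simp add: T_def)
      from less_le_trans[OF this q] have Q: "3 * T < X1 x + X2 x + X3 x * X4 x" by simp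
      show "x \<in> (?E1 \<union> ?E2) \<union> (?E3 \<union> ?E4)"
      proof (rule ccontr)
        assume "x \<notin> (?E1 \<union> ?E2) \<union> (?E3 \<union> ?E4)"
        then have le: "X1 x \<le> T" "X2 x \<le> T" "X3 x \<le> sqrt T" "X4 x \<le> sqrt T" using s by (auto simp: not_less)
        have "0 \<le> X4 x" by (rule order.trans[OF norm_ge_zero S4(2)[OF _ s y]])
        then have "X3 x * X4 x \<le> sqrt T * sqrt T" using le T by (intro mult_mono) auto
        then show False using Q le T by simp
      qed
    qed
    have "prob ?A + (1 - prob ?I) = prob ?A + prob (space P - ?I)" by (simp add: prob_compl)
    also have "\<dots> = prob (?A \<union> (space P - ?I))" by (rule finite_measure_Union[symmetric]) auto
    also have "\<dots> \<le> prob ((?E1 \<union> ?E2) \<union> (?E3 \<union> ?E4))" by (rule finite_measure_mono[OF sub]) auto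
    also note ER
    finally show ?thesis by (intro conditional_le AI) auto
  qed
  then have main: "\<P>(x in P. \<bar>sY x - sf m t\<bar> > eps \<bar> sY x \<in> interior B) \<le> R" unfolding cp .
  define q where "q = 1 - exp (- ((Delta - mu)\<^sup>2 / sigma\<^sup>2))"
  have q: "0 \<le> q" "q \<le> 1" by (auto simp: q_def)
  have "ereal R \<le> inverse (ereal q) * ereal R"
  \<comment> \<open>\<open>q\<close> vanishes when \<open>Delta = mu\<close>, and also when
    \<open>sigma = 0\<close>, where the quotient has the value \<open>0\<close>. The extended real
    inverse of \<open>0\<close> is infinite, and the strict positivity of \<open>R\<close> keeps the
    product infinite.\<close>
  proof (cases "q = 0")
    case True
    then show ?thesis using R0 by simp
  next
    case False
    then have "0 < q" using q by simp
    then have "R * q \<le> R" using q R0 by simp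
    then show ?thesis using \<open>0 < q\<close> by (simp add: field_simps)
  qed
  with main show ?thesis unfolding R_def[symmetric] q_def[symmetric]
    by (meson ereal_less_eq(3) order.trans)
qed



end
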